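(* Let $\mathbb{K}$ be a commutative ring, let $X$ be a quasimetric space and let $\mathbb{G}\subseteq\mathbb{R}$ be a subgroup such that $d(x,y)\in\mathbb{G}\cup\{\infty\}$ for any points $x,y$ of $X$. For any $\mathbb{G}$-graded distance module $M$ over $X$, any $n\ge 0$ and any $\ell\in\mathbb{G}$, the magnitude cohomology with coefficients in $M$ can be presented as an $\mathrm{Ext}$ in the category $\mathrm{DistMod}_{\mathbb{G}}(X,\mathbb{K})$ of $\mathbb{G}$-graded distance modules: $$\mathrm{MH}^{n,\ell}(X,M)\cong\mathrm{Ext}^n(\tilde{\mathbb{K}},M[\ell]).$$
   Context: Quasimetric space: a set $X$ with $d:X\times X\to[0,\infty]$ such that $d(x,y)+d(y,z)\ge d(x,z)$, and $d(x,y)=0$ iff $x=y$ (no symmetry required). Write $x\preccurlyeq y\preccurlyeq z$ if $d(x,y)+d(y,z)=d(x,z)$. Put $|x_0,\dots,x_n|=\sum_{i=0}^{n-1}d(x_i,x_{i+1})$. Graded modules: an $\mathbb{R}$-graded module is a family $A=(A_g)_{g\in\mathbb{R}}$ of $\mathbb{K}$-modules; a morphism of degree $d$ is a family $A_g\to B_{g+d}$. Shift: $(A[\ell])_g=A_{g-\ell}$. Distance modules: a distance module $M$ over $X$ consists of $\mathbb{R}$-graded $\mathbb{K}$-modules $M(x)$, $x\in X$, and morphisms $M(x,y):M(x)\to M(y)$ of degree $d(x,y)$ for each pair with $d(x,y)<\infty$, such that $M(x,x)=1_{M(x)}$ and, whenever $d(x,y),d(y,z)<\infty$, $M(y,z)\circ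 M(x,y)=M(x,z)$ if $x\preccurlyeq y\preccurlyeq z$ and $=0$ otherwise. For $m\in M(x)_\ell$ write $m\cdot y:=M(x,y)(m)$. A morphism $\varphi:M\to N$ is a family of degree $0$ morphisms $\varphi(x):M(x)\to N(x)$ with $\varphi(x)(m)\cdot y=\varphi(y)(m\cdot y)$ for $m$ over $x$ and $d(x,y)<\infty$. $\mathrm{DistMod}_{\mathbb{G}}(X,\mathbb{K})$ is the full subcategory of those $M$ with $M(x)_\ell=0$ for all $x$ and all $\ell\in\mathbb{R}\setminus\mathbb{G}$ ($\mathbb{G}$-graded distance modules); it is abelian with componentwise exactness, with enough projectives and injectives. The shift $M[\ell]$ is taken pointwise: $M[\ell](x)=M(x)[\ell]$. The trivial distance module $\tilde{\mathbb{K}}$ has $\tilde{\mathbb{K}}(x)=\mathbb{K}$ concentrated in degree $0$ for all $x$, and $\tilde{\mathbb{K}}(x,y)=0$ for $x\ne y$. Magnitude cohomology with coefficients in $M$: let $\widetilde{\mathrm{MC}}^{\bullet,\ell}(X,M)$ be the cosimplicial $\mathbb{K}$-module with $$\widetilde{\mathrm{MC}}^{n,\ell}(X,M)=\prod_{|x_0,\dots,x_n|<\infty}M(x_n)_{-\ell+|x_0,\dots,x_n|},$$ where $\alpha(x_0,\dots,x_n)$ denotes the component of $\alpha$ at $(x_0,\dots,x_n)$. Cofaces $d^i$, $0\le i\le n+1$: for $0<i<n+1$, $d^i(\alpha)(x_0,\dots,x_{n+1})=\alpha(x_0,\dots,\hat x_i,\dots,x_{n+1})$ if $x_{i-1}\preccurlyeq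 x_i\preccurlyeq x_{i+1}$ and $0$ otherwise; $d^0(\alpha)(x_0,\dots,x_{n+1})=\alpha(x_1,\dots,x_{n+1})$ if $x_0=x_1$ and $0$ otherwise; $d^{n+1}(\alpha)(x_0,\dots,x_{n+1})=\alpha(x_0,\dots,x_n)\cdot x_{n+1}$. Codegeneracies: $s^i(\alpha)(x_0,\dots,x_{n-1})=\alpha(x_0,\dots,x_i,x_i,\dots,x_{n-1})$. $\mathrm{MH}^{n,\ell}(X,M)$ is the $n$-th cohomology of the associated normalised cochain complex (equivalently of the unnormalised one). *)

theory Defs
  imports "HOL-Library.Extended_Nonnegative_Real" "HOL-Algebra.Module" "HOL-Algebra.AbelCoset"
begin

section \<open>Quasimetric spaces\<close>

locale quasimetric_space =
  fixes X :: "'x set" and d :: "'x \<Rightarrow> 'x \<Rightarrow> ennreal"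
  assumes triangle: "\<lbrakk>x \<in> X; y \<in> X; z \<in> X\<rbrakk> \<Longrightarrow> d x z \<le> d x y + d y z"
    and dist_zero_iff: "\<lbrakk>x \<in> X; y \<in> X\<rbrakk> \<Longrightarrow> d x y = 0 \<longleftrightarrow> x = y"

definition between :: "('x \<Rightarrow> 'x \<Rightarrow> ennreal) \<Rightarrow> 'x \<Rightarrow> 'x \<Rightarrow> 'x \<Rightarrow> bool" where
  "between d x y z \<longleftrightarrow> d x y + d y z = d x z"

definition chain_length :: "('x \<Rightarrow> 'x \<Rightarrow> ennreal) \<Rightarrow> 'x list \<Rightarrow> ennreal" where
  "chain_length d xs = (\<Sum>i<length xs - 1. d (xs ! i) (xs ! Suc i))"

text \<open>The real number underlying a finite distance; it is only used when \<open>d x y < \<infinity>\<close>.\<close>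

abbreviation rdist :: "('x \<Rightarrow> 'x \<Rightarrow> ennreal) \<Rightarrow> 'x \<Rightarrow> 'x \<Rightarrow> real" where
  "rdist d x y \<equiv> enn2real (d x y)"

definition real_add_group :: "real monoid" where
  "real_add_group = \<lparr>carrier = UNIV, mult = (+), one = 0\<rparr>"


section \<open>Linear maps and cohomology of cochain complexes of modules\<close>

definition linear_maps ::
  "('k, 'z) ring_scheme \<Rightarrow> ('k, 'a) module \<Rightarrow> ('k, 'b) module \<Rightarrow> ('a \<Rightarrow> 'b) set" where
  "linear_maps K M N = {f \<in> carrier M \<rightarrow> carrier N.
     (\<forall>u\<in>carrier M. \<forall>v\<in>carrier M. f (u \<oplus>\<^bsub>M\<^esub> v) = f u \<oplus>\<^bsub>N\<^esub> f v) \<and>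
     (\<forall>c\<in>carrier K. \<forall>u\<in>carrier M. f (c \<odot>\<^bsub>M\<^esub> u) = c \<odot>\<^bsub>N\<^esub> f u)}"

definition module_iso ::
  "('k, 'z) ring_scheme \<Rightarrow> ('k, 'a) module \<Rightarrow> ('k, 'b) module \<Rightarrow> bool" where
  "module_iso K M N \<longleftrightarrow> (\<exists>f \<in> linear_maps K M N. bij_betw f (carrier M) (carrier N))"

definition cocycles ::
  "(nat \<Rightarrow> ('k, 'c) module) \<Rightarrow> (nat \<Rightarrow> 'c \<Rightarrow> 'c) \<Rightarrow> nat \<Rightarrow> 'c set" where
  "cocycles C \<delta> n = {z \<in> carrier (C n). \<delta> n z = \<zero>\<^bsub>C (Suc n)\<^esub>}"

definition coboundaries ::
  "(nat \<Rightarrow> ('k, 'c) module) \<Rightarrow> (nat \<Rightarrow> 'c \<Rightarrow> 'c) \<Rightarrow> nat \<Rightarrow> 'c set" where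
  "coboundaries C \<delta> n = (case n of 0 \<Rightarrow> {\<zero>\<^bsub>C 0\<^esub>} | Suc m \<Rightarrow> \<delta> m ` carrier (C m))"

text \<open>
  The quotient module of the cocycles by the coboundaries, realised on cosets. A \<open>module\<close> record
  formally contains ring multiplication fields; they play no role for modules and are left
  \<open>undefined\<close> here and below.
\<close>

definition cohomology ::
  "(nat \<Rightarrow> ('k, 'c) module) \<Rightarrow> (nat \<Rightarrow> 'c \<Rightarrow> 'c) \<Rightarrow> nat \<Rightarrow> ('k, 'c set) module" where
  "cohomology C \<delta> n =
     \<lparr>carrier = (\<lambda>z. coboundaries C \<delta> n +>\<^bsub>C n\<^esub> z) ` cocycles C \<delta> n,
      mult = undefined, one = undefined,
      zero = coboundaries C \<delta> n,
      add = (\<lambda>U V. U <+>\<^bsub>C n\<^esub> V),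
      smult = (\<lambda>c U. coboundaries C \<delta> n <+>\<^bsub>C n\<^esub> ((\<lambda>u. c \<odot>\<^bsub>C n\<^esub> u) ` U))\<rparr>"


section \<open>Distance modules\<close>

text \<open>
  \<open>fib M x g\<close> is the \<open>K\<close>-module \<open>M(x)\<^sub>g\<close>, and \<open>act M x y g\<close> is the component
  \<open>M(x)\<^sub>g \<rightarrow> M(y)\<^sub>g\<^sub>+\<^sub>d\<^sub>(\<^sub>x\<^sub>,\<^sub>y\<^sub>)\<close> of \<open>M(x,y)\<close>.
\<close>

record ('x, 'k, 'm) distance_module =
  fib :: "'x \<Rightarrow> real \<Rightarrow> ('k, 'm) module"
  act :: "'x \<Rightarrow> 'x \<Rightarrow> real \<Rightarrow> 'm \<Rightarrow> 'm"

definition is_distance_module ::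
  "('k, 'z) ring_scheme \<Rightarrow> 'x set \<Rightarrow> ('x \<Rightarrow> 'x \<Rightarrow> ennreal) \<Rightarrow>
   ('x, 'k, 'm) distance_module \<Rightarrow> bool" where
  "is_distance_module K X d M \<longleftrightarrow>
     (\<forall>x\<in>X. \<forall>g. module K (fib M x g)) \<and>
     (\<forall>x\<in>X. \<forall>y\<in>X. d x y < \<infinity> \<longrightarrow>
        (\<forall>g. act M x y g \<in> linear_maps K (fib M x g) (fib M y (g + rdist d x y)))) \<and>
     (\<forall>x\<in>X. \<forall>g. \<forall>m\<in>carrier (fib M x g). act M x x g m = m) \<and>
     (\<forall>x\<in>X. \<forall>y\<in>X. \<forall>z\<in>X. d x y < \<infinity> \<longrightarrow> d y z < \<infinity> \<longrightarrow>
        (\<forall>g. \<forall>m\<in>carrier (fib M x g).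
           act M y z (g + rdist d x y) (act M x y g m) =
             (if between d x y z then act M x z g m
              else \<zero>\<^bsub>fib M z (g + rdist d x y + rdist d y z)\<^esub>)))"

definition graded_distance_module ::
  "('k, 'z) ring_scheme \<Rightarrow> 'x set \<Rightarrow> ('x \<Rightarrow> 'x \<Rightarrow> ennreal) \<Rightarrow> real set \<Rightarrow>
   ('x, 'k, 'm) distance_module \<Rightarrow> bool" where
  "graded_distance_module K X d G M \<longleftrightarrow>
     is_distance_module K X d M \<and>
     (\<forall>x\<in>X. \<forall>g. g \<notin> G \<longrightarrow> carrier (fib M x g) = {\<zero>\<^bsub>fib M x g\<^esub>})"

definition shift ::
  "('x, 'k, 'm) distance_module \<Rightarrow> real \<Rightarrow> ('x, 'k, 'm) distance_module" where
  "shift M l = \<lparr>fib = (\<lambda>x g. fib M x (g - l)), act = (\<lambda>x y g. act M x y (g - l))\<rparr>"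

definition trivial_distance_module ::
  "('k, 'z) ring_scheme \<Rightarrow> ('x, 'k, 'k) distance_module" where
  "trivial_distance_module K =
     \<lparr>fib = (\<lambda>x g. \<lparr>carrier = (if g = 0 then carrier K else {\<zero>\<^bsub>K\<^esub>}),
                mult = undefined, one = undefined,
                zero = \<zero>\<^bsub>K\<^esub>, add = add K, smult = monoid.mult K\<rparr>),
      act = (\<lambda>x y g m. if x = y then m else \<zero>\<^bsub>K\<^esub>)\<rparr>"

text \<open>
  Morphisms are required to be \<open>undefined\<close> outside the carriers, so that equality of
  morphisms is equality of functions and the morphisms form a genuine \<open>K\<close>-module.
\<close>

definition dm_hom ::
  "('k, 'z) ring_scheme \<Rightarrow> 'x set \<Rightarrow> ('x \<Rightarrow> 'x \<Rightarrow> ennreal) \<Rightarrow>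
   ('x, 'k, 'a) distance_module \<Rightarrow> ('x, 'k, 'b) distance_module \<Rightarrow>
   ('x \<Rightarrow> real \<Rightarrow> 'a \<Rightarrow> 'b) set" where
  "dm_hom K X d M N = {\<phi> \<in> extensional X.
     (\<forall>x\<in>X. \<forall>g. \<phi> x g \<in> linear_maps K (fib M x g) (fib N x g) \<inter> extensional (carrier (fib M x g))) \<and>
     (\<forall>x\<in>X. \<forall>y\<in>X. d x y < \<infinity> \<longrightarrow> (\<forall>g. \<forall>m\<in>carrier (fib M x g).
        act N x y g (\<phi> x g m) = \<phi> y (g + rdist d x y) (act M x y g m)))}"

definition dm_fun ::
  "'x set \<Rightarrow> ('x, 'k, 'a) distance_module \<Rightarrow> ('x \<Rightarrow> real \<Rightarrow> 'a \<Rightarrow> 'b) \<Rightarrow>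
   'x \<Rightarrow> real \<Rightarrow> 'a \<Rightarrow> 'b" where
  "dm_fun X M f = (\<lambda>x\<in>X. \<lambda>g. \<lambda>m\<in>carrier (fib M x g). f x g m)"

definition dm_comp ::
  "'x set \<Rightarrow> ('x, 'k, 'a) distance_module \<Rightarrow> ('x \<Rightarrow> real \<Rightarrow> 'b \<Rightarrow> 'c) \<Rightarrow>
   ('x \<Rightarrow> real \<Rightarrow> 'a \<Rightarrow> 'b) \<Rightarrow> 'x \<Rightarrow> real \<Rightarrow> 'a \<Rightarrow> 'c" where
  "dm_comp X M \<psi> \<phi> = dm_fun X M (\<lambda>x g m. \<psi> x g (\<phi> x g m))"

definition dm_hom_module ::
  "('k, 'z) ring_scheme \<Rightarrow> 'x set \<Rightarrow> ('x \<Rightarrow> 'x \<Rightarrow> ennreal) \<Rightarrow>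
   ('x, 'k, 'a) distance_module \<Rightarrow> ('x, 'k, 'b) distance_module \<Rightarrow>
   ('k, 'x \<Rightarrow> real \<Rightarrow> 'a \<Rightarrow> 'b) module" where
  "dm_hom_module K X d M N =
     \<lparr>carrier = dm_hom K X d M N, mult = undefined, one = undefined,
      zero = dm_fun X M (\<lambda>x g m. \<zero>\<^bsub>fib N x g\<^esub>),
      add = (\<lambda>\<phi> \<psi>. dm_fun X M (\<lambda>x g m. \<phi> x g m \<oplus>\<^bsub>fib N x g\<^esub> \<psi> x g m)),
      smult = (\<lambda>c \<phi>. dm_fun X M (\<lambda>x g m. c \<odot>\<^bsub>fib N x g\<^esub> \<phi> x g m))\<rparr>"


section \<open>Ext in the category of graded distance modules\<close>

text \<open>Epimorphisms are the componentwise surjective morphisms, as exactness is componentwise.\<close>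

definition dm_surj ::
  "'x set \<Rightarrow> ('x, 'k, 'a) distance_module \<Rightarrow> ('x, 'k, 'b) distance_module \<Rightarrow>
   ('x \<Rightarrow> real \<Rightarrow> 'a \<Rightarrow> 'b) \<Rightarrow> bool" where
  "dm_surj X M N \<phi> \<longleftrightarrow>
     (\<forall>x\<in>X. \<forall>g. \<phi> x g ` carrier (fib M x g) = carrier (fib N x g))"

definition dm_exact ::
  "'x set \<Rightarrow> ('x, 'k, 'a) distance_module \<Rightarrow> ('x, 'k, 'b) distance_module \<Rightarrow>
   ('x, 'k, 'c) distance_module \<Rightarrow> ('x \<Rightarrow> real \<Rightarrow> 'a \<Rightarrow> 'b) \<Rightarrow>
   ('x \<Rightarrow> real \<Rightarrow> 'b \<Rightarrow> 'c) \<Rightarrow> bool" where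
  "dm_exact X L M N \<phi> \<psi> \<longleftrightarrow>
     (\<forall>x\<in>X. \<forall>g. \<phi> x g ` carrier (fib L x g) =
        {m \<in> carrier (fib M x g). \<psi> x g m = \<zero>\<^bsub>fib N x g\<^esub>})"

text \<open>
  The lifting property, for test objects \<open>B\<close>, \<open>C\<close> whose elements lie in the same type \<open>'p\<close> as those
  of \<open>P\<close>. This is projectivity in the category of all graded distance modules as soon as
  \<open>'p\<close> is infinite and at least as large as \<open>'x\<close>, \<open>real\<close> and \<open>'k\<close>: the
  canonical epimorphism onto \<open>P\<close> from a direct sum of (shifted) representable distance modules
  can then be realised in \<open>'p\<close>, so the lifting property makes \<open>P\<close> a retract of that sum.
  The definition is only used for such \<open>'p\<close>.
\<close>

definition dm_projective ::
  "('k, 'z) ring_scheme \<Rightarrow> 'x set \<Rightarrow> ('x \<Rightarrow> 'x \<Rightarrow> ennreal) \<Rightarrow> real set \<Rightarrow>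
   ('x, 'k, 'p) distance_module \<Rightarrow> bool" where
  "dm_projective K X d G P \<longleftrightarrow>
     graded_distance_module K X d G P \<and>
     (\<forall>(B :: ('x, 'k, 'p) distance_module) (C :: ('x, 'k, 'p) distance_module) e f.
        graded_distance_module K X d G B \<longrightarrow> graded_distance_module K X d G C \<longrightarrow>
        e \<in> dm_hom K X d B C \<longrightarrow> dm_surj X B C e \<longrightarrow> f \<in> dm_hom K X d P C \<longrightarrow>
        (\<exists>h \<in> dm_hom K X d P B. dm_comp X P e h = f))"

text \<open>\<open>\<dots> \<rightarrow> P 2 \<rightarrow> P 1 \<rightarrow> P 0 \<rightarrow> A \<rightarrow> 0\<close> with \<open>D n : P (n+1) \<rightarrow> P n\<close> and \<open>\<epsilon> : P 0 \<rightarrow> A\<close>.\<close>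

definition projective_resolution ::
  "('k, 'z) ring_scheme \<Rightarrow> 'x set \<Rightarrow> ('x \<Rightarrow> 'x \<Rightarrow> ennreal) \<Rightarrow> real set \<Rightarrow>
   ('x, 'k, 'a) distance_module \<Rightarrow> (nat \<Rightarrow> ('x, 'k, 'p) distance_module) \<Rightarrow>
   (nat \<Rightarrow> 'x \<Rightarrow> real \<Rightarrow> 'p \<Rightarrow> 'p) \<Rightarrow> ('x \<Rightarrow> real \<Rightarrow> 'p \<Rightarrow> 'a) \<Rightarrow> bool" where
  "projective_resolution K X d G A P D \<epsilon> \<longleftrightarrow>
     (\<forall>n. dm_projective K X d G (P n)) \<and>
     (\<forall>n. D n \<in> dm_hom K X d (P (Suc n)) (P n)) \<and>
     \<epsilon> \<in> dm_hom K X d (P 0) A \<and>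
     dm_surj X (P 0) A \<epsilon> \<and>
     dm_exact X (P (Suc 0)) (P 0) A (D 0) \<epsilon> \<and>
     (\<forall>n. dm_exact X (P (Suc (Suc n))) (P (Suc n)) (P n) (D (Suc n)) (D n))"

text \<open>
  Lists over \<open>'x + real + 'k + 'a\<close> form an infinite type, at least as large as \<open>'x\<close>, \<open>real\<close>, \<open>'k\<close> and
  \<open>'a\<close>, into which finite formal linear combinations of its own elements can be coded injectively.
  Hence every graded distance module with elements in \<open>'a\<close> has a projective resolution
  by graded distance modules with elements in this type.
\<close>

type_synonym ('x, 'k, 'a) resolution_elem = "('x + real + 'k + 'a) list"

text \<open>
  \<open>Ext\<^sup>n(A,B)\<close> is the cohomology of \<open>Hom(P,B)\<close> for a chosen projective resolution \<open>P\<close> of \<open>A\<close>;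
  up to isomorphism it does not depend on the choice.
\<close>

definition Ext ::
  "('k, 'z) ring_scheme \<Rightarrow> 'x set \<Rightarrow> ('x \<Rightarrow> 'x \<Rightarrow> ennreal) \<Rightarrow> real set \<Rightarrow> nat \<Rightarrow>
   ('x, 'k, 'a) distance_module \<Rightarrow> ('x, 'k, 'b) distance_module \<Rightarrow>
   ('k, ('x \<Rightarrow> real \<Rightarrow> ('x, 'k, 'a) resolution_elem \<Rightarrow> 'b) set) module" where
  "Ext K X d G n A B =
     (let (P, D, \<epsilon>) = (SOME (P, D, \<epsilon>). projective_resolution K X d G A P D \<epsilon>)
      in cohomology (\<lambda>i. dm_hom_module K X d (P i) B)
           (\<lambda>i \<phi>. dm_comp X (P (Suc i)) \<phi> (D i)) n)"


section \<open>Magnitude cohomology with coefficients\<close>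

definition finite_chains :: "'x set \<Rightarrow> ('x \<Rightarrow> 'x \<Rightarrow> ennreal) \<Rightarrow> nat \<Rightarrow> 'x list set" where
  "finite_chains X d n = {xs. length xs = Suc n \<and> set xs \<subseteq> X \<and> chain_length d xs < \<infinity>}"

definition mc_degree :: "('x \<Rightarrow> 'x \<Rightarrow> ennreal) \<Rightarrow> real \<Rightarrow> 'x list \<Rightarrow> real" where
  "mc_degree d l xs = - l + enn2real (chain_length d xs)"

definition mc_coeff ::
  "('x \<Rightarrow> 'x \<Rightarrow> ennreal) \<Rightarrow> ('x, 'k, 'm) distance_module \<Rightarrow> real \<Rightarrow> 'x list \<Rightarrow> ('k, 'm) module" where
  "mc_coeff d M l xs = fib M (last xs) (mc_degree d l xs)"

definition MC ::
  "'x set \<Rightarrow> ('x \<Rightarrow> 'x \<Rightarrow> ennreal) \<Rightarrow> ('x, 'k, 'm) distance_module \<Rightarrow> real \<Rightarrow> nat \<Rightarrow>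
   ('k, 'x list \<Rightarrow> 'm) module" where
  "MC X d M l n =
     \<lparr>carrier = (\<Pi>\<^sub>E xs\<in>finite_chains X d n. carrier (mc_coeff d M l xs)),
      mult = undefined, one = undefined,
      zero = (\<lambda>xs\<in>finite_chains X d n. \<zero>\<^bsub>mc_coeff d M l xs\<^esub>),
      add = (\<lambda>\<alpha> \<beta>. \<lambda>xs\<in>finite_chains X d n. \<alpha> xs \<oplus>\<^bsub>mc_coeff d M l xs\<^esub> \<beta> xs),
      smult = (\<lambda>c \<alpha>. \<lambda>xs\<in>finite_chains X d n. c \<odot>\<^bsub>mc_coeff d M l xs\<^esub> \<alpha> xs)\<rparr>"

definition omit_nth :: "nat \<Rightarrow> 'x list \<Rightarrow> 'x list" where
  "omit_nth i xs = take i xs @ drop (Suc i) xs"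

definition repeat_nth :: "nat \<Rightarrow> 'x list \<Rightarrow> 'x list" where
  "repeat_nth i xs = take (Suc i) xs @ drop i xs"

text \<open>The coface \<open>d\<^sup>i\<close> from degree \<open>n\<close> to degree \<open>n + 1\<close>, for \<open>0 \<le> i \<le> n + 1\<close>.\<close>

definition coface ::
  "'x set \<Rightarrow> ('x \<Rightarrow> 'x \<Rightarrow> ennreal) \<Rightarrow> ('x, 'k, 'm) distance_module \<Rightarrow> real \<Rightarrow> nat \<Rightarrow> nat \<Rightarrow>
   ('x list \<Rightarrow> 'm) \<Rightarrow> 'x list \<Rightarrow> 'm" where
  "coface X d M l n i \<alpha> = (\<lambda>xs\<in>finite_chains X d (Suc n).
     if i = 0 then
       (if xs ! 0 = xs ! 1 then \<alpha> (omit_nth 0 xs) else \<zero>\<^bsub>mc_coeff d M l xs\<^esub>)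
     else if i < Suc n then
       (if between d (xs ! (i - 1)) (xs ! i) (xs ! (i + 1)) then \<alpha> (omit_nth i xs)
        else \<zero>\<^bsub>mc_coeff d M l xs\<^esub>)
     else
       act M (xs ! n) (xs ! Suc n) (mc_degree d l (omit_nth (Suc n) xs)) (\<alpha> (omit_nth (Suc n) xs)))"

text \<open>The codegeneracy \<open>s\<^sup>i\<close> from degree \<open>n + 1\<close> to degree \<open>n\<close>, for \<open>0 \<le> i \<le> n\<close>.\<close>

definition codegeneracy ::
  "'x set \<Rightarrow> ('x \<Rightarrow> 'x \<Rightarrow> ennreal) \<Rightarrow> nat \<Rightarrow> nat \<Rightarrow> ('x list \<Rightarrow> 'm) \<Rightarrow> 'x list \<Rightarrow> 'm" where
  "codegeneracy X d n i \<alpha> = (\<lambda>xs\<in>finite_chains X d n. \<alpha> (repeat_nth i xs))"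

definition mc_differential ::
  "'x set \<Rightarrow> ('x \<Rightarrow> 'x \<Rightarrow> ennreal) \<Rightarrow> ('x, 'k, 'm) distance_module \<Rightarrow> real \<Rightarrow> nat \<Rightarrow>
   ('x list \<Rightarrow> 'm) \<Rightarrow> 'x list \<Rightarrow> 'm" where
  "mc_differential X d M l n \<alpha> =
     (\<Oplus>\<^bsub>MC X d M l (Suc n)\<^esub>i\<in>{0..Suc n}.
        if even i then coface X d M l n i \<alpha>
        else \<ominus>\<^bsub>MC X d M l (Suc n)\<^esub> coface X d M l n i \<alpha>)"

definition normalised_MC ::
  "'x set \<Rightarrow> ('x \<Rightarrow> 'x \<Rightarrow> ennreal) \<Rightarrow> ('x, 'k, 'm) distance_module \<Rightarrow> real \<Rightarrow> nat \<Rightarrow>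
   ('k, 'x list \<Rightarrow> 'm) module" where
  "normalised_MC X d M l n = (MC X d M l n)
     \<lparr>carrier := {\<alpha> \<in> carrier (MC X d M l n).
        \<forall>i<n. codegeneracy X d (n - 1) i \<alpha> = \<zero>\<^bsub>MC X d M l (n - 1)\<^esub>}\<rparr>"

definition MH ::
  "'x set \<Rightarrow> ('x \<Rightarrow> 'x \<Rightarrow> ennreal) \<Rightarrow> nat \<Rightarrow> real \<Rightarrow> ('x, 'k, 'm) distance_module \<Rightarrow>
   ('k, ('x list \<Rightarrow> 'm) set) module" where
  "MH X d n l M = cohomology (normalised_MC X d M l) (mc_differential X d M l) n"

end

theory Submission
  imports Defs
begin

text \<open>
  The functor \<open>M \<mapsto> M(x)\<^sub>g\<close> is represented by a distance module that is free on one generator over \<open>x\<close>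
  in degree \<open>g\<close>. The normalised bar module \<open>bar n\<close> is the direct sum of these over the nondegenerate
  chains \<open>(x\<^sub>0, \<dots>, x\<^sub>n)\<close> of finite length, with generator over \<open>x\<^sub>n\<close> in degree \<open>|x\<^sub>0, \<dots>, x\<^sub>n|\<close>. Hence it is
  projective, and morphisms from it to \<open>M[\<ell>]\<close> are the normalised magnitude cochains of \<open>M\<close>.
  Over a fixed point \<open>y\<close> the bar complex is contracted onto the trivial module by appending \<open>y\<close> to
  chains, so it is a projective resolution. Comparison of projective resolutions
  then identifies its cohomology with \<open>Ext\<close>. Since the latter is computed from a
  chosen resolution with elements in a type of lists, the bar modules are transported into that
  type along an injection of the finitely supported functions.
\<close>

section \<open>Linear maps and cohomology\<close>

text \<open>Several obstacles shape the argument. Normalisation: appending \<open>y\<close> to a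
  chain that already ends in \<open>y\<close> would give a degenerate chain, so the contraction must
  be zero there; the missing term is supplied by the last face, whose cone restores the chain. The
  contraction also yields that the differential squares to zero: a generator in degree at least 2 is
  a cone in the fibre over its own end point, and the homotopy identity carries the claim from
  degree to degree, starting at the augmentation. Element types: projectivity is tested against
  modules with elements in one fixed type, whereas the augmentation lands in a module with elements
  in \<open>'k\<close>. The type of all functions from \<open>'x list\<close> to \<open>'k\<close>
  may be too large to embed into lists, so it is the finitely supported ones that are encoded.
  Choice: \<open>Ext\<close> uses an unspecified resolution, so a concrete one in the prescribed
  type serves twice, to guarantee that the choice is a resolution and to be compared with it.
  Indexing: the bar differential starts at face 1, because coface 0 is nonzero only on chains whose
  first two points agree, and these are degenerate.\<close>

lemma linear_mapsI:
  assumes "\<And>u. u \<in> carrier M \<Longrightarrow> f u \<in> carrier N"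
    and "\<And>u v. u \<in> carrier M \<Longrightarrow> v \<in> carrier M \<Longrightarrow> f (u \<oplus>\<^bsub>M\<^esub> v) = f u \<oplus>\<^bsub>N\<^esub> f v"
    and "\<And>c u. c \<in> carrier K \<Longrightarrow> u \<in> carrier M \<Longrightarrow> f (c \<odot>\<^bsub>M\<^esub> u) = c \<odot>\<^bsub>N\<^esub> f u"
  shows "f \<in> linear_maps K M N"
  using assms by (auto simp: linear_maps_def)

lemma linear_mapsD:
  assumes "f \<in> linear_maps K M N"
  shows linear_maps_closed: "u \<in> carrier M \<Longrightarrow> f u \<in> carrier N"
    and linear_maps_add:
      "\<lbrakk>u \<in> carrier M; v \<in> carrier M\<rbrakk> \<Longrightarrow> f (u \<oplus>\<^bsub>M\<^esub> v) = f u \<oplus>\<^bsub>N\<^esub> f v"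
    and linear_maps_smult:
      "\<lbrakk>c \<in> carrier K; u \<in> carrier M\<rbrakk> \<Longrightarrow> f (c \<odot>\<^bsub>M\<^esub> u) = c \<odot>\<^bsub>N\<^esub> f u"
  using assms by (auto simp: linear_maps_def)

lemma linear_maps_zero:
  assumes "f \<in> linear_maps K M N" "module K M" "module K N"
  shows "f \<zero>\<^bsub>M\<^esub> = \<zero>\<^bsub>N\<^esub>"
proof -
  interpret M: module K M by fact
  interpret N: module K N by fact
  have "f (\<zero>\<^bsub>K\<^esub> \<odot>\<^bsub>M\<^esub> \<zero>\<^bsub>M\<^esub>) = \<zero>\<^bsub>K\<^esub> \<odot>\<^bsub>N\<^esub> f \<zero>\<^bsub>M\<^esub>"
    using assms(1) by (intro linear_maps_smult) auto
  then show ?thesis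
    using linear_maps_closed[OF assms(1)] by simp
qed

lemma linear_maps_minus:
  assumes f: "f \<in> linear_maps K M N" and "module K M" "module K N"
    and u: "u \<in> carrier M"
  shows "f (\<ominus>\<^bsub>M\<^esub> u) = \<ominus>\<^bsub>N\<^esub> f u"
proof -
  interpret M: module K M by fact
  interpret N: module K N by fact
  have "f (\<ominus>\<^bsub>M\<^esub> u) \<oplus>\<^bsub>N\<^esub> f u = \<zero>\<^bsub>N\<^esub>"
    using linear_maps_add[OF f, of "\<ominus>\<^bsub>M\<^esub> u" u] u linear_maps_zero[OF assms(1-3)]
    by (simp add: M.M.l_neg)
  then show ?thesis
    using linear_maps_closed[OF f] u by (simp add: N.M.minus_equality)
qed

lemma linear_maps_diff:
  assumes f: "f \<in> linear_maps K M N" and "module K M" "module K N"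
    and "u \<in> carrier M" "v \<in> carrier M"
  shows "f (u \<ominus>\<^bsub>M\<^esub> v) = f u \<ominus>\<^bsub>N\<^esub> f v"
proof -
  interpret M: module K M by fact
  interpret N: module K N by fact
  show ?thesis
    using assms by (simp add: a_minus_def linear_maps_add[OF f] linear_maps_minus)
qed

lemma linear_maps_finsum:
  assumes f: "f \<in> linear_maps K M N" and "module K M" "module K N"
    and "finite A" "a \<in> A \<rightarrow> carrier M"
  shows "f (\<Oplus>\<^bsub>M\<^esub>i\<in>A. a i) = (\<Oplus>\<^bsub>N\<^esub>i\<in>A. f (a i))"
proof -
  interpret M: module K M by fact
  interpret N: module K N by fact
  show ?thesis
    using assms(4,5)
  proof (induction A rule: finite_induct)
    case empty
    then show ?case using linear_maps_zero[OF assms(1-3)] by simp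
  next
    case (insert x F)
    then show ?case
      using linear_maps_closed[OF f]
      by (simp add: Pi_def linear_maps_add[OF f])
  qed
qed

lemma linear_maps_comp:
  assumes "f \<in> linear_maps K L M" "g \<in> linear_maps K M N"
  shows "(\<lambda>u. g (f u)) \<in> linear_maps K L N"
  using linear_mapsD[OF assms(1)] linear_mapsD[OF assms(2)] by (auto intro!: linear_mapsI)

lemma linear_maps_id: "(\<lambda>u. u) \<in> linear_maps K M M"
  by (auto intro: linear_mapsI)

lemma linear_maps_zero_map:
  assumes "module K N"
  shows "(\<lambda>u. \<zero>\<^bsub>N\<^esub>) \<in> linear_maps K M N"
proof -
  interpret N: module K N by fact
  show ?thesis by (auto intro: linear_mapsI)
qed

lemma linear_maps_add_map:
  assumes f: "f \<in> linear_maps K M N" and g: "g \<in> linear_maps K M N" and "module K N"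
  shows "(\<lambda>u. f u \<oplus>\<^bsub>N\<^esub> g u) \<in> linear_maps K M N"
proof -
  interpret N: module K N by fact
  show ?thesis
    using linear_mapsD[OF f] linear_mapsD[OF g]
    by (auto intro!: linear_mapsI simp: N.smult_r_distr N.M.a_ac)
qed

lemma linear_maps_smult_map:
  assumes f: "f \<in> linear_maps K M N" and "module K N" and c: "c \<in> carrier K"
  shows "(\<lambda>u. c \<odot>\<^bsub>N\<^esub> f u) \<in> linear_maps K M N"
proof -
  interpret N: module K N by fact
  show ?thesis
    using linear_mapsD[OF f] c
    by (auto intro!: linear_mapsI simp: N.smult_r_distr N.smult_assoc1[symmetric] N.R.m_comm)
qed

lemma linear_maps_diff_map:
  assumes f: "f \<in> linear_maps K M N" and g: "g \<in> linear_maps K M N" and N: "module K N"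
  shows "(\<lambda>u. f u \<ominus>\<^bsub>N\<^esub> g u) \<in> linear_maps K M N"
proof -
  interpret N: module K N by fact
  show ?thesis
    using linear_mapsD[OF f] linear_mapsD[OF g]
    by (auto intro!: linear_mapsI
        simp: a_minus_def N.smult_r_distr N.smult_r_minus N.M.a_ac N.M.minus_add)
qed

text \<open>Morphisms are stored as restrictions, so a map often agrees with a known linear one only
  on the carrier. That \<open>M\<close> is a module keeps sums and multiples inside the carrier,
  where the two maps agree.\<close>

lemma linear_maps_cong:
  assumes "f \<in> linear_maps K M N" "\<And>u. u \<in> carrier M \<Longrightarrow> g u = f u" "module K M"
  shows "g \<in> linear_maps K M N"
proof -
  interpret M: module K M by fact
  show ?thesis
    using linear_mapsD[OF assms(1)] assms(2) by (auto intro!: linear_mapsI)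
qed

lemma submodule_kernel:
  assumes f: "f \<in> linear_maps K M N" and M: "module K M" and N: "module K N"
  shows "submodule {u \<in> carrier M. f u = \<zero>\<^bsub>N\<^esub>} K M"
proof -
  interpret M: module K M by fact
  interpret N: module K N by fact
  show ?thesis
    using linear_mapsD[OF f] linear_maps_zero[OF f M N]
    by (intro M.submoduleI) (auto simp: linear_maps_minus[OF f M N])
qed

lemma submodule_image:
  assumes f: "f \<in> linear_maps K M N" and M: "module K M" and N: "module K N"
  shows "submodule (f ` carrier M) K N"
proof -
  interpret M: module K M by fact
  interpret N: module K N by fact
  show ?thesis
  proof (intro N.submoduleI)
    show "\<zero>\<^bsub>N\<^esub> \<in> f ` carrier M"
      using linear_maps_zero[OF f M N] by (metis M.M.zero_closed image_eqI)
    show "\<ominus>\<^bsub>N\<^esub> a \<in> f ` carrier M" if "a \<in> f ` carrier M" for a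
      using that by (auto simp: linear_maps_minus[OF f M N, symmetric])
    show "a \<oplus>\<^bsub>N\<^esub> b \<in> f ` carrier M" if "a \<in> f ` carrier M" "b \<in> f ` carrier M" for a b
      using that by (auto simp: linear_maps_add[OF f, symmetric])
    show "c \<odot>\<^bsub>N\<^esub> b \<in> f ` carrier M" if "c \<in> carrier K" "b \<in> f ` carrier M" for c b
      using that by (auto simp: linear_maps_smult[OF f, symmetric])
  qed (use linear_maps_closed[OF f] in auto)
qed

lemma module_iso_trans:
  assumes "module_iso K L M" "module_iso K M N"
  shows "module_iso K L N"
proof -
  obtain f g where f: "f \<in> linear_maps K L M" "bij_betw f (carrier L) (carrier M)"
    and g: "g \<in> linear_maps K M N" "bij_betw g (carrier M) (carrier N)"
    using assms by (auto simp: module_iso_def)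
  then show ?thesis
    unfolding module_iso_def
    using linear_maps_comp[OF f(1) g(1)] bij_betw_trans[OF f(2) g(2)] by (auto simp: comp_def)
qed

section \<open>Cocycles, coboundaries and a criterion for isomorphic cohomology\<close>

lemma submodule_cocycles:
  assumes "\<And>i. module K (C i)" "\<And>i. \<delta> i \<in> linear_maps K (C i) (C (Suc i))"
  shows "submodule (cocycles C \<delta> n) K (C n)"
  unfolding cocycles_def by (rule submodule_kernel[OF assms(2) assms(1) assms(1)])

lemma submodule_coboundaries:
  assumes C: "\<And>i. module K (C i)" and \<delta>: "\<And>i. \<delta> i \<in> linear_maps K (C i) (C (Suc i))"
  shows "submodule (coboundaries C \<delta> n) K (C n)"
proof (cases n)
  case 0
  interpret C: module K "C 0" by (rule C)
  have "submodule {\<zero>\<^bsub>C 0\<^esub>} K (C 0)"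
    by (rule C.submoduleI) auto
  with 0 show ?thesis by (simp add: coboundaries_def)
next
  case (Suc m)
  then show ?thesis
    using submodule_image[OF \<delta>[of m] C C] by (simp add: coboundaries_def)
qed

lemma (in module) submodule_abelian_subgroup:
  assumes "submodule H R M"
  shows "abelian_subgroup H M"
  using assms by (intro abelian_subgroupI3 additive_subgroupI submodule.axioms(1) M.abelian_group_axioms)

text \<open>A scalar need not be invertible, so multiplying a coset of \<open>B\<close> by
  \<open>c\<close> may give a proper subset of a coset; adding \<open>B\<close> fills it up. This is
  why \<open>cohomology\<close> defines its scalar action with the extra summand.\<close>

lemma smult_coset:
  assumes M: "module K M" and B: "submodule B K M"
    and c: "c \<in> carrier K" and u: "u \<in> carrier M"
  shows "B <+>\<^bsub>M\<^esub> ((\<lambda>v. c \<odot>\<^bsub>M\<^esub> v) ` (B +>\<^bsub>M\<^esub> u)) = B +>\<^bsub>M\<^esub> (c \<odot>\<^bsub>M\<^esub> u)"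
proof -
  interpret M: module K M by fact
  note B' = M.submoduleE[OF B]
  have sub: "B \<subseteq> carrier M" by (rule B'(1))
  have zero: "\<zero>\<^bsub>M\<^esub> \<in> B"
    using submodule.axioms(1)[OF B] subgroup.one_closed by fastforce
  show ?thesis
  proof (intro equalityI subsetI)
    fix w assume "w \<in> B <+>\<^bsub>M\<^esub> ((\<lambda>v. c \<odot>\<^bsub>M\<^esub> v) ` (B +>\<^bsub>M\<^esub> u))"
    then obtain b b' where b: "b \<in> B" "b' \<in> B" "w = b \<oplus>\<^bsub>M\<^esub> c \<odot>\<^bsub>M\<^esub> (b' \<oplus>\<^bsub>M\<^esub> u)"
      by (auto simp: set_add_def' a_r_coset_def')
    then have "w = (b \<oplus>\<^bsub>M\<^esub> c \<odot>\<^bsub>M\<^esub> b') \<oplus>\<^bsub>M\<^esub> c \<odot>\<^bsub>M\<^esub> u"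
      using sub c u by (auto simp: subset_iff M.smult_r_distr M.M.a_assoc)
    moreover have "b \<oplus>\<^bsub>M\<^esub> c \<odot>\<^bsub>M\<^esub> b' \<in> B"
      using b c B' by blast
    ultimately show "w \<in> B +>\<^bsub>M\<^esub> (c \<odot>\<^bsub>M\<^esub> u)"
      by (auto simp: a_r_coset_def')
  next
    fix w assume "w \<in> B +>\<^bsub>M\<^esub> (c \<odot>\<^bsub>M\<^esub> u)"
    then obtain b where b: "b \<in> B" "w = b \<oplus>\<^bsub>M\<^esub> c \<odot>\<^bsub>M\<^esub> u"
      by (auto simp: a_r_coset_def')
    moreover have "u \<in> B +>\<^bsub>M\<^esub> u"
      using zero u by (force simp: a_r_coset_def')
    ultimately show "w \<in> B <+>\<^bsub>M\<^esub> ((\<lambda>v. c \<odot>\<^bsub>M\<^esub> v) ` (B +>\<^bsub>M\<^esub> u))"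
      by (auto simp: set_add_def')
  qed
qed

text \<open>Only degree \<open>n\<close> of \<open>f\<close> enters, with the four conditions that
  make the induced map on quotients well defined, injective and surjective. So the criterion covers
  homotopy equivalences, where \<open>f\<close> is invertible up to coboundaries, as well as
  isomorphisms of complexes.\<close>

lemma cohomology_module_iso:
  assumes C: "\<And>i. module K (C i)" and \<delta>: "\<And>i. \<delta> i \<in> linear_maps K (C i) (C (Suc i))"
    and C': "\<And>i. module K (C' i)" and \<delta>': "\<And>i. \<delta>' i \<in> linear_maps K (C' i) (C' (Suc i))"
    and f: "f \<in> linear_maps K (C n) (C' n)"
    and cocycle: "\<And>z. z \<in> cocycles C \<delta> n \<Longrightarrow> f z \<in> cocycles C' \<delta>' n"
    and coboundary: "\<And>z. z \<in> coboundaries C \<delta> n \<Longrightarrow> f z \<in> coboundaries C' \<delta>' n"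
    and inj: "\<And>z. \<lbrakk>z \<in> cocycles C \<delta> n; f z \<in> coboundaries C' \<delta>' n\<rbrakk> \<Longrightarrow> z \<in> coboundaries C \<delta> n"
    and surj: "\<And>w. w \<in> cocycles C' \<delta>' n \<Longrightarrow>
      \<exists>z\<in>cocycles C \<delta> n. w \<ominus>\<^bsub>C' n\<^esub> f z \<in> coboundaries C' \<delta>' n"
  shows "module_iso K (cohomology C \<delta> n) (cohomology C' \<delta>' n)"
proof -
  let ?B = "coboundaries C \<delta> n" and ?Z = "cocycles C \<delta> n"
  let ?B' = "coboundaries C' \<delta>' n" and ?Z' = "cocycles C' \<delta>' n"
  let ?M = "C n" and ?N = "C' n"
  interpret M: module K ?M by (rule C)
  interpret N: module K ?N by (rule C')
  have B: "submodule ?B K ?M" by (rule submodule_coboundaries[where C=C and \<delta>=\<delta>, OF C \<delta>])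
  have B': "submodule ?B' K ?N" by (rule submodule_coboundaries[where C=C' and \<delta>=\<delta>', OF C' \<delta>'])
  have Z: "submodule ?Z K ?M" by (rule submodule_cocycles[where C=C and \<delta>=\<delta>, OF C \<delta>])
  have Z': "submodule ?Z' K ?N" by (rule submodule_cocycles[where C=C' and \<delta>=\<delta>', OF C' \<delta>'])
  interpret B: abelian_subgroup ?B ?M by (rule M.submodule_abelian_subgroup[OF B])
  interpret B': abelian_subgroup ?B' ?N by (rule N.submodule_abelian_subgroup[OF B'])
  note ZE = M.submoduleE[OF Z] and ZE' = N.submoduleE[OF Z']
  have Zc: "u \<in> carrier ?M" if "u \<in> ?Z" for u
    using that ZE(1) by blast
  have Zc': "u \<in> carrier ?N" if "u \<in> ?Z'" for u
    using that ZE'(1) by blast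
  have fc: "f u \<in> carrier ?N" if "u \<in> ?Z" for u
    using Zc[OF that] f by (simp add: linear_maps_closed)
  \<comment> \<open>The union avoids a choice of representative: all \<open>u\<close> in one coset
    yield the same coset of the image, so the union is that coset.\<close>
  define \<Phi> where "\<Phi> U = (\<Union>u\<in>U. ?B' +>\<^bsub>?N\<^esub> f u)" for U
  have \<Phi>: "\<Phi> (?B +>\<^bsub>?M\<^esub> z) = ?B' +>\<^bsub>?N\<^esub> f z" if z: "z \<in> ?Z" for z
  proof -
    have "?B' +>\<^bsub>?N\<^esub> f u = ?B' +>\<^bsub>?N\<^esub> f z" if u: "u \<in> ?B +>\<^bsub>?M\<^esub> z" for u
    proof -
      obtain b where b: "b \<in> ?B" "u = b \<oplus>\<^bsub>?M\<^esub> z"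
        using u by (auto simp: a_r_coset_def')
      then have "f u = f b \<oplus>\<^bsub>?N\<^esub> f z"
        using linear_maps_add[OF f] Zc[OF z] by simp
      then have "f u \<in> ?B' +>\<^bsub>?N\<^esub> f z"
        using coboundary[OF b(1)] by (auto simp: a_r_coset_def')
      then show ?thesis
        by (metis B'.a_repr_independence' fc z)
    qed
    moreover have "z \<in> ?B +>\<^bsub>?M\<^esub> z"
      using Zc[OF z] by (rule B.a_rcos_self)
    ultimately show ?thesis
      unfolding \<Phi>_def by blast
  qed
  \<comment> \<open>Injectivity: the difference of two representatives is a cocycle that
    \<open>f\<close> sends to a coboundary.\<close>
  have eq: "?B +>\<^bsub>?M\<^esub> z = ?B +>\<^bsub>?M\<^esub> w"
    if "z \<in> ?Z" "w \<in> ?Z" and h: "?B' +>\<^bsub>?N\<^esub> f z = ?B' +>\<^bsub>?N\<^esub> f w" for z w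
  proof -
    have "f z \<in> ?B' +>\<^bsub>?N\<^esub> f w"
      using B'.a_rcos_self[OF fc[OF that(1)]] h by simp
    then have "f z \<ominus>\<^bsub>?N\<^esub> f w \<in> ?B'"
      using B'.a_rcos_module_imp[OF fc[OF that(2)]] by (simp add: a_minus_def)
    then have "f (z \<ominus>\<^bsub>?M\<^esub> w) \<in> ?B'"
      using linear_maps_diff[OF f C C'] Zc that by simp
    moreover have "z \<ominus>\<^bsub>?M\<^esub> w \<in> ?Z"
      using that ZE by (simp add: a_minus_def)
    ultimately have "z \<ominus>\<^bsub>?M\<^esub> w \<in> ?B"
      by (rule inj[rotated])
    moreover have "z = (z \<ominus>\<^bsub>?M\<^esub> w) \<oplus>\<^bsub>?M\<^esub> w"
      using that Zc by (simp add: a_minus_def M.M.a_assoc M.M.l_neg)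
    ultimately have "z \<in> ?B +>\<^bsub>?M\<^esub> w"
      by (auto simp: a_r_coset_def')
    then show ?thesis
      by (metis B.a_repr_independence' Zc that(2))
  qed
  have lin: "\<Phi> \<in> linear_maps K (cohomology C \<delta> n) (cohomology C' \<delta>' n)"
  proof (rule linear_mapsI)
    fix U assume "U \<in> carrier (cohomology C \<delta> n)"
    then show "\<Phi> U \<in> carrier (cohomology C' \<delta>' n)"
      using \<Phi> cocycle by (auto simp: cohomology_def)
  next
    fix U V assume "U \<in> carrier (cohomology C \<delta> n)" "V \<in> carrier (cohomology C \<delta> n)"
    then obtain u v where uv: "u \<in> ?Z" "v \<in> ?Z" "U = ?B +>\<^bsub>?M\<^esub> u" "V = ?B +>\<^bsub>?M\<^esub> v"
      by (auto simp: cohomology_def)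
    have "\<Phi> (U <+>\<^bsub>?M\<^esub> V) = \<Phi> (?B +>\<^bsub>?M\<^esub> (u \<oplus>\<^bsub>?M\<^esub> v))"
      using uv Zc by (simp add: B.a_rcos_sum)
    also have "\<dots> = ?B' +>\<^bsub>?N\<^esub> (f u \<oplus>\<^bsub>?N\<^esub> f v)"
      using uv Zc ZE by (simp add: \<Phi> linear_maps_add[OF f])
    also have "\<dots> = \<Phi> U <+>\<^bsub>?N\<^esub> \<Phi> V"
      using uv fc by (simp add: B'.a_rcos_sum \<Phi>)
    finally show "\<Phi> (U \<oplus>\<^bsub>cohomology C \<delta> n\<^esub> V) = \<Phi> U \<oplus>\<^bsub>cohomology C' \<delta>' n\<^esub> \<Phi> V"
      by (simp add: cohomology_def)
  next
    fix c U assume c: "c \<in> carrier K" and "U \<in> carrier (cohomology C \<delta> n)"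
    then obtain u where u: "u \<in> ?Z" "U = ?B +>\<^bsub>?M\<^esub> u"
      by (auto simp: cohomology_def)
    have "\<Phi> (?B <+>\<^bsub>?M\<^esub> ((\<lambda>v. c \<odot>\<^bsub>?M\<^esub> v) ` U)) = \<Phi> (?B +>\<^bsub>?M\<^esub> (c \<odot>\<^bsub>?M\<^esub> u))"
      using u c Zc by (simp add: smult_coset[OF C B])
    also have "\<dots> = ?B' +>\<^bsub>?N\<^esub> (c \<odot>\<^bsub>?N\<^esub> f u)"
      using u c Zc ZE by (simp add: \<Phi> linear_maps_smult[OF f])
    also have "\<dots> = ?B' <+>\<^bsub>?N\<^esub> ((\<lambda>v. c \<odot>\<^bsub>?N\<^esub> v) ` \<Phi> U)"
      using u c fc by (simp add: smult_coset[OF C' B'] \<Phi>)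
    finally show "\<Phi> (c \<odot>\<^bsub>cohomology C \<delta> n\<^esub> U) = c \<odot>\<^bsub>cohomology C' \<delta>' n\<^esub> \<Phi> U"
      by (simp add: cohomology_def)
  qed
  have inj: "inj_on \<Phi> (carrier (cohomology C \<delta> n))"
  proof (rule inj_onI)
    fix U V assume UV: "U \<in> carrier (cohomology C \<delta> n)" "V \<in> carrier (cohomology C \<delta> n)"
      and h: "\<Phi> U = \<Phi> V"
    obtain u v where "u \<in> ?Z" "v \<in> ?Z" "U = ?B +>\<^bsub>?M\<^esub> u" "V = ?B +>\<^bsub>?M\<^esub> v"
      using UV by (auto simp: cohomology_def)
    with h show "U = V"
      using eq[of u v] by (simp add: \<Phi>)
  qed
  have "carrier (cohomology C' \<delta>' n) \<subseteq> \<Phi> ` carrier (cohomology C \<delta> n)"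
  proof
    fix W assume "W \<in> carrier (cohomology C' \<delta>' n)"
    then obtain w where w: "w \<in> ?Z'" "W = ?B' +>\<^bsub>?N\<^esub> w"
      by (auto simp: cohomology_def)
    obtain z where z: "z \<in> ?Z" "w \<ominus>\<^bsub>?N\<^esub> f z \<in> ?B'"
      using surj[OF w(1)] by blast
    have "w = (w \<ominus>\<^bsub>?N\<^esub> f z) \<oplus>\<^bsub>?N\<^esub> f z"
      using w z fc Zc' by (simp add: a_minus_def N.M.a_assoc N.M.l_neg)
    then have "w \<in> ?B' +>\<^bsub>?N\<^esub> f z"
      using z(2) by (auto simp: a_r_coset_def')
    then have "W = \<Phi> (?B +>\<^bsub>?M\<^esub> z)"
      using w z \<Phi> by (metis B'.a_repr_independence' fc)
    then show "W \<in> \<Phi> ` carrier (cohomology C \<delta> n)"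
      using z by (auto simp: cohomology_def)
  qed
  with inj lin show ?thesis
    unfolding module_iso_def bij_betw_def using linear_maps_closed[OF lin] by blast
qed

section \<open>Distance modules and their morphisms\<close>

lemma is_distance_moduleD:
  assumes "is_distance_module K X d M"
  shows dm_module: "x \<in> X \<Longrightarrow> module K (fib M x g)"
    and dm_act: "\<lbrakk>x \<in> X; y \<in> X; d x y < \<infinity>\<rbrakk> \<Longrightarrow>
      act M x y g \<in> linear_maps K (fib M x g) (fib M y (g + rdist d x y))"
    and dm_act_self: "\<lbrakk>x \<in> X; m \<in> carrier (fib M x g)\<rbrakk> \<Longrightarrow> act M x x g m = m"
    and dm_act_act: "\<lbrakk>x \<in> X; y \<in> X; z \<in> X; d x y < \<infinity>; d y z < \<infinity>; m \<in> carrier (fib M x g)\<rbrakk> \<Longrightarrow>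
      act M y z (g + rdist d x y) (act M x y g m) =
        (if between d x y z then act M x z g m
         else \<zero>\<^bsub>fib M z (g + rdist d x y + rdist d y z)\<^esub>)"
  using assms unfolding is_distance_module_def by blast+

lemma is_distance_moduleI:
  assumes "\<And>x g. x \<in> X \<Longrightarrow> module K (fib M x g)"
    and "\<And>x y g. \<lbrakk>x \<in> X; y \<in> X; d x y < \<infinity>\<rbrakk> \<Longrightarrow>
      act M x y g \<in> linear_maps K (fib M x g) (fib M y (g + rdist d x y))"
    and "\<And>x m g. \<lbrakk>x \<in> X; m \<in> carrier (fib M x g)\<rbrakk> \<Longrightarrow> act M x x g m = m"
    and "\<And>x y z m g. \<lbrakk>x \<in> X; y \<in> X; z \<in> X; d x y < \<infinity>; d y z < \<infinity>; m \<in> carrier (fib M x g)\<rbrakk> \<Longrightarrow>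
      act M y z (g + rdist d x y) (act M x y g m) =
        (if between d x y z then act M x z g m
         else \<zero>\<^bsub>fib M z (g + rdist d x y + rdist d y z)\<^esub>)"
  shows "is_distance_module K X d M"
  using assms unfolding is_distance_module_def by blast

lemma graded_imp_distance_module:
  "graded_distance_module K X d G M \<Longrightarrow> is_distance_module K X d M"
  by (simp add: graded_distance_module_def)

lemma dm_homD:
  assumes "\<phi> \<in> dm_hom K X d M N"
  shows dm_hom_linear: "x \<in> X \<Longrightarrow> \<phi> x g \<in> linear_maps K (fib M x g) (fib N x g)"
    and dm_hom_act: "\<lbrakk>x \<in> X; y \<in> X; d x y < \<infinity>; m \<in> carrier (fib M x g)\<rbrakk> \<Longrightarrow>
      act N x y g (\<phi> x g m) = \<phi> y (g + rdist d x y) (act M x y g m)"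
  using assms unfolding dm_hom_def by blast+

lemma dm_hom_closed:
  assumes "\<phi> \<in> dm_hom K X d M N" "x \<in> X" "m \<in> carrier (fib M x g)"
  shows "\<phi> x g m \<in> carrier (fib N x g)"
  using linear_maps_closed[OF dm_hom_linear[OF assms(1,2)] assms(3)] .

lemma dm_fun_apply [simp]:
  "\<lbrakk>x \<in> X; m \<in> carrier (fib M x g)\<rbrakk> \<Longrightarrow> dm_fun X M f x g m = f x g m"
  by (simp add: dm_fun_def)

lemma dm_fun_cong:
  assumes "\<And>x g m. \<lbrakk>x \<in> X; m \<in> carrier (fib M x g)\<rbrakk> \<Longrightarrow> f x g m = h x g m"
  shows "dm_fun X M f = dm_fun X M h"
  unfolding dm_fun_def using assms by (intro restrict_ext ext) auto

text \<open>Morphisms are \<open>undefined\<close> off the carriers by definition, so restricting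
  them once more changes nothing. With this, equality of morphisms can be checked on elements of the
  fibres.\<close>

lemma dm_fun_hom_eq:
  assumes "\<phi> \<in> dm_hom K X d M N"
  shows "dm_fun X M \<phi> = \<phi>"
proof -
  have "\<phi> \<in> extensional X" "\<And>x g. x \<in> X \<Longrightarrow> \<phi> x g \<in> extensional (carrier (fib M x g))"
    using assms unfolding dm_hom_def by blast+
  then show ?thesis
    unfolding dm_fun_def by (auto simp: fun_eq_iff restrict_def extensional_def)
qed

lemma dm_hom_eqI:
  assumes "\<phi> \<in> dm_hom K X d M N" "\<psi> \<in> dm_hom K X d M N'"
    and "\<And>x g m. \<lbrakk>x \<in> X; m \<in> carrier (fib M x g)\<rbrakk> \<Longrightarrow> \<phi> x g m = \<psi> x g m"
  shows "\<phi> = \<psi>"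
  by (metis dm_fun_hom_eq[OF assms(1)] dm_fun_hom_eq[OF assms(2)] dm_fun_cong assms(3))

text \<open>The standard way to build a morphism: an unrestricted family is checked on carriers and
  then cut down. The source is a distance module, so its action stays in the carriers, where the
  restriction agrees with \<open>f\<close>.\<close>

lemma dm_fun_hom:
  assumes M: "is_distance_module K X d M"
    and lin: "\<And>x g. x \<in> X \<Longrightarrow> f x g \<in> linear_maps K (fib M x g) (fib N x g)"
    and nat: "\<And>x y g m. \<lbrakk>x \<in> X; y \<in> X; d x y < \<infinity>; m \<in> carrier (fib M x g)\<rbrakk> \<Longrightarrow>
      act N x y g (f x g m) = f y (g + rdist d x y) (act M x y g m)"
  shows "dm_fun X M f \<in> dm_hom K X d M N"
proof -
  have "dm_fun X M f \<in> extensional X"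
    by (simp add: dm_fun_def)
  moreover have "dm_fun X M f x g \<in> linear_maps K (fib M x g) (fib N x g)" if "x \<in> X" for x g
    using that by (intro linear_maps_cong[OF lin]) (auto intro: dm_module[OF M])
  moreover have "dm_fun X M f x g \<in> extensional (carrier (fib M x g))" if "x \<in> X" for x g
    using that by (simp add: dm_fun_def)
  moreover have "act N x y g (dm_fun X M f x g m) = dm_fun X M f y (g + rdist d x y) (act M x y g m)"
    if "x \<in> X" "y \<in> X" "d x y < \<infinity>" "m \<in> carrier (fib M x g)" for x y g m
    using that linear_maps_closed[OF dm_act[OF M that(1-3)] that(4)] by (simp add: nat)
  ultimately show ?thesis
    unfolding dm_hom_def by blast
qed

lemma dm_comp_apply [simp]:
  "\<lbrakk>x \<in> X; m \<in> carrier (fib M x g)\<rbrakk> \<Longrightarrow> dm_comp X M \<psi> \<phi> x g m = \<psi> x g (\<phi> x g m)"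
  by (simp add: dm_comp_def)

lemma dm_comp_hom:
  assumes L: "is_distance_module K X d L"
    and \<phi>: "\<phi> \<in> dm_hom K X d L M" and \<psi>: "\<psi> \<in> dm_hom K X d M N"
  shows "dm_comp X L \<psi> \<phi> \<in> dm_hom K X d L N"
  unfolding dm_comp_def
proof (rule dm_fun_hom[OF L])
  show "(\<lambda>m. \<psi> x g (\<phi> x g m)) \<in> linear_maps K (fib L x g) (fib N x g)" if "x \<in> X" for x g
    by (rule linear_maps_comp[OF dm_hom_linear[OF \<phi> that] dm_hom_linear[OF \<psi> that]])
  show "act N x y g (\<psi> x g (\<phi> x g m)) =
      \<psi> y (g + rdist d x y) (\<phi> y (g + rdist d x y) (act L x y g m))"
    if "x \<in> X" "y \<in> X" "d x y < \<infinity>" "m \<in> carrier (fib L x g)" for x y g m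
    using that dm_hom_closed[OF \<phi> that(1,4)]
    by (simp add: dm_hom_act[OF \<psi>] dm_hom_act[OF \<phi>])
qed

lemma dm_id_hom:
  assumes M: "is_distance_module K X d M"
  shows "dm_fun X M (\<lambda>x g m. m) \<in> dm_hom K X d M M"
  by (rule dm_fun_hom[OF M linear_maps_id]) simp

lemma dm_zero_hom:
  assumes M: "is_distance_module K X d M" and N: "is_distance_module K X d N"
  shows "dm_fun X M (\<lambda>x g m. \<zero>\<^bsub>fib N x g\<^esub>) \<in> dm_hom K X d M N"
  using dm_module[OF N] linear_maps_zero[OF dm_act[OF N] dm_module[OF N] dm_module[OF N]]
  by (intro dm_fun_hom[OF M linear_maps_zero_map]) auto

lemma dm_add_hom:
  assumes M: "is_distance_module K X d M" and N: "is_distance_module K X d N"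
    and \<phi>: "\<phi> \<in> dm_hom K X d M N" and \<psi>: "\<psi> \<in> dm_hom K X d M N"
  shows "dm_fun X M (\<lambda>x g m. \<phi> x g m \<oplus>\<^bsub>fib N x g\<^esub> \<psi> x g m) \<in> dm_hom K X d M N"
  using dm_hom_linear[OF \<phi>] dm_hom_linear[OF \<psi>] dm_module[OF N]
  by (intro dm_fun_hom[OF M linear_maps_add_map])
    (auto simp: dm_hom_closed[OF \<phi>] dm_hom_closed[OF \<psi>] linear_maps_add[OF dm_act[OF N]]
      dm_hom_act[OF \<phi>] dm_hom_act[OF \<psi>])

lemma dm_smult_hom:
  assumes M: "is_distance_module K X d M" and N: "is_distance_module K X d N"
    and \<phi>: "\<phi> \<in> dm_hom K X d M N" and c: "c \<in> carrier K"
  shows "dm_fun X M (\<lambda>x g m. c \<odot>\<^bsub>fib N x g\<^esub> \<phi> x g m) \<in> dm_hom K X d M N"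
  using dm_hom_linear[OF \<phi>] dm_module[OF N] c
  by (intro dm_fun_hom[OF M linear_maps_smult_map])
    (auto simp: dm_hom_closed[OF \<phi>] linear_maps_smult[OF dm_act[OF N]] dm_hom_act[OF \<phi>])

lemma dm_diff_hom:
  assumes M: "is_distance_module K X d M" and N: "is_distance_module K X d N"
    and \<phi>: "\<phi> \<in> dm_hom K X d M N" and \<psi>: "\<psi> \<in> dm_hom K X d M N"
  shows "dm_fun X M (\<lambda>x g m. \<phi> x g m \<ominus>\<^bsub>fib N x g\<^esub> \<psi> x g m) \<in> dm_hom K X d M N"
  using dm_hom_linear[OF \<phi>] dm_hom_linear[OF \<psi>] dm_module[OF N]
  by (intro dm_fun_hom[OF M linear_maps_diff_map])
    (auto simp: dm_hom_closed[OF \<phi>] dm_hom_closed[OF \<psi>]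
      linear_maps_diff[OF dm_act[OF N] dm_module[OF N] dm_module[OF N]]
      dm_hom_act[OF \<phi>] dm_hom_act[OF \<psi>])

section \<open>The module of morphisms between two distance modules\<close>

lemma dm_hom_module_simps [simp]:
  "carrier (dm_hom_module K X d M N) = dm_hom K X d M N"
  "zero (dm_hom_module K X d M N) = dm_fun X M (\<lambda>x g m. \<zero>\<^bsub>fib N x g\<^esub>)"
  "add (dm_hom_module K X d M N) \<phi> \<psi> = dm_fun X M (\<lambda>x g m. \<phi> x g m \<oplus>\<^bsub>fib N x g\<^esub> \<psi> x g m)"
  "smult (dm_hom_module K X d M N) c \<phi> = dm_fun X M (\<lambda>x g m. c \<odot>\<^bsub>fib N x g\<^esub> \<phi> x g m)"
  by (simp_all add: dm_hom_module_def)

lemma module_dm_hom_module: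
  assumes K: "cring K" and M: "is_distance_module K X d M" and N: "is_distance_module K X d N"
  shows "module K (dm_hom_module K X d M N)"
proof (rule moduleI)
  interpret K: cring K by fact
  have ab: "abelian_monoid (fib N x g)" if "x \<in> X" for x g
    using dm_module[OF N that] by (simp add: module_def abelian_group_def)
  note homs = dm_zero_hom[OF M N] dm_add_hom[OF M N] dm_smult_hom[OF M N]
  show "abelian_group (dm_hom_module K X d M N)"
  proof (rule abelian_groupI)
    fix \<phi> \<psi> \<chi>
    assume "\<phi> \<in> carrier (dm_hom_module K X d M N)" "\<psi> \<in> carrier (dm_hom_module K X d M N)"
      "\<chi> \<in> carrier (dm_hom_module K X d M N)"
    then have h: "\<phi> \<in> dm_hom K X d M N" "\<psi> \<in> dm_hom K X d M N" "\<chi> \<in> dm_hom K X d M N"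
      by simp_all
    note cl = h[THEN dm_hom_closed]
    show "\<phi> \<oplus>\<^bsub>dm_hom_module K X d M N\<^esub> \<psi> \<in> carrier (dm_hom_module K X d M N)"
      using homs(2)[OF h(1,2)] by simp
    show "(\<phi> \<oplus>\<^bsub>dm_hom_module K X d M N\<^esub> \<psi>) \<oplus>\<^bsub>dm_hom_module K X d M N\<^esub> \<chi> =
        \<phi> \<oplus>\<^bsub>dm_hom_module K X d M N\<^esub> (\<psi> \<oplus>\<^bsub>dm_hom_module K X d M N\<^esub> \<chi>)"
      unfolding dm_hom_module_simps
      by (rule dm_fun_cong) (simp add: abelian_monoid.a_assoc[OF ab] cl)
    show "\<phi> \<oplus>\<^bsub>dm_hom_module K X d M N\<^esub> \<psi> = \<psi> \<oplus>\<^bsub>dm_hom_module K X d M N\<^esub> \<phi>"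
      unfolding dm_hom_module_simps
      by (rule dm_fun_cong) (rule abelian_monoid.a_comm[OF ab]; simp add: cl)
    have "dm_fun X M (\<lambda>x g m. dm_fun X M (\<lambda>x g m. \<zero>\<^bsub>fib N x g\<^esub>) x g m \<oplus>\<^bsub>fib N x g\<^esub> \<phi> x g m) = dm_fun X M \<phi>"
      by (rule dm_fun_cong) (simp add: abelian_monoid.l_zero[OF ab] cl)
    then show "\<zero>\<^bsub>dm_hom_module K X d M N\<^esub> \<oplus>\<^bsub>dm_hom_module K X d M N\<^esub> \<phi> = \<phi>"
      by (simp add: dm_fun_hom_eq[OF h(1)])
    \<comment> \<open>The additive inverse is taken as zero minus \<phi>, since differences of
      morphisms are already known to be morphisms.\<close>
    have "dm_fun X M (\<lambda>x g m. dm_fun X M (\<lambda>x g m. \<zero>\<^bsub>fib N x g\<^esub>) x g m \<ominus>\<^bsub>fib N x g\<^esub> \<phi> x g m)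
        \<oplus>\<^bsub>dm_hom_module K X d M N\<^esub> \<phi> = \<zero>\<^bsub>dm_hom_module K X d M N\<^esub>"
      unfolding dm_hom_module_simps
    proof (rule dm_fun_cong)
      fix x g m assume xm: "x \<in> X" "m \<in> carrier (fib M x g)"
      interpret N: module K "fib N x g" using dm_module[OF N xm(1)] .
      show "dm_fun X M (\<lambda>x g m. dm_fun X M (\<lambda>x g m. \<zero>\<^bsub>fib N x g\<^esub>) x g m \<ominus>\<^bsub>fib N x g\<^esub> \<phi> x g m) x g m
          \<oplus>\<^bsub>fib N x g\<^esub> \<phi> x g m = \<zero>\<^bsub>fib N x g\<^esub>"
        using xm cl(1)[OF xm] by (simp add: a_minus_def N.M.a_assoc N.M.l_neg)
    qed
    then show "\<exists>\<psi>\<in>carrier (dm_hom_module K X d M N).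
        \<psi> \<oplus>\<^bsub>dm_hom_module K X d M N\<^esub> \<phi> = \<zero>\<^bsub>dm_hom_module K X d M N\<^esub>"
      by (intro bexI[of _ "dm_fun X M (\<lambda>x g m. dm_fun X M (\<lambda>x g m. \<zero>\<^bsub>fib N x g\<^esub>) x g m \<ominus>\<^bsub>fib N x g\<^esub> \<phi> x g m)"])
        (simp_all only: dm_hom_module_simps dm_diff_hom[OF M N dm_zero_hom[OF M N] h(1)])
  qed (simp only: dm_hom_module_simps homs)
  fix a b \<phi> \<psi>
  assume ab: "a \<in> carrier K" "b \<in> carrier K"
    and "\<phi> \<in> carrier (dm_hom_module K X d M N)" "\<psi> \<in> carrier (dm_hom_module K X d M N)"
  then have h: "\<phi> \<in> dm_hom K X d M N" "\<psi> \<in> dm_hom K X d M N" by simp_all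
  note cl = h[THEN dm_hom_closed]
  show "a \<odot>\<^bsub>dm_hom_module K X d M N\<^esub> \<phi> \<in> carrier (dm_hom_module K X d M N)"
    by (simp only: dm_hom_module_simps homs(3)[OF h(1) ab(1)])
  show "(a \<oplus>\<^bsub>K\<^esub> b) \<odot>\<^bsub>dm_hom_module K X d M N\<^esub> \<phi> = a \<odot>\<^bsub>dm_hom_module K X d M N\<^esub> \<phi>
      \<oplus>\<^bsub>dm_hom_module K X d M N\<^esub> b \<odot>\<^bsub>dm_hom_module K X d M N\<^esub> \<phi>"
    unfolding dm_hom_module_simps
    by (rule dm_fun_cong) (simp add: module.smult_l_distr[OF dm_module[OF N]] ab cl)
  show "a \<odot>\<^bsub>dm_hom_module K X d M N\<^esub> (\<phi> \<oplus>\<^bsub>dm_hom_module K X d M N\<^esub> \<psi>) =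
      a \<odot>\<^bsub>dm_hom_module K X d M N\<^esub> \<phi> \<oplus>\<^bsub>dm_hom_module K X d M N\<^esub> a \<odot>\<^bsub>dm_hom_module K X d M N\<^esub> \<psi>"
    unfolding dm_hom_module_simps
    by (rule dm_fun_cong) (simp add: module.smult_r_distr[OF dm_module[OF N]] ab cl)
  show "(a \<otimes>\<^bsub>K\<^esub> b) \<odot>\<^bsub>dm_hom_module K X d M N\<^esub> \<phi> =
      a \<odot>\<^bsub>dm_hom_module K X d M N\<^esub> (b \<odot>\<^bsub>dm_hom_module K X d M N\<^esub> \<phi>)"
    unfolding dm_hom_module_simps
    by (rule dm_fun_cong) (simp add: module.smult_assoc1[OF dm_module[OF N]] ab cl)
next
  fix \<phi> assume "\<phi> \<in> carrier (dm_hom_module K X d M N)"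
  then have h: "\<phi> \<in> dm_hom K X d M N" by simp
  have "dm_fun X M (\<lambda>x g m. \<one>\<^bsub>K\<^esub> \<odot>\<^bsub>fib N x g\<^esub> \<phi> x g m) = dm_fun X M \<phi>"
    by (rule dm_fun_cong) (simp add: module.smult_one[OF dm_module[OF N]] dm_hom_closed[OF h])
  then show "\<one>\<^bsub>K\<^esub> \<odot>\<^bsub>dm_hom_module K X d M N\<^esub> \<phi> = \<phi>"
    by (simp add: dm_fun_hom_eq[OF h])
qed (rule K)

text \<open>Subtraction in the module of morphisms is defined through an abstract inverse; as
  evaluation is linear, it can nevertheless be computed pointwise.\<close>

lemma dm_eval_linear:
  assumes "x \<in> X" "m \<in> carrier (fib M x g)"
  shows "(\<lambda>\<phi>. \<phi> x g m) \<in> linear_maps K (dm_hom_module K X d M N) (fib N x g)"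
  using assms by (intro linear_mapsI) (simp_all add: dm_hom_closed)

lemma dm_precomp_linear:
  assumes L: "is_distance_module K X d L" and M: "is_distance_module K X d M"
    and a: "a \<in> dm_hom K X d L M"
  shows "(\<lambda>\<phi>. dm_comp X L \<phi> a) \<in> linear_maps K (dm_hom_module K X d M N) (dm_hom_module K X d L N)"
proof (rule linear_mapsI)
  show "dm_comp X L \<phi> a \<in> carrier (dm_hom_module K X d L N)"
    if "\<phi> \<in> carrier (dm_hom_module K X d M N)" for \<phi>
    using that dm_comp_hom[OF L a] by simp
  fix \<phi> \<psi>
  assume "\<phi> \<in> carrier (dm_hom_module K X d M N)" "\<psi> \<in> carrier (dm_hom_module K X d M N)"
  show "dm_comp X L (\<phi> \<oplus>\<^bsub>dm_hom_module K X d M N\<^esub> \<psi>) a =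
      dm_comp X L \<phi> a \<oplus>\<^bsub>dm_hom_module K X d L N\<^esub> dm_comp X L \<psi> a"
    unfolding dm_hom_module_simps dm_comp_def
    by (rule dm_fun_cong) (simp add: dm_hom_closed[OF a])
next
  fix c \<phi>
  show "dm_comp X L (c \<odot>\<^bsub>dm_hom_module K X d M N\<^esub> \<phi>) a =
      c \<odot>\<^bsub>dm_hom_module K X d L N\<^esub> dm_comp X L \<phi> a"
    unfolding dm_hom_module_simps dm_comp_def
    by (rule dm_fun_cong) (simp add: dm_hom_closed[OF a])
qed

section \<open>Transport along an injection\<close>

text \<open>Each operation decodes with \<open>v\<close>, computes in \<open>M\<close> and encodes
  again. All that is asked of \<open>v\<close> is \<open>v (e m) = m\<close> on the carriers, so it
  may be arbitrary off their images.\<close>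

definition module_copy :: "('a \<Rightarrow> 'b) \<Rightarrow> ('b \<Rightarrow> 'a) \<Rightarrow> ('k, 'a) module \<Rightarrow> ('k, 'b) module" where
  "module_copy e v M =
     \<lparr>carrier = e ` carrier M, mult = undefined, one = undefined,
      zero = e \<zero>\<^bsub>M\<^esub>, add = (\<lambda>a b. e (v a \<oplus>\<^bsub>M\<^esub> v b)), smult = (\<lambda>c a. e (c \<odot>\<^bsub>M\<^esub> v a))\<rparr>"

lemma module_module_copy:
  assumes M: "module K M" and v: "\<And>m. m \<in> carrier M \<Longrightarrow> v (e m) = m"
  shows "module K (module_copy e v M)"
proof -
  interpret M: module K M by fact
  have ag: "abelian_group (module_copy e v M)"
  proof (rule abelian_groupI)
    fix x assume "x \<in> carrier (module_copy e v M)"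
    then obtain m where m: "m \<in> carrier M" "x = e m"
      by (auto simp: module_copy_def)
    then show "\<exists>y\<in>carrier (module_copy e v M). y \<oplus>\<^bsub>module_copy e v M\<^esub> x = \<zero>\<^bsub>module_copy e v M\<^esub>"
      by (intro bexI[of _ "e (\<ominus>\<^bsub>M\<^esub> m)"]) (auto simp: module_copy_def v M.M.l_neg)
  qed (auto simp: module_copy_def v M.M.a_ac)
  show ?thesis
    by (rule moduleI[OF M.R.is_cring ag])
      (auto simp: module_copy_def v M.smult_l_distr M.smult_r_distr M.smult_assoc1)
qed

lemma module_copy_linear:
  assumes M: "module K M" and v: "\<And>m. m \<in> carrier M \<Longrightarrow> v (e m) = m"
  shows "e \<in> linear_maps K M (module_copy e v M)" "v \<in> linear_maps K (module_copy e v M) M"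
proof -
  interpret M: module K M by fact
  show "e \<in> linear_maps K M (module_copy e v M)" "v \<in> linear_maps K (module_copy e v M) M"
    by (auto intro!: linear_mapsI simp: module_copy_def v)
qed

definition dm_copy ::
  "('a \<Rightarrow> 'b) \<Rightarrow> ('b \<Rightarrow> 'a) \<Rightarrow> ('x, 'k, 'a) distance_module \<Rightarrow> ('x, 'k, 'b) distance_module" where
  "dm_copy e v M =
     \<lparr>fib = (\<lambda>x g. module_copy e v (fib M x g)), act = (\<lambda>x y g a. e (act M x y g (v a)))\<rparr>"

lemma fib_dm_copy [simp]: "fib (dm_copy e v M) x g = module_copy e v (fib M x g)"
  by (simp add: dm_copy_def)

lemma act_dm_copy [simp]: "act (dm_copy e v M) x y g a = e (act M x y g (v a))"
  by (simp add: dm_copy_def)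

lemma carrier_module_copy [simp]: "carrier (module_copy e v M) = e ` carrier M"
  by (simp add: module_copy_def)

lemma zero_module_copy [simp]: "\<zero>\<^bsub>module_copy e v M\<^esub> = e \<zero>\<^bsub>M\<^esub>"
  by (simp add: module_copy_def)

lemma is_distance_module_dm_copy:
  assumes M: "is_distance_module K X d M"
    and v: "\<And>x g m. \<lbrakk>x \<in> X; m \<in> carrier (fib M x g)\<rbrakk> \<Longrightarrow> v (e m) = m"
  shows "is_distance_module K X d (dm_copy e v M)"
proof (rule is_distance_moduleI)
  show mod: "module K (fib (dm_copy e v M) x g)" if "x \<in> X" for x g
    using module_module_copy[where e=e and v=v, OF dm_module[OF M that] v[OF that]] by simp
  show "act (dm_copy e v M) x y g
      \<in> linear_maps K (fib (dm_copy e v M) x g) (fib (dm_copy e v M) y (g + rdist d x y))"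
    if "x \<in> X" "y \<in> X" "d x y < \<infinity>" for x y g
  proof -
    have "(\<lambda>a. e (act M x y g (v a)))
        \<in> linear_maps K (fib (dm_copy e v M) x g) (fib (dm_copy e v M) y (g + rdist d x y))"
      unfolding fib_dm_copy
      by (rule linear_maps_comp[OF linear_maps_comp[OF module_copy_linear(2)[where e=e and v=v, OF dm_module[OF M] v]
        dm_act[OF M that]] module_copy_linear(1)[where e=e and v=v, OF dm_module[OF M] v]]) (use that in auto)
    then show ?thesis by (simp add: dm_copy_def)
  qed
  show "act (dm_copy e v M) x x g a = a" if "x \<in> X" "a \<in> carrier (fib (dm_copy e v M) x g)" for x a g
    using that by (auto simp: v dm_act_self[OF M])
  show "act (dm_copy e v M) y z (g + rdist d x y) (act (dm_copy e v M) x y g a) =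
      (if between d x y z then act (dm_copy e v M) x z g a
       else \<zero>\<^bsub>fib (dm_copy e v M) z (g + rdist d x y + rdist d y z)\<^esub>)"
    if h: "x \<in> X" "y \<in> X" "z \<in> X" "d x y < \<infinity>" "d y z < \<infinity>" "a \<in> carrier (fib (dm_copy e v M) x g)"
    for x y z a g
  proof -
    obtain m where m: "m \<in> carrier (fib M x g)" "a = e m"
      using h(6) by auto
    then have "act M x y g m \<in> carrier (fib M y (g + rdist d x y))"
      using linear_maps_closed[OF dm_act[OF M h(1,2,4)]] by blast
    then show ?thesis
      using m h(1-5) by (simp add: v dm_act_act[OF M])
  qed
qed

lemma graded_distance_module_dm_copy:
  assumes "graded_distance_module K X d G M"
    and "\<And>x g m. \<lbrakk>x \<in> X; m \<in> carrier (fib M x g)\<rbrakk> \<Longrightarrow> v (e m) = m"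
  shows "graded_distance_module K X d G (dm_copy e v M)"
  using assms is_distance_module_dm_copy[of K X d M v e] unfolding graded_distance_module_def by auto

lemma dm_copy_homs:
  assumes M: "is_distance_module K X d M"
    and v: "\<And>x g m. \<lbrakk>x \<in> X; m \<in> carrier (fib M x g)\<rbrakk> \<Longrightarrow> v (e m) = m"
  shows dm_copy_encode: "dm_fun X M (\<lambda>x g. e) \<in> dm_hom K X d M (dm_copy e v M)"
    and dm_copy_decode: "dm_fun X (dm_copy e v M) (\<lambda>x g. v) \<in> dm_hom K X d (dm_copy e v M) M"
proof -
  show "dm_fun X M (\<lambda>x g. e) \<in> dm_hom K X d M (dm_copy e v M)"
    by (rule dm_fun_hom[OF M]) (auto simp: v intro!: module_copy_linear[where e=e and v=v, OF dm_module[OF M] v])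
  show "dm_fun X (dm_copy e v M) (\<lambda>x g. v) \<in> dm_hom K X d (dm_copy e v M) M"
  proof (rule dm_fun_hom[OF is_distance_module_dm_copy[where e=e and v=v, OF M v]])
    show "v \<in> linear_maps K (fib (dm_copy e v M) x g) (fib M x g)" if "x \<in> X" for x g
      using module_copy_linear(2)[where e=e and v=v, OF dm_module[OF M that] v[OF that]] by simp
    show "act M x y g (v m) = v (act (dm_copy e v M) x y g m)"
      if "x \<in> X" "y \<in> X" "d x y < \<infinity>" "m \<in> carrier (fib (dm_copy e v M) x g)" for x y g m
      using that v[OF that(2) linear_maps_closed[OF dm_act[OF M that(1-3)]]] by (auto simp: v)
  qed auto
qed

section \<open>Lifting against projective distance modules\<close>

text \<open>Projectivity lifts against surjections, and exactness of a pair of maps says that the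
  first is onto the kernel of the second. Making that kernel an object connects the two.\<close>

definition dm_kernel ::
  "('x, 'k, 'a) distance_module \<Rightarrow> ('x, 'k, 'b) distance_module \<Rightarrow>
   ('x \<Rightarrow> real \<Rightarrow> 'a \<Rightarrow> 'b) \<Rightarrow> ('x, 'k, 'a) distance_module" where
  "dm_kernel M N \<phi> =
     \<lparr>fib = (\<lambda>x g. fib M x g \<lparr>carrier := {m \<in> carrier (fib M x g). \<phi> x g m = \<zero>\<^bsub>fib N x g\<^esub>}\<rparr>),
      act = act M\<rparr>"

lemma graded_dm_kernel:
  assumes M: "graded_distance_module K X d G M" and N: "is_distance_module K X d N"
    and \<phi>: "\<phi> \<in> dm_hom K X d M N"
  shows "graded_distance_module K X d G (dm_kernel M N \<phi>)"
proof -
  note M' = graded_imp_distance_module[OF M]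
  have zero: "\<zero>\<^bsub>fib M x g\<^esub> \<in> carrier (fib M x g)" if "x \<in> X" for x g
    using module.carrier_is_submodule[OF dm_module[OF M' that, of g]] by (simp add: submodule_def subgroup_def)
  have "is_distance_module K X d (dm_kernel M N \<phi>)"
  proof (rule is_distance_moduleI)
    show "module K (fib (dm_kernel M N \<phi>) x g)" if "x \<in> X" for x g
      using submodule.submodule_is_module[OF submodule_kernel[OF dm_hom_linear[OF \<phi> that]
        dm_module[OF M' that] dm_module[OF N that]] dm_module[OF M' that]]
      by (simp add: dm_kernel_def)
    show "act (dm_kernel M N \<phi>) x y g \<in> linear_maps K (fib (dm_kernel M N \<phi>) x g)
        (fib (dm_kernel M N \<phi>) y (g + rdist d x y))"
      if xy: "x \<in> X" "y \<in> X" "d x y < \<infinity>" for x y g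
    proof (rule linear_mapsI)
      note lin = dm_act[OF M' xy, of g]
      fix u assume "u \<in> carrier (fib (dm_kernel M N \<phi>) x g)"
      then have u: "u \<in> carrier (fib M x g)" "\<phi> x g u = \<zero>\<^bsub>fib N x g\<^esub>"
        by (auto simp: dm_kernel_def)
      \<comment> \<open>Naturality of \<phi>, together with linearity of the action of
        \<open>N\<close>, keeps the kernel stable under the action.\<close>
      have "\<phi> y (g + rdist d x y) (act M x y g u) = \<zero>\<^bsub>fib N y (g + rdist d x y)\<^esub>"
        using dm_hom_act[OF \<phi> xy u(1)] u(2)
          linear_maps_zero[OF dm_act[OF N xy] dm_module[OF N] dm_module[OF N]] xy by simp
      then show "act (dm_kernel M N \<phi>) x y g u \<in> carrier (fib (dm_kernel M N \<phi>) y (g + rdist d x y))"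
        using linear_maps_closed[OF lin u(1)] by (simp add: dm_kernel_def)
    qed (use linear_mapsD[OF dm_act[OF M' xy]] in \<open>auto simp: dm_kernel_def\<close>)
    show "act (dm_kernel M N \<phi>) x x g m = m"
      if "x \<in> X" "m \<in> carrier (fib (dm_kernel M N \<phi>) x g)" for x m g
      using that by (simp add: dm_kernel_def dm_act_self[OF M'])
    show "act (dm_kernel M N \<phi>) y z (g + rdist d x y) (act (dm_kernel M N \<phi>) x y g m) =
        (if between d x y z then act (dm_kernel M N \<phi>) x z g m
         else \<zero>\<^bsub>fib (dm_kernel M N \<phi>) z (g + rdist d x y + rdist d y z)\<^esub>)"
      if "x \<in> X" "y \<in> X" "z \<in> X" "d x y < \<infinity>" "d y z < \<infinity>"
        "m \<in> carrier (fib (dm_kernel M N \<phi>) x g)" for x y z m g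
      using that by (simp add: dm_kernel_def dm_act_act[OF M'])
  qed
  moreover have "carrier (fib (dm_kernel M N \<phi>) x g) = {\<zero>\<^bsub>fib (dm_kernel M N \<phi>) x g\<^esub>}"
    if "x \<in> X" "g \<notin> G" for x g
  proof -
    have "carrier (fib M x g) = {\<zero>\<^bsub>fib M x g\<^esub>}"
      using M that by (simp add: graded_distance_module_def)
    moreover have "\<phi> x g \<zero>\<^bsub>fib M x g\<^esub> = \<zero>\<^bsub>fib N x g\<^esub>"
      using linear_maps_zero[OF dm_hom_linear[OF \<phi>] dm_module[OF M'] dm_module[OF N]] that by blast
    ultimately show ?thesis by (auto simp: dm_kernel_def)
  qed
  ultimately show ?thesis
    by (simp add: graded_distance_module_def)
qed

lemma dm_hom_into_kernel:
  assumes \<phi>: "\<phi> \<in> dm_hom K X d L M"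
    and mem: "\<And>x g m. \<lbrakk>x \<in> X; m \<in> carrier (fib L x g)\<rbrakk> \<Longrightarrow> \<psi> x g (\<phi> x g m) = \<zero>\<^bsub>fib N x g\<^esub>"
    and L: "is_distance_module K X d L"
  shows "\<phi> \<in> dm_hom K X d L (dm_kernel M N \<psi>)"
proof -
  have "dm_fun X L \<phi> \<in> dm_hom K X d L (dm_kernel M N \<psi>)"
  proof (rule dm_fun_hom[OF L])
    show "\<phi> x g \<in> linear_maps K (fib L x g) (fib (dm_kernel M N \<psi>) x g)" if "x \<in> X" for x g
      using mem that linear_mapsD[OF dm_hom_linear[OF \<phi> that]]
      by (intro linear_mapsI) (simp_all add: dm_kernel_def)
    show "act (dm_kernel M N \<psi>) x y g (\<phi> x g m) = \<phi> y (g + rdist d x y) (act L x y g m)"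
      if "x \<in> X" "y \<in> X" "d x y < \<infinity>" "m \<in> carrier (fib L x g)" for x y g m
      using dm_hom_act[OF \<phi> that] by (simp add: dm_kernel_def)
  qed
  then show ?thesis using dm_fun_hom_eq[OF \<phi>] by simp
qed

text \<open>By exactness \<beta> is onto the kernel of \<gamma>, into which \<open>f\<close> maps by
  assumption. The kernel has its elements in the type of \<open>C\<close>, so projectivity applies
  even if \<open>E\<close> lives in another type, as the augmented module does.\<close>

lemma projective_lift:
  fixes P B C :: "('x, 'k, 'p) distance_module" and E :: "('x, 'k, 'a) distance_module"
  assumes P: "dm_projective K X d G P"
    and B: "graded_distance_module K X d G B" and C: "graded_distance_module K X d G C"
    and E: "is_distance_module K X d E"
    and \<beta>: "\<beta> \<in> dm_hom K X d B C" and \<gamma>: "\<gamma> \<in> dm_hom K X d C E"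
    and exact: "dm_exact X B C E \<beta> \<gamma>"
    and f: "f \<in> dm_hom K X d P C"
    and zero: "\<And>x g m. \<lbrakk>x \<in> X; m \<in> carrier (fib P x g)\<rbrakk> \<Longrightarrow> \<gamma> x g (f x g m) = \<zero>\<^bsub>fib E x g\<^esub>"
  shows "\<exists>h\<in>dm_hom K X d P B. \<forall>x\<in>X. \<forall>g. \<forall>m\<in>carrier (fib P x g). \<beta> x g (h x g m) = f x g m"
proof -
  let ?Z = "dm_kernel C E \<gamma>"
  have Z: "graded_distance_module K X d G ?Z"
    by (rule graded_dm_kernel[OF C E \<gamma>])
  have P': "graded_distance_module K X d G P"
    using P by (simp add: dm_projective_def)
  have im: "\<beta> x g ` carrier (fib B x g) = carrier (fib ?Z x g)" if "x \<in> X" for x g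
    using exact that by (simp add: dm_exact_def dm_kernel_def)
  have "\<beta> \<in> dm_hom K X d B ?Z"
    using exact by (intro dm_hom_into_kernel[OF \<beta> _ graded_imp_distance_module[OF B]]) (auto simp: dm_exact_def)
  moreover have "f \<in> dm_hom K X d P ?Z"
    using zero by (intro dm_hom_into_kernel[OF f _ graded_imp_distance_module[OF P']])
  moreover have "dm_surj X B ?Z \<beta>"
    using im by (simp add: dm_surj_def)
  ultimately obtain h where "h \<in> dm_hom K X d P B" "dm_comp X P \<beta> h = f"
    using P B Z unfolding dm_projective_def by blast
  then show ?thesis by force
qed

text \<open>Projectivity only tests against elements of type \<open>'p\<close>; the target is moved there along \<open>j\<close>.\<close>

lemma projective_lift_surj:
  fixes P B :: "('x, 'k, 'p) distance_module" and A :: "('x, 'k, 'a) distance_module"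
    and j :: "'a \<Rightarrow> 'p"
  assumes P: "dm_projective K X d G P"
    and B: "graded_distance_module K X d G B" and A: "graded_distance_module K X d G A"
    and \<beta>: "\<beta> \<in> dm_hom K X d B A" and surj: "dm_surj X B A \<beta>"
    and f: "f \<in> dm_hom K X d P A" and j: "inj j"
  shows "\<exists>h\<in>dm_hom K X d P B. \<forall>x\<in>X. \<forall>g. \<forall>m\<in>carrier (fib P x g). \<beta> x g (h x g m) = f x g m"
proof -
  let ?A = "dm_copy j (inv_into UNIV j) A"
  have v: "inv_into UNIV j (j m) = m" for m
    using j by simp
  note A' = graded_imp_distance_module[OF A]
  have P': "is_distance_module K X d P"
    using P by (simp add: dm_projective_def graded_distance_module_def)
  let ?J = "dm_fun X A (\<lambda>x g. j)"
  have J: "?J \<in> dm_hom K X d A ?A"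
    by (rule dm_copy_encode[where e=j and v="inv_into UNIV j", OF A' v])
  have s: "dm_surj X B ?A (dm_comp X B ?J \<beta>)"
    unfolding dm_surj_def
  proof (intro ballI allI)
    fix x g assume x: "x \<in> X"
    have "dm_comp X B ?J \<beta> x g ` carrier (fib B x g) = j ` \<beta> x g ` carrier (fib B x g)"
      using x dm_hom_closed[OF \<beta> x] by (auto simp: image_image intro!: image_cong)
    then show "dm_comp X B ?J \<beta> x g ` carrier (fib B x g) = carrier (fib ?A x g)"
      using surj x by (simp add: dm_surj_def)
  qed
  have "\<exists>h\<in>dm_hom K X d P B. dm_comp X P (dm_comp X B ?J \<beta>) h = dm_comp X P ?J f"
    using P B graded_distance_module_dm_copy[where e=j and v="inv_into UNIV j", OF A v] s
      dm_comp_hom[OF graded_imp_distance_module[OF B] \<beta> J] dm_comp_hom[OF P' f J]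
    unfolding dm_projective_def by blast
  then obtain h where h: "h \<in> dm_hom K X d P B"
    and eq: "dm_comp X P (dm_comp X B ?J \<beta>) h = dm_comp X P ?J f" by blast
  have "\<beta> x g (h x g m) = f x g m" if xm: "x \<in> X" "m \<in> carrier (fib P x g)" for x g m
  proof -
    have "j (\<beta> x g (h x g m)) = j (f x g m)"
      using fun_cong[OF fun_cong[OF fun_cong[OF eq, of x], of g], of m] xm
        dm_hom_closed[OF h xm] dm_hom_closed[OF f xm] dm_hom_closed[OF \<beta> xm(1)] by simp
    then show ?thesis using j by (simp add: inj_eq)
  qed
  with h show ?thesis by blast
qed


section \<open>Comparison of projective resolutions\<close>

lemma projective_resolutionD:
  assumes "projective_resolution K X d G A P D \<epsilon>"
  shows resolution_projective: "dm_projective K X d G (P n)"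
    and resolution_graded: "graded_distance_module K X d G (P n)"
    and resolution_module: "is_distance_module K X d (P n)"
    and resolution_diff: "D n \<in> dm_hom K X d (P (Suc n)) (P n)"
    and resolution_aug: "\<epsilon> \<in> dm_hom K X d (P 0) A"
    and resolution_surj: "dm_surj X (P 0) A \<epsilon>"
    and resolution_exact_0: "dm_exact X (P (Suc 0)) (P 0) A (D 0) \<epsilon>"
    and resolution_exact: "dm_exact X (P (Suc (Suc n))) (P (Suc n)) (P n) (D (Suc n)) (D n)"
  using assms by (auto simp: projective_resolution_def dm_projective_def graded_distance_module_def)

lemma resolution_diff_diff:
  assumes P: "projective_resolution K X d G A P D \<epsilon>"
  shows resolution_aug_diff: "\<lbrakk>x \<in> X; m \<in> carrier (fib (P (Suc 0)) x g)\<rbrakk> \<Longrightarrow>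
      \<epsilon> x g (D 0 x g m) = \<zero>\<^bsub>fib A x g\<^esub>"
    and "\<lbrakk>x \<in> X; m \<in> carrier (fib (P (Suc (Suc n))) x g)\<rbrakk> \<Longrightarrow>
      D n x g (D (Suc n) x g m) = \<zero>\<^bsub>fib (P n) x g\<^esub>"
  using resolution_exact_0[OF P] resolution_exact[OF P, of n] unfolding dm_exact_def by blast+

text \<open>Built degree by degree: the map in degree \<open>n\<close> composed with the
  differential of \<open>P\<close> takes values in cycles of \<open>Q\<close>, and exactness of
  \<open>Q\<close> with projectivity of \<open>P\<close> lifts this composite one degree up.\<close>

lemma resolution_chain_map:
  fixes P Q :: "nat \<Rightarrow> ('x, 'k, 'p) distance_module" and A :: "('x, 'k, 'a) distance_module"
    and j :: "'a \<Rightarrow> 'p"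
  assumes A: "graded_distance_module K X d G A" and j: "inj j"
    and P: "projective_resolution K X d G A P D \<epsilon>"
    and Q: "projective_resolution K X d G A Q D' \<epsilon>'"
  obtains a where "\<And>n. a n \<in> dm_hom K X d (P n) (Q n)"
    and "\<And>x g m. \<lbrakk>x \<in> X; m \<in> carrier (fib (P 0) x g)\<rbrakk> \<Longrightarrow> \<epsilon>' x g (a 0 x g m) = \<epsilon> x g m"
    and "\<And>n x g m. \<lbrakk>x \<in> X; m \<in> carrier (fib (P (Suc n)) x g)\<rbrakk> \<Longrightarrow>
      D' n x g (a (Suc n) x g m) = a n x g (D n x g m)"
proof -
  note Pm = resolution_module[OF P] and DP = resolution_diff[OF P] and DQ = resolution_diff[OF Q]
  \<comment> \<open>The next choice sees only the previous map, so the invariant records exactly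
    what the next lift requires: compatibility with the augmentations in degree 0, and above that
    vanishing of \<open>D' k\<close> on the map to be lifted.\<close>
  define R where "R n b \<longleftrightarrow> b \<in> dm_hom K X d (P n) (Q n) \<and>
    (case n of 0 \<Rightarrow> \<forall>x\<in>X. \<forall>g. \<forall>m\<in>carrier (fib (P 0) x g). \<epsilon>' x g (b x g m) = \<epsilon> x g m
     | Suc k \<Rightarrow> \<forall>x\<in>X. \<forall>g. \<forall>m\<in>carrier (fib (P (Suc n)) x g).
         D' k x g (b x g (D n x g m)) = \<zero>\<^bsub>fib (Q k) x g\<^esub>)" for n b
  have "\<exists>a. \<forall>n. R n (a n) \<and> (\<forall>x\<in>X. \<forall>g. \<forall>m\<in>carrier (fib (P (Suc n)) x g).
      D' n x g (a (Suc n) x g m) = a n x g (D n x g m))"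
  proof (rule dependent_nat_choice)
    show "\<exists>b. R 0 b"
      using projective_lift_surj[OF resolution_projective[OF P] resolution_graded[OF Q] A
          resolution_aug[OF Q] resolution_surj[OF Q] resolution_aug[OF P] j]
      by (auto simp: R_def)
  next
    fix b n assume b: "R n b"
    let ?f = "dm_comp X (P (Suc n)) b (D n)"
    have bh: "b \<in> dm_hom K X d (P n) (Q n)"
      using b by (simp add: R_def)
    have f: "?f \<in> dm_hom K X d (P (Suc n)) (Q n)"
      by (rule dm_comp_hom[OF Pm DP bh])
    have "\<exists>h\<in>dm_hom K X d (P (Suc n)) (Q (Suc n)). \<forall>x\<in>X. \<forall>g. \<forall>m\<in>carrier (fib (P (Suc n)) x g).
        D' n x g (h x g m) = ?f x g m"
    proof (cases n)
      case 0
      have "\<epsilon>' x g (?f x g m) = \<zero>\<^bsub>fib A x g\<^esub>" if "x \<in> X" "m \<in> carrier (fib (P (Suc n)) x g)" for x g m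
        using that b 0 dm_hom_closed[OF DP[of 0]] resolution_aug_diff[OF P] by (simp add: R_def)
      then show ?thesis
        using resolution_exact_0[OF Q] DQ f resolution_aug[OF Q] 0
        by (intro projective_lift[where \<gamma> = \<epsilon>', OF resolution_projective[OF P] resolution_graded[OF Q]
          resolution_graded[OF Q] graded_imp_distance_module[OF A]]) auto
    next
      case (Suc k)
      have "D' k x g (?f x g m) = \<zero>\<^bsub>fib (Q k) x g\<^esub>" if "x \<in> X" "m \<in> carrier (fib (P (Suc n)) x g)" for x g m
        using that b Suc by (simp add: R_def)
      then show ?thesis
        using resolution_exact[OF Q, of k] DQ f Suc
        by (intro projective_lift[where \<gamma> = "D' k" and C = "Q (Suc k)" and E = "Q k", OF
          resolution_projective[OF P] resolution_graded[OF Q] resolution_graded[OF Q]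
          resolution_module[OF Q]]) auto
    qed
    then obtain h where h: "h \<in> dm_hom K X d (P (Suc n)) (Q (Suc n))"
      and eq: "\<And>x g m. \<lbrakk>x \<in> X; m \<in> carrier (fib (P (Suc n)) x g)\<rbrakk> \<Longrightarrow> D' n x g (h x g m) = b x g (D n x g m)"
      by auto
    have "D' n x g (h x g (D (Suc n) x g m)) = \<zero>\<^bsub>fib (Q n) x g\<^esub>"
      if "x \<in> X" "m \<in> carrier (fib (P (Suc (Suc n))) x g)" for x g m
      using eq[OF that(1) dm_hom_closed[OF DP that]] resolution_diff_diff(2)[OF P that]
        linear_maps_zero[OF dm_hom_linear[OF bh that(1)] dm_module[OF Pm that(1)]
          dm_module[OF resolution_module[OF Q] that(1)]] by simp
    with h eq show "\<exists>h. R (Suc n) h \<and> (\<forall>x\<in>X. \<forall>g. \<forall>m\<in>carrier (fib (P (Suc n)) x g).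
        D' n x g (h x g m) = b x g (D n x g m))"
      by (auto simp: R_def)
  qed
  then obtain a where a: "\<And>n. R n (a n)" "\<And>n. \<forall>x\<in>X. \<forall>g. \<forall>m\<in>carrier (fib (P (Suc n)) x g).
      D' n x g (a (Suc n) x g m) = a n x g (D n x g m)"
    by blast
  show thesis
  proof (rule that[of a])
    show "a n \<in> dm_hom K X d (P n) (Q n)" for n
      using a(1)[of n] by (simp add: R_def)
    show "\<epsilon>' x g (a 0 x g m) = \<epsilon> x g m" if "x \<in> X" "m \<in> carrier (fib (P 0) x g)" for x g m
      using a(1)[of 0] that by (simp add: R_def)
    show "D' n x g (a (Suc n) x g m) = a n x g (D n x g m)"
      if "x \<in> X" "m \<in> carrier (fib (P (Suc n)) x g)" for n x g m
      using a(2) that by blast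
  qed
qed

text \<open>The map to be lifted is \<open>c (Suc n)\<close> minus \<open>s n\<close> after
  \<open>D n\<close>; its values are cycles because \<open>D' n\<close> turns both terms into
  \<open>c n\<close> after \<open>D n\<close>. Applied to a difference of two lifts of one map, this
  is uniqueness of lifts up to homotopy.\<close>

lemma resolution_null_homotopy:
  fixes P Q :: "nat \<Rightarrow> ('x, 'k, 'p) distance_module" and A :: "('x, 'k, 'a) distance_module"
  assumes A: "is_distance_module K X d A"
    and P: "projective_resolution K X d G A P D \<epsilon>"
    and Q: "projective_resolution K X d G A Q D' \<epsilon>'"
    and c: "\<And>n. c n \<in> dm_hom K X d (P n) (Q n)"
    and c0: "\<And>x g m. \<lbrakk>x \<in> X; m \<in> carrier (fib (P 0) x g)\<rbrakk> \<Longrightarrow> \<epsilon>' x g (c 0 x g m) = \<zero>\<^bsub>fib A x g\<^esub>"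
    and cD: "\<And>n x g m. \<lbrakk>x \<in> X; m \<in> carrier (fib (P (Suc n)) x g)\<rbrakk> \<Longrightarrow>
      D' n x g (c (Suc n) x g m) = c n x g (D n x g m)"
  obtains s where "\<And>n. s n \<in> dm_hom K X d (P n) (Q (Suc n))"
    and "\<And>x g m. \<lbrakk>x \<in> X; m \<in> carrier (fib (P 0) x g)\<rbrakk> \<Longrightarrow> D' 0 x g (s 0 x g m) = c 0 x g m"
    and "\<And>n x g m. \<lbrakk>x \<in> X; m \<in> carrier (fib (P (Suc n)) x g)\<rbrakk> \<Longrightarrow>
      D' (Suc n) x g (s (Suc n) x g m) = c (Suc n) x g m \<ominus>\<^bsub>fib (Q (Suc n)) x g\<^esub> s n x g (D n x g m)"
proof -
  note Pm = resolution_module[OF P] and Qm = resolution_module[OF Q]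
    and DP = resolution_diff[OF P] and DQ = resolution_diff[OF Q]
  \<comment> \<open>The last conjunct is the homotopy identity composed with \<open>D n\<close>.
    There the term with the previous homotopy drops out since \<open>D\<close> squares to zero, so
    the invariant refers to no earlier choice.\<close>
  define R where "R n s \<longleftrightarrow> s \<in> dm_hom K X d (P n) (Q (Suc n)) \<and>
    (n = 0 \<longrightarrow> (\<forall>x\<in>X. \<forall>g. \<forall>m\<in>carrier (fib (P 0) x g). D' 0 x g (s x g m) = c 0 x g m)) \<and>
    (\<forall>x\<in>X. \<forall>g. \<forall>m\<in>carrier (fib (P (Suc n)) x g). D' n x g (s x g (D n x g m)) = c n x g (D n x g m))"
    for n s
  have "\<exists>s. \<forall>n. R n (s n) \<and> (\<forall>x\<in>X. \<forall>g. \<forall>m\<in>carrier (fib (P (Suc n)) x g).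
      D' (Suc n) x g (s (Suc n) x g m) = c (Suc n) x g m \<ominus>\<^bsub>fib (Q (Suc n)) x g\<^esub> s n x g (D n x g m))"
  proof (rule dependent_nat_choice)
    have "\<exists>h\<in>dm_hom K X d (P 0) (Q (Suc 0)). \<forall>x\<in>X. \<forall>g. \<forall>m\<in>carrier (fib (P 0) x g).
        D' 0 x g (h x g m) = c 0 x g m"
      by (rule projective_lift[OF resolution_projective[OF P] resolution_graded[OF Q]
        resolution_graded[OF Q] A DQ resolution_aug[OF Q] resolution_exact_0[OF Q] c c0])
    then show "\<exists>s. R 0 s"
      using dm_hom_closed[OF DP] by (auto simp: R_def)
  next
    fix s n assume s: "R n s"
    have sh: "s \<in> dm_hom K X d (P n) (Q (Suc n))"
      using s by (simp add: R_def)
    let ?t = "dm_comp X (P (Suc n)) s (D n)"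
    have t: "?t \<in> dm_hom K X d (P (Suc n)) (Q (Suc n))"
      by (rule dm_comp_hom[OF Pm DP sh])
    let ?f = "dm_fun X (P (Suc n)) (\<lambda>x g m. c (Suc n) x g m \<ominus>\<^bsub>fib (Q (Suc n)) x g\<^esub> ?t x g m)"
    have f: "?f \<in> dm_hom K X d (P (Suc n)) (Q (Suc n))"
      by (rule dm_diff_hom[OF Pm Qm c t])
    have "D' n x g (?f x g m) = \<zero>\<^bsub>fib (Q n) x g\<^esub>"
      if xm: "x \<in> X" "m \<in> carrier (fib (P (Suc n)) x g)" for x g m
    proof -
      interpret N: module K "fib (Q n) x g" using dm_module[OF Qm xm(1)] .
      have "D' n x g (?f x g m) = D' n x g (c (Suc n) x g m) \<ominus>\<^bsub>fib (Q n) x g\<^esub> D' n x g (?t x g m)"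
        using xm linear_maps_diff[OF dm_hom_linear[OF DQ xm(1)] dm_module[OF Qm xm(1)]
          dm_module[OF Qm xm(1)] dm_hom_closed[OF c xm] dm_hom_closed[OF t xm]] by simp
      also have "\<dots> = c n x g (D n x g m) \<ominus>\<^bsub>fib (Q n) x g\<^esub> c n x g (D n x g m)"
        using s xm by (simp add: R_def cD)
      also have "\<dots> = \<zero>\<^bsub>fib (Q n) x g\<^esub>"
        using dm_hom_closed[OF c xm(1) dm_hom_closed[OF DP xm]] by (simp add: a_minus_def N.M.r_neg)
      finally show ?thesis .
    qed
    then obtain h where h: "h \<in> dm_hom K X d (P (Suc n)) (Q (Suc (Suc n)))"
      and "\<And>x g m. \<lbrakk>x \<in> X; m \<in> carrier (fib (P (Suc n)) x g)\<rbrakk> \<Longrightarrow> D' (Suc n) x g (h x g m) = ?f x g m"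
      using projective_lift[OF resolution_projective[OF P] resolution_graded[OF Q]
        resolution_graded[OF Q] Qm DQ DQ resolution_exact[OF Q] f] by blast
    then have eq: "\<And>x g m. \<lbrakk>x \<in> X; m \<in> carrier (fib (P (Suc n)) x g)\<rbrakk> \<Longrightarrow>
        D' (Suc n) x g (h x g m) = c (Suc n) x g m \<ominus>\<^bsub>fib (Q (Suc n)) x g\<^esub> s x g (D n x g m)"
      by simp
    have "D' (Suc n) x g (h x g (D (Suc n) x g m)) = c (Suc n) x g (D (Suc n) x g m)"
      if xm: "x \<in> X" "m \<in> carrier (fib (P (Suc (Suc n))) x g)" for x g m
    proof -
      interpret N: module K "fib (Q (Suc n)) x g" using dm_module[OF Qm xm(1)] .
      have "s x g (D n x g (D (Suc n) x g m)) = \<zero>\<^bsub>fib (Q (Suc n)) x g\<^esub>"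
        using resolution_diff_diff(2)[OF P xm] linear_maps_zero[OF dm_hom_linear[OF sh xm(1)]
          dm_module[OF Pm xm(1)] dm_module[OF Qm xm(1)]] by simp
      then show ?thesis
        using eq[OF xm(1) dm_hom_closed[OF DP xm]] dm_hom_closed[OF c xm(1) dm_hom_closed[OF DP xm]]
        by (simp add: a_minus_def)
    qed
    with h eq show "\<exists>h. R (Suc n) h \<and> (\<forall>x\<in>X. \<forall>g. \<forall>m\<in>carrier (fib (P (Suc n)) x g).
        D' (Suc n) x g (h x g m) = c (Suc n) x g m \<ominus>\<^bsub>fib (Q (Suc n)) x g\<^esub> s x g (D n x g m))"
      by (auto simp: R_def)
  qed
  then obtain s where s: "\<And>n. R n (s n)" "\<And>n. \<forall>x\<in>X. \<forall>g. \<forall>m\<in>carrier (fib (P (Suc n)) x g).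
      D' (Suc n) x g (s (Suc n) x g m) = c (Suc n) x g m \<ominus>\<^bsub>fib (Q (Suc n)) x g\<^esub> s n x g (D n x g m)"
    by blast
  show thesis
  proof (rule that[of s])
    show "s n \<in> dm_hom K X d (P n) (Q (Suc n))" for n
      using s(1)[of n] by (simp add: R_def)
    show "D' 0 x g (s 0 x g m) = c 0 x g m" if "x \<in> X" "m \<in> carrier (fib (P 0) x g)" for x g m
      using s(1)[of 0] that by (simp add: R_def)
    show "D' (Suc n) x g (s (Suc n) x g m) = c (Suc n) x g m \<ominus>\<^bsub>fib (Q (Suc n)) x g\<^esub> s n x g (D n x g m)"
      if "x \<in> X" "m \<in> carrier (fib (P (Suc n)) x g)" for n x g m
      using s(2) that by blast
  qed
qed

lemma (in abelian_group) minus_add_cancel: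
  "\<lbrakk>a \<in> carrier G; b \<in> carrier G\<rbrakk> \<Longrightarrow> (a \<ominus> b) \<oplus> b = a"
  by (simp add: a_minus_def a_assoc l_neg)

lemma (in abelian_group) eq_if_minus_zero:
  "\<lbrakk>a \<ominus> b = \<zero>; a \<in> carrier G; b \<in> carrier G\<rbrakk> \<Longrightarrow> a = b"
  using minus_add_cancel[of a b] by simp

section \<open>Hom complexes of a resolution, with cocycles and coboundaries described on
  elements\<close>

abbreviation hom_complex ::
  "('k, 'z) ring_scheme \<Rightarrow> 'x set \<Rightarrow> ('x \<Rightarrow> 'x \<Rightarrow> ennreal) \<Rightarrow>
   (nat \<Rightarrow> ('x, 'k, 'p) distance_module) \<Rightarrow> ('x, 'k, 'b) distance_module \<Rightarrow>
   nat \<Rightarrow> ('k, 'x \<Rightarrow> real \<Rightarrow> 'p \<Rightarrow> 'b) module" where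
  "hom_complex K X d P B \<equiv> \<lambda>i. dm_hom_module K X d (P i) B"

abbreviation hom_diff ::
  "'x set \<Rightarrow> (nat \<Rightarrow> ('x, 'k, 'p) distance_module) \<Rightarrow> (nat \<Rightarrow> 'x \<Rightarrow> real \<Rightarrow> 'p \<Rightarrow> 'p) \<Rightarrow>
   nat \<Rightarrow> ('x \<Rightarrow> real \<Rightarrow> 'p \<Rightarrow> 'b) \<Rightarrow> 'x \<Rightarrow> real \<Rightarrow> 'p \<Rightarrow> 'b" where
  "hom_diff X P D \<equiv> \<lambda>i \<phi>. dm_comp X (P (Suc i)) \<phi> (D i)"

lemma hom_complex_module:
  assumes "cring K" "projective_resolution K X d G A P D \<epsilon>" "is_distance_module K X d B"
  shows "module K (hom_complex K X d P B i)"
  by (rule module_dm_hom_module[OF assms(1) resolution_module[OF assms(2)] assms(3)])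

lemma hom_diff_linear:
  assumes "projective_resolution K X d G A P D \<epsilon>"
  shows "hom_diff X P D i \<in> linear_maps K (hom_complex K X d P B i) (hom_complex K X d P B (Suc i))"
  by (rule dm_precomp_linear[OF resolution_module[OF assms] resolution_module[OF assms] resolution_diff[OF assms]])

text \<open>Replaces an equation between restricted functions by one between values, so that later
  chases run on elements.\<close>

lemma hom_cocycles_iff:
  assumes P: "projective_resolution K X d G A P D \<epsilon>" and B: "is_distance_module K X d B"
  shows "z \<in> cocycles (hom_complex K X d P B) (hom_diff X P D) n \<longleftrightarrow>
    z \<in> dm_hom K X d (P n) B \<and>
    (\<forall>x\<in>X. \<forall>g. \<forall>m\<in>carrier (fib (P (Suc n)) x g). z x g (D n x g m) = \<zero>\<^bsub>fib B x g\<^esub>)"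
proof -
  note Pm = resolution_module[OF P]
  have "dm_comp X (P (Suc n)) z (D n) = dm_fun X (P (Suc n)) (\<lambda>x g m. \<zero>\<^bsub>fib B x g\<^esub>) \<longleftrightarrow>
    (\<forall>x\<in>X. \<forall>g. \<forall>m\<in>carrier (fib (P (Suc n)) x g). z x g (D n x g m) = \<zero>\<^bsub>fib B x g\<^esub>)"
    (is "?l \<longleftrightarrow> ?r") if z: "z \<in> dm_hom K X d (P n) B"
  proof
    assume l: ?l
    show ?r
      using fun_cong[OF fun_cong[OF fun_cong[OF l]]] by (metis dm_comp_apply dm_fun_apply)
  next
    assume ?r
    then show ?l
      by (intro dm_hom_eqI[OF dm_comp_hom[OF Pm resolution_diff[OF P] z] dm_zero_hom[OF Pm B]]) simp
  qed
  then show ?thesis by (auto simp: cocycles_def)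
qed

lemma hom_coboundaries_0:
  assumes P: "projective_resolution K X d G A P D \<epsilon>" and B: "is_distance_module K X d B"
  shows "z \<in> coboundaries (hom_complex K X d P B) (hom_diff X P D) 0 \<longleftrightarrow>
    z \<in> dm_hom K X d (P 0) B \<and> (\<forall>x\<in>X. \<forall>g. \<forall>m\<in>carrier (fib (P 0) x g). z x g m = \<zero>\<^bsub>fib B x g\<^esub>)"
  using dm_hom_eqI[OF _ dm_zero_hom[OF resolution_module[OF P] B], of z 0]
    dm_zero_hom[OF resolution_module[OF P] B, of 0]
  by (auto simp: coboundaries_def)

lemma hom_coboundaries_Suc:
  assumes P: "projective_resolution K X d G A P D \<epsilon>"
  shows "z \<in> coboundaries (hom_complex K X d P B) (hom_diff X P D) (Suc n) \<longleftrightarrow>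
    z \<in> dm_hom K X d (P (Suc n)) B \<and>
    (\<exists>u\<in>dm_hom K X d (P n) B. \<forall>x\<in>X. \<forall>g. \<forall>m\<in>carrier (fib (P (Suc n)) x g). z x g m = u x g (D n x g m))"
proof -
  have comp: "dm_comp X (P (Suc n)) u (D n) \<in> dm_hom K X d (P (Suc n)) B"
    if "u \<in> dm_hom K X d (P n) B" for u
    by (rule dm_comp_hom[OF resolution_module[OF P] resolution_diff[OF P] that])
  have "z = dm_comp X (P (Suc n)) u (D n) \<longleftrightarrow> z \<in> dm_hom K X d (P (Suc n)) B \<and>
      (\<forall>x\<in>X. \<forall>g. \<forall>m\<in>carrier (fib (P (Suc n)) x g). z x g m = u x g (D n x g m))" (is "?l \<longleftrightarrow> ?r")
    if u: "u \<in> dm_hom K X d (P n) B" for u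
  proof
    assume ?l
    then show ?r using comp[OF u] by simp
  next
    assume r: ?r
    then show ?l by (intro dm_hom_eqI[OF conjunct1[OF r] comp[OF u]]) simp
  qed
  then show ?thesis
    unfolding coboundaries_def nat.case dm_hom_module_simps image_iff by blast
qed

lemma dm_hom_module_diff_apply:
  assumes "cring K" and M: "is_distance_module K X d M" and N: "is_distance_module K X d N"
    and "\<phi> \<in> dm_hom K X d M N" "\<psi> \<in> dm_hom K X d M N" "x \<in> X" "m \<in> carrier (fib M x g)"
  shows "(\<phi> \<ominus>\<^bsub>dm_hom_module K X d M N\<^esub> \<psi>) x g m = \<phi> x g m \<ominus>\<^bsub>fib N x g\<^esub> \<psi> x g m"
  using linear_maps_diff[OF dm_eval_linear module_dm_hom_module dm_module[OF N]] assms by simp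

text \<open>A self map \<open>c\<close> that lifts the identity of \<open>A\<close> is homotopic to
  the identity, say \<open>id - c = D s + s D\<close>. A cocycle \<open>z\<close> kills the first
  term, so \<open>z - z c\<close> is \<open>z s\<close> after \<open>D\<close>, a coboundary; in
  degree 0 the second term is absent and the difference is zero.\<close>

lemma cocycle_self_map:
  fixes P :: "nat \<Rightarrow> ('x, 'k, 'p) distance_module"
  assumes K: "cring K" and A: "is_distance_module K X d A"
    and P: "projective_resolution K X d G A P D \<epsilon>"
    and B: "is_distance_module K X d B"
    and c: "\<And>n. c n \<in> dm_hom K X d (P n) (P n)"
    and c0: "\<And>x g m. \<lbrakk>x \<in> X; m \<in> carrier (fib (P 0) x g)\<rbrakk> \<Longrightarrow> \<epsilon> x g (c 0 x g m) = \<epsilon> x g m"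
    and cD: "\<And>n x g m. \<lbrakk>x \<in> X; m \<in> carrier (fib (P (Suc n)) x g)\<rbrakk> \<Longrightarrow>
      D n x g (c (Suc n) x g m) = c n x g (D n x g m)"
    and z: "z \<in> cocycles (hom_complex K X d P B) (hom_diff X P D) n"
  shows "z \<ominus>\<^bsub>hom_complex K X d P B n\<^esub> dm_comp X (P n) z (c n)
    \<in> coboundaries (hom_complex K X d P B) (hom_diff X P D) n"
proof -
  note Pm = resolution_module[OF P] and DP = resolution_diff[OF P]
  have zh: "z \<in> dm_hom K X d (P n) B"
    and z0: "\<And>x g m. \<lbrakk>x \<in> X; m \<in> carrier (fib (P (Suc n)) x g)\<rbrakk> \<Longrightarrow> z x g (D n x g m) = \<zero>\<^bsub>fib B x g\<^esub>"
    using z unfolding hom_cocycles_iff[OF P B] by auto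
  interpret H: module K "hom_complex K X d P B n"
    by (rule hom_complex_module[OF K P B])
  have zc: "dm_comp X (P n) z (c n) \<in> dm_hom K X d (P n) B"
    by (rule dm_comp_hom[OF Pm c zh])
  have wh: "z \<ominus>\<^bsub>hom_complex K X d P B n\<^esub> dm_comp X (P n) z (c n) \<in> dm_hom K X d (P n) B"
    using H.M.minus_closed[of z] zh zc by simp
  \<comment> \<open>The chain map \<open>id - c\<close>; the augmentation kills it, so it is null
    homotopic.\<close>
  define f where "f n = dm_fun X (P n) (\<lambda>x g m. dm_fun X (P n) (\<lambda>x g m. m) x g m \<ominus>\<^bsub>fib (P n) x g\<^esub> c n x g m)" for n
  have f: "f n \<in> dm_hom K X d (P n) (P n)" for n
    unfolding f_def by (rule dm_diff_hom[OF Pm Pm dm_id_hom[OF Pm] c])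
  have f_apply: "f n x g m = m \<ominus>\<^bsub>fib (P n) x g\<^esub> c n x g m"
    if "x \<in> X" "m \<in> carrier (fib (P n) x g)" for n x g m
    using that by (simp add: f_def)
  have "\<epsilon> x g (f 0 x g m) = \<zero>\<^bsub>fib A x g\<^esub>" if xm: "x \<in> X" "m \<in> carrier (fib (P 0) x g)" for x g m
  proof -
    interpret N: module K "fib A x g" using dm_module[OF A xm(1)] .
    show ?thesis
      using f_apply[OF xm] linear_maps_diff[OF dm_hom_linear[OF resolution_aug[OF P]] dm_module[OF Pm]
        dm_module[OF A] xm(2) dm_hom_closed[OF c xm]] xm c0[OF xm]
        dm_hom_closed[OF resolution_aug[OF P] xm] by (simp add: a_minus_def N.M.r_neg)
  qed
  moreover have "D n x g (f (Suc n) x g m) = f n x g (D n x g m)"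
    if xm: "x \<in> X" "m \<in> carrier (fib (P (Suc n)) x g)" for n x g m
    using f_apply[OF xm] f_apply[OF xm(1) dm_hom_closed[OF DP xm]] cD[OF xm]
      linear_maps_diff[OF dm_hom_linear[OF DP xm(1)] dm_module[OF Pm xm(1)]
        dm_module[OF Pm xm(1)] xm(2) dm_hom_closed[OF c xm]] by simp
  ultimately obtain s where s: "\<And>n. s n \<in> dm_hom K X d (P n) (P (Suc n))"
    and s0: "\<And>x g m. \<lbrakk>x \<in> X; m \<in> carrier (fib (P 0) x g)\<rbrakk> \<Longrightarrow> D 0 x g (s 0 x g m) = f 0 x g m"
    and sS: "\<And>n x g m. \<lbrakk>x \<in> X; m \<in> carrier (fib (P (Suc n)) x g)\<rbrakk> \<Longrightarrow>
      D (Suc n) x g (s (Suc n) x g m) = f (Suc n) x g m \<ominus>\<^bsub>fib (P (Suc n)) x g\<^esub> s n x g (D n x g m)"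
    using resolution_null_homotopy[OF A P P f] by blast
  have w: "(z \<ominus>\<^bsub>hom_complex K X d P B n\<^esub> dm_comp X (P n) z (c n)) x g m = z x g (f n x g m)"
    if xm: "x \<in> X" "m \<in> carrier (fib (P n) x g)" for x g m
    using dm_hom_module_diff_apply[OF K Pm B zh zc xm] f_apply[OF xm] xm
      linear_maps_diff[OF dm_hom_linear[OF zh xm(1)] dm_module[OF Pm xm(1)] dm_module[OF B xm(1)]
        xm(2) dm_hom_closed[OF c xm]] by simp
  show ?thesis
  proof (cases n)
    case 0
    have "z x g (f n x g m) = \<zero>\<^bsub>fib B x g\<^esub>" if xm: "x \<in> X" "m \<in> carrier (fib (P n) x g)" for x g m
      using z0[OF xm(1) dm_hom_closed[OF s xm]] s0 xm 0 by simp
    with w wh show ?thesis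
      unfolding 0 hom_coboundaries_0[OF P B] by simp
  next
    case (Suc k)
    have "z x g (f n x g m) = dm_comp X (P k) z (s k) x g (D k x g m)"
      if xm: "x \<in> X" "m \<in> carrier (fib (P (Suc k)) x g)" for x g m
    proof -
      interpret N: module K "fib (P n) x g" using dm_module[OF Pm xm(1)] .
      interpret B: module K "fib B x g" using dm_module[OF B xm(1)] .
      note Dm = dm_hom_closed[OF DP xm] and fm = dm_hom_closed[OF f xm]
      note sD = dm_hom_closed[OF s xm(1) Dm]
      \<comment> \<open>By the homotopy identity the argument is \<open>D (Suc k)\<close> of an
        element, which the cocycle sends to zero.\<close>
      have "z x g (f n x g m \<ominus>\<^bsub>fib (P n) x g\<^esub> s k x g (D k x g m)) = \<zero>\<^bsub>fib B x g\<^esub>"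
        using z0[OF xm(1) dm_hom_closed[OF s]] xm sS[OF xm] Suc by metis
      then have "z x g (f n x g m) \<ominus>\<^bsub>fib B x g\<^esub> z x g (s k x g (D k x g m)) = \<zero>\<^bsub>fib B x g\<^esub>"
        using linear_maps_diff[OF dm_hom_linear[OF zh xm(1)] dm_module[OF Pm xm(1)] dm_module[OF B xm(1)]]
          fm sD Suc by simp
      then have "z x g (f n x g m) = z x g (s k x g (D k x g m))"
        using fm sD dm_hom_closed[OF zh xm(1)] Suc by (auto intro: B.M.eq_if_minus_zero)
      then show ?thesis
        using xm Dm by simp
    qed
    moreover have "dm_comp X (P k) z (s k) \<in> dm_hom K X d (P k) B"
      using zh Suc by (intro dm_comp_hom[OF Pm s]) simp
    ultimately have "\<exists>u\<in>dm_hom K X d (P k) B. \<forall>x\<in>X. \<forall>g. \<forall>m\<in>carrier (fib (P (Suc k)) x g).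
        z x g (f n x g m) = u x g (D k x g m)"
      by blast
    with w wh show ?thesis
      unfolding Suc hom_coboundaries_Suc[OF P] by simp
  qed
qed

text \<open>Comparison maps \<open>a\<close> from \<open>P\<close> to \<open>Q\<close> and
  \<open>b\<close> back exist by lifting, and both composites lift the identity, so pulling back
  along them is inverse up to coboundaries. The isomorphism runs from \<open>Q\<close> to
  \<open>P\<close> since \<open>Hom\<close> is contravariant.\<close>

theorem resolution_independent:
  fixes P Q :: "nat \<Rightarrow> ('x, 'k, 'p) distance_module" and A :: "('x, 'k, 'a) distance_module"
    and j :: "'a \<Rightarrow> 'p"
  assumes K: "cring K" and A: "graded_distance_module K X d G A" and j: "inj j"
    and P: "projective_resolution K X d G A P D \<epsilon>"
    and Q: "projective_resolution K X d G A Q D' \<epsilon>'"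
    and B: "is_distance_module K X d B"
  shows "module_iso K (cohomology (hom_complex K X d Q B) (hom_diff X Q D') n)
    (cohomology (hom_complex K X d P B) (hom_diff X P D) n)"
proof -
  note Pm = resolution_module[OF P] and Qm = resolution_module[OF Q]
    and DP = resolution_diff[OF P] and DQ = resolution_diff[OF Q]
    and A' = graded_imp_distance_module[OF A]
  let ?CP = "hom_complex K X d P B" and ?CQ = "hom_complex K X d Q B"
  let ?dP = "hom_diff X P D" and ?dQ = "hom_diff X Q D'"
  \<comment> \<open>Proved for an arbitrary pair of resolutions, because it is used for
    \<open>a\<close> as well as for \<open>b\<close>.\<close>
  have pullback: "dm_comp X (P n) z (a n) \<in> cocycles (hom_complex K X d P B) (hom_diff X P D) n"
      "z \<in> coboundaries (hom_complex K X d Q B) (hom_diff X Q D') n \<Longrightarrow>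
        dm_comp X (P n) z (a n) \<in> coboundaries (hom_complex K X d P B) (hom_diff X P D) n"
    if P: "projective_resolution K X d G A P D \<epsilon>"
      and Q: "projective_resolution K X d G A Q D' \<epsilon>'"
      and a: "\<And>n. a n \<in> dm_hom K X d (P n) (Q n)"
      and aD: "\<And>n x g m. \<lbrakk>x \<in> X; m \<in> carrier (fib (P (Suc n)) x g)\<rbrakk> \<Longrightarrow>
        D' n x g (a (Suc n) x g m) = a n x g (D n x g m)"
      and z: "z \<in> cocycles (hom_complex K X d Q B) (hom_diff X Q D') n"
    for P Q :: "nat \<Rightarrow> ('x, 'k, 'p) distance_module" and D D' \<epsilon> \<epsilon>' a z
  proof -
    note Pm = resolution_module[OF P] and DP = resolution_diff[OF P]
    have zh: "z \<in> dm_hom K X d (Q n) B"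
      and z0: "\<And>x g m. \<lbrakk>x \<in> X; m \<in> carrier (fib (Q (Suc n)) x g)\<rbrakk> \<Longrightarrow> z x g (D' n x g m) = \<zero>\<^bsub>fib B x g\<^esub>"
      using z unfolding hom_cocycles_iff[OF Q B] by auto
    have za: "dm_comp X (P n) z (a n) \<in> dm_hom K X d (P n) B"
      by (rule dm_comp_hom[OF Pm a zh])
    have "dm_comp X (P n) z (a n) x g (D n x g m) = \<zero>\<^bsub>fib B x g\<^esub>"
      if xm: "x \<in> X" "m \<in> carrier (fib (P (Suc n)) x g)" for x g m
      using z0[OF xm(1) dm_hom_closed[OF a xm]] aD[OF xm] dm_hom_closed[OF DP xm] xm by simp
    with za show "dm_comp X (P n) z (a n) \<in> cocycles (hom_complex K X d P B) (hom_diff X P D) n"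
      unfolding hom_cocycles_iff[OF P B] by blast
    show "dm_comp X (P n) z (a n) \<in> coboundaries (hom_complex K X d P B) (hom_diff X P D) n"
      if "z \<in> coboundaries (hom_complex K X d Q B) (hom_diff X Q D') n"
    proof (cases n)
      case 0
      have "dm_comp X (P n) z (a n) x g m = \<zero>\<^bsub>fib B x g\<^esub>"
        if xm: "x \<in> X" "m \<in> carrier (fib (P n) x g)" for x g m
        using \<open>z \<in> coboundaries _ _ n\<close> dm_hom_closed[OF a xm] xm
        unfolding 0 hom_coboundaries_0[OF Q B] by simp
      with za show ?thesis
        unfolding 0 hom_coboundaries_0[OF P B] by simp
    next
      case (Suc k)
      with that obtain u where u: "u \<in> dm_hom K X d (Q k) B"
        and zu: "\<And>x g m. \<lbrakk>x \<in> X; m \<in> carrier (fib (Q (Suc k)) x g)\<rbrakk> \<Longrightarrow> z x g m = u x g (D' k x g m)"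
        unfolding Suc hom_coboundaries_Suc[OF Q] by blast
      have "dm_comp X (P n) z (a n) x g m = dm_comp X (P k) u (a k) x g (D k x g m)"
        if xm: "x \<in> X" "m \<in> carrier (fib (P (Suc k)) x g)" for x g m
        using zu[OF xm(1) dm_hom_closed[OF a xm]] aD[OF xm] dm_hom_closed[OF DP xm] xm Suc by simp
      with dm_comp_hom[OF Pm a u] za show ?thesis
        unfolding Suc hom_coboundaries_Suc[OF P] by blast
    qed
  qed
  obtain a where a: "\<And>n. a n \<in> dm_hom K X d (P n) (Q n)"
    and a0: "\<And>x g m. \<lbrakk>x \<in> X; m \<in> carrier (fib (P 0) x g)\<rbrakk> \<Longrightarrow> \<epsilon>' x g (a 0 x g m) = \<epsilon> x g m"
    and aD: "\<And>n x g m. \<lbrakk>x \<in> X; m \<in> carrier (fib (P (Suc n)) x g)\<rbrakk> \<Longrightarrow>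
      D' n x g (a (Suc n) x g m) = a n x g (D n x g m)"
    using resolution_chain_map[OF A j P Q] by blast
  obtain b where b: "\<And>n. b n \<in> dm_hom K X d (Q n) (P n)"
    and b0: "\<And>x g m. \<lbrakk>x \<in> X; m \<in> carrier (fib (Q 0) x g)\<rbrakk> \<Longrightarrow> \<epsilon> x g (b 0 x g m) = \<epsilon>' x g m"
    and bD: "\<And>n x g m. \<lbrakk>x \<in> X; m \<in> carrier (fib (Q (Suc n)) x g)\<rbrakk> \<Longrightarrow>
      D n x g (b (Suc n) x g m) = b n x g (D' n x g m)"
    using resolution_chain_map[OF A j Q P] by blast
  show ?thesis
  proof (rule cohomology_module_iso[where f = "\<lambda>\<phi>. dm_comp X (P n) \<phi> (a n)",
        OF hom_complex_module[OF K Q B] hom_diff_linear[OF Q] hom_complex_module[OF K P B] hom_diff_linear[OF P]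
          dm_precomp_linear[OF Pm Qm a]])
    show "dm_comp X (P n) z (a n) \<in> cocycles ?CP ?dP n" if "z \<in> cocycles ?CQ ?dQ n" for z
      by (rule pullback(1)[OF P Q a aD that])
    show "dm_comp X (P n) z (a n) \<in> coboundaries ?CP ?dP n" if z: "z \<in> coboundaries ?CQ ?dQ n" for z
    proof (rule pullback(2)[OF P Q a aD _ z])
      \<comment> \<open>The pullback of coboundaries was stated for cocycles, so a coboundary is
        first seen to be one.\<close>
      show "z \<in> cocycles ?CQ ?dQ n"
      proof (cases n)
        case 0
        interpret H: module K "?CQ 0" by (rule hom_complex_module[OF K Q B])
        have "z = \<zero>\<^bsub>?CQ 0\<^esub>" using z 0 by (simp add: coboundaries_def)
        then show ?thesis
          using module.submoduleE(2)[OF hom_complex_module[OF K Q B] submodule_cocycles] 0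
            submodule.axioms(1)[OF submodule_cocycles[where C = ?CQ and \<delta> = ?dQ and n = 0,
              OF hom_complex_module[OF K Q B] hom_diff_linear[OF Q]]] subgroup.one_closed by fastforce
      next
        case (Suc k)
        with z obtain u where zh: "z \<in> dm_hom K X d (Q (Suc k)) B" and u: "u \<in> dm_hom K X d (Q k) B"
          and zu: "\<And>x g m. \<lbrakk>x \<in> X; m \<in> carrier (fib (Q (Suc k)) x g)\<rbrakk> \<Longrightarrow> z x g m = u x g (D' k x g m)"
          unfolding Suc hom_coboundaries_Suc[OF Q] by blast
        have "z x g (D' n x g m) = \<zero>\<^bsub>fib B x g\<^esub>"
          if xm: "x \<in> X" "m \<in> carrier (fib (Q (Suc (Suc k))) x g)" for x g m
          using zu[OF xm(1) dm_hom_closed[OF DQ xm]] resolution_diff_diff(2)[OF Q xm] Suc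
            linear_maps_zero[OF dm_hom_linear[OF u xm(1)] dm_module[OF Qm xm(1)] dm_module[OF B xm(1)]]
          by simp
        with zh show ?thesis unfolding Suc hom_cocycles_iff[OF Q B] by blast
      qed
    qed
    show "z \<in> coboundaries ?CQ ?dQ n"
      if z: "z \<in> cocycles ?CQ ?dQ n" and "dm_comp X (P n) z (a n) \<in> coboundaries ?CP ?dP n" for z
    proof -
      interpret H: module K "?CQ n" by (rule hom_complex_module[OF K Q B])
      note sub = H.submoduleE[OF submodule_coboundaries[where C = ?CQ and \<delta> = ?dQ and n = n,
          OF hom_complex_module[OF K Q B] hom_diff_linear[OF Q]]]
      let ?c = "\<lambda>n. dm_comp X (Q n) (a n) (b n)"
      have zh: "z \<in> dm_hom K X d (Q n) B"
        using z unfolding hom_cocycles_iff[OF Q B] by auto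
      have ch: "?c n \<in> dm_hom K X d (Q n) (Q n)" for n
        by (rule dm_comp_hom[OF Qm b a])
      let ?w = "dm_comp X (Q n) z (?c n)"
      have wh: "?w \<in> dm_hom K X d (Q n) B"
        by (rule dm_comp_hom[OF Qm ch zh])
      have "dm_comp X (Q n) (dm_comp X (P n) z (a n)) (b n) \<in> coboundaries ?CQ ?dQ n"
        using that by (intro pullback(2)[OF Q P b bD pullback(1)[OF P Q a aD z]])
      moreover have "dm_comp X (Q n) (dm_comp X (P n) z (a n)) (b n) = ?w"
        by (rule dm_hom_eqI[OF dm_comp_hom[OF Qm b dm_comp_hom[OF Pm a zh]] wh])
          (simp add: dm_hom_closed[OF b])
      ultimately have w: "?w \<in> coboundaries ?CQ ?dQ n"
        by simp
      have zw: "z \<ominus>\<^bsub>?CQ n\<^esub> ?w \<in> coboundaries ?CQ ?dQ n"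
        using z by (intro cocycle_self_map[OF K A' Q B ch])
          (simp_all add: dm_hom_closed[OF b] dm_hom_closed[OF DQ] a0 b0 aD bD)
      \<comment> \<open>\<open>z\<close> is the sum of \<open>z - z a b\<close>, a coboundary by the
        homotopy, and \<open>z a b\<close>, a coboundary because \<open>z a\<close> is one.\<close>
      have eq: "(z \<ominus>\<^bsub>?CQ n\<^esub> ?w) \<oplus>\<^bsub>?CQ n\<^esub> ?w = z"
        by (rule H.M.minus_add_cancel) (simp_all only: dm_hom_module_simps zh wh)
      show ?thesis
        using sub(5)[OF zw w] unfolding eq .
    qed
    show "\<exists>z\<in>cocycles ?CQ ?dQ n. w \<ominus>\<^bsub>?CP n\<^esub> dm_comp X (P n) z (a n) \<in> coboundaries ?CP ?dP n"
      if w: "w \<in> cocycles ?CP ?dP n" for w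
    proof (rule bexI[OF _ pullback(1)[OF Q P b bD w]])
      let ?c = "\<lambda>n. dm_comp X (P n) (b n) (a n)"
      have wh: "w \<in> dm_hom K X d (P n) B"
        using w unfolding hom_cocycles_iff[OF P B] by auto
      have ch: "?c n \<in> dm_hom K X d (P n) (P n)" for n
        by (rule dm_comp_hom[OF Pm a b])
      have "dm_comp X (P n) (dm_comp X (Q n) w (b n)) (a n) = dm_comp X (P n) w (?c n)"
        by (rule dm_hom_eqI[OF dm_comp_hom[OF Pm a dm_comp_hom[OF Qm b wh]] dm_comp_hom[OF Pm ch wh]])
          (simp add: dm_hom_closed[OF a])
      moreover have "w \<ominus>\<^bsub>?CP n\<^esub> dm_comp X (P n) w (?c n) \<in> coboundaries ?CP ?dP n"
        using w by (intro cocycle_self_map[OF K A' P B ch])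
          (simp_all add: dm_hom_closed[OF a] dm_hom_closed[OF DP] a0 b0 aD bD)
      ultimately show "w \<ominus>\<^bsub>?CP n\<^esub> dm_comp X (P n) (dm_comp X (Q n) w (b n)) (a n) \<in> coboundaries ?CP ?dP n"
        by simp
    qed
  qed
qed

section \<open>Free modules\<close>

text \<open>Total functions that vanish off \<open>S\<close>, so that free modules on different sets
  share one type. The action of the bar modules can then be given by cutting off coefficients,
  without maps between index sets.\<close>

definition free_carrier :: "('k, 'z) ring_scheme \<Rightarrow> 'c set \<Rightarrow> ('c \<Rightarrow> 'k) set" where
  "free_carrier K S = {f. range f \<subseteq> carrier K \<and> (\<forall>c. c \<notin> S \<longrightarrow> f c = \<zero>\<^bsub>K\<^esub>) \<and> finite {c. f c \<noteq> \<zero>\<^bsub>K\<^esub>}}"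

definition free_mod :: "('k, 'z) ring_scheme \<Rightarrow> 'c set \<Rightarrow> ('k, 'c \<Rightarrow> 'k) module" where
  "free_mod K S =
     \<lparr>carrier = free_carrier K S, mult = undefined, one = undefined,
      zero = (\<lambda>c. \<zero>\<^bsub>K\<^esub>), add = (\<lambda>f g c. f c \<oplus>\<^bsub>K\<^esub> g c), smult = (\<lambda>a f c. a \<otimes>\<^bsub>K\<^esub> f c)\<rparr>"

definition delta :: "('k, 'z) ring_scheme \<Rightarrow> 'c \<Rightarrow> 'c \<Rightarrow> 'k" where
  "delta K c = (\<lambda>c'. if c' = c then \<one>\<^bsub>K\<^esub> else \<zero>\<^bsub>K\<^esub>)"

text \<open>Summed over the support of \<open>f\<close> and not over \<open>S\<close>, since a
  \<open>finsum\<close> has its intended value only on finite index sets.\<close>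

definition free_lift ::
  "('k, 'z) ring_scheme \<Rightarrow> ('k, 'a) module \<Rightarrow> ('c \<Rightarrow> 'a) \<Rightarrow> ('c \<Rightarrow> 'k) \<Rightarrow> 'a" where
  "free_lift K N b f = (\<Oplus>\<^bsub>N\<^esub>c\<in>{c. f c \<noteq> \<zero>\<^bsub>K\<^esub>}. f c \<odot>\<^bsub>N\<^esub> b c)"

lemma free_mod_simps [simp]:
  "carrier (free_mod K S) = free_carrier K S"
  "\<zero>\<^bsub>free_mod K S\<^esub> = (\<lambda>c. \<zero>\<^bsub>K\<^esub>)"
  "f \<oplus>\<^bsub>free_mod K S\<^esub> g = (\<lambda>c. f c \<oplus>\<^bsub>K\<^esub> g c)"
  "a \<odot>\<^bsub>free_mod K S\<^esub> f = (\<lambda>c. a \<otimes>\<^bsub>K\<^esub> f c)"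
  by (simp_all add: free_mod_def)

lemma free_carrierD:
  assumes "f \<in> free_carrier K S"
  shows "f c \<in> carrier K" "c \<notin> S \<Longrightarrow> f c = \<zero>\<^bsub>K\<^esub>" "finite {c. f c \<noteq> \<zero>\<^bsub>K\<^esub>}"
    "{c. f c \<noteq> \<zero>\<^bsub>K\<^esub>} \<subseteq> S"
  using assms by (auto simp: free_carrier_def)

lemma free_carrierI:
  assumes "\<And>c. f c \<in> carrier K" "\<And>c. c \<notin> S \<Longrightarrow> f c = \<zero>\<^bsub>K\<^esub>" "finite {c. f c \<noteq> \<zero>\<^bsub>K\<^esub>}"
  shows "f \<in> free_carrier K S"
  using assms by (auto simp: free_carrier_def)

lemma free_carrier_mono: "S \<subseteq> T \<Longrightarrow> free_carrier K S \<subseteq> free_carrier K T"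
  by (auto simp: free_carrier_def)

context cring
begin

lemma free_carrier_closed:
  shows free_carrier_zero: "(\<lambda>c. \<zero>) \<in> free_carrier R S"
    and free_carrier_add: "\<lbrakk>f \<in> free_carrier R S; g \<in> free_carrier R S\<rbrakk> \<Longrightarrow>
      (\<lambda>c. f c \<oplus> g c) \<in> free_carrier R S"
    and free_carrier_smult: "\<lbrakk>a \<in> carrier R; f \<in> free_carrier R S\<rbrakk> \<Longrightarrow>
      (\<lambda>c. a \<otimes> f c) \<in> free_carrier R S"
    and free_carrier_delta: "c \<in> S \<Longrightarrow> delta R c \<in> free_carrier R S"
proof -
  show "(\<lambda>c. \<zero>) \<in> free_carrier R S"
    by (auto simp: free_carrier_def)
  show "(\<lambda>c. f c \<oplus> g c) \<in> free_carrier R S"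
    if f: "f \<in> free_carrier R S" and g: "g \<in> free_carrier R S"
  proof (rule free_carrierI)
    have "{c. f c \<oplus> g c \<noteq> \<zero>} \<subseteq> {c. f c \<noteq> \<zero>} \<union> {c. g c \<noteq> \<zero>}"
      by auto
    then show "finite {c. f c \<oplus> g c \<noteq> \<zero>}"
      using free_carrierD(3)[OF f] free_carrierD(3)[OF g] finite_subset by blast
  qed (use free_carrierD[OF f] free_carrierD[OF g] in auto)
  show "(\<lambda>c. a \<otimes> f c) \<in> free_carrier R S" if a: "a \<in> carrier R" and f: "f \<in> free_carrier R S"
  proof (rule free_carrierI)
    have "{c. a \<otimes> f c \<noteq> \<zero>} \<subseteq> {c. f c \<noteq> \<zero>}"
      using a by auto
    then show "finite {c. a \<otimes> f c \<noteq> \<zero>}"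
      using free_carrierD(3)[OF f] finite_subset by blast
  qed (use free_carrierD[OF f] a in auto)
  show "delta R c \<in> free_carrier R S" if "c \<in> S"
  proof (rule free_carrierI)
    show "finite {c'. delta R c c' \<noteq> \<zero>}"
      by (rule finite_subset[of _ "{c}"]) (auto simp: delta_def)
  qed (use that in \<open>auto simp: delta_def\<close>)
qed

lemma module_free_mod: "module R (free_mod R S)"
proof -
  have ag: "abelian_group (free_mod R S)"
  proof (rule abelian_groupI)
    fix f assume "f \<in> carrier (free_mod R S)"
    then have f: "f \<in> free_carrier R S" by simp
    \<comment> \<open>The inverse is -1 times \<open>f\<close>, so closure under scalars already
      covers it.\<close>
    have "(\<lambda>c. (\<ominus> \<one>) \<otimes> f c) \<oplus>\<^bsub>free_mod R S\<^esub> f = \<zero>\<^bsub>free_mod R S\<^esub>"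
      using free_carrierD(1)[OF f] by (simp add: l_minus l_neg)
    then show "\<exists>g\<in>carrier (free_mod R S). g \<oplus>\<^bsub>free_mod R S\<^esub> f = \<zero>\<^bsub>free_mod R S\<^esub>"
      using free_carrier_smult[OF _ f, of "\<ominus> \<one>"] by auto
  qed (auto simp: free_carrier_closed free_carrierD(1) a_assoc free_carrierD(1) intro!: ext a_comm)
  show ?thesis
    by (rule moduleI[OF is_cring ag])
      (auto simp: free_carrier_closed free_carrierD(1) l_distr r_distr m_assoc)
qed

lemma free_induct [consumes 1, case_names zero delta add smult]:
  assumes f: "f \<in> free_carrier R S"
    and zero: "Q (\<lambda>c. \<zero>)"
    and delta: "\<And>c. c \<in> S \<Longrightarrow> Q (delta R c)"
    and add: "\<And>f g. \<lbrakk>f \<in> free_carrier R S; g \<in> free_carrier R S; Q f; Q g\<rbrakk> \<Longrightarrow> Q (\<lambda>c. f c \<oplus> g c)"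
    and smult: "\<And>a f. \<lbrakk>a \<in> carrier R; f \<in> free_carrier R S; Q f\<rbrakk> \<Longrightarrow> Q (\<lambda>c. a \<otimes> f c)"
  shows "Q f"
proof -
  have "Q f" if "finite T" "f \<in> free_carrier R S" "{c. f c \<noteq> \<zero>} = T" for T f
    using that
  proof (induction T arbitrary: f rule: finite_induct)
    case empty
    then have "f = (\<lambda>c. \<zero>)" by auto
    with zero show ?case by simp
  next
    case (insert x T)
    note f = insert.prems(1)
    \<comment> \<open>Splits off one basis element; what remains has the smaller support
      \<open>T\<close>.\<close>
    let ?g = "f(x := \<zero>)"
    have x: "x \<in> S"
      using free_carrierD(2)[OF f, of x] insert.prems(2) by blast
    have supp: "{c. ?g c \<noteq> \<zero>} = T"
      using insert.prems(2) insert.hyps(2) by auto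
    have g: "?g \<in> free_carrier R S"
    proof (rule free_carrierI)
      show "finite {c. ?g c \<noteq> \<zero>}" unfolding supp by (rule insert.hyps(1))
    qed (use free_carrierD[OF f] in auto)
    have fx: "f x \<in> carrier R" by (rule free_carrierD(1)[OF f])
    have eq: "f = (\<lambda>c. ?g c \<oplus> f x \<otimes> delta R x c)"
      using free_carrierD(1)[OF f] by (auto simp: delta_def fun_eq_iff)
    have "Q (\<lambda>c. ?g c \<oplus> f x \<otimes> delta R x c)"
      by (rule add[OF g free_carrier_smult[OF fx free_carrier_delta[OF x]] insert.IH[OF g supp]
        smult[OF fx free_carrier_delta[OF x] delta[OF x]]])
    with eq show ?case by simp
  qed
  then show ?thesis using free_carrierD(3)[OF f] f by blast
qed

lemma linear_maps_free_eqI: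
  assumes N: "module R N"
    and \<phi>: "\<phi> \<in> linear_maps R (free_mod R S) N" and \<psi>: "\<psi> \<in> linear_maps R (free_mod R S) N"
    and eq: "\<And>c. c \<in> S \<Longrightarrow> \<phi> (delta R c) = \<psi> (delta R c)"
    and f: "f \<in> free_carrier R S"
  shows "\<phi> f = \<psi> f"
  using f
proof (induction f rule: free_induct)
  case zero
  then show ?case
    using linear_maps_zero[OF \<phi> module_free_mod N] linear_maps_zero[OF \<psi> module_free_mod N] by simp
next
  case (delta c)
  then show ?case by (rule eq)
next
  case (add f g)
  then show ?case
    using linear_maps_add[OF \<phi>, of f g] linear_maps_add[OF \<psi>, of f g] by simp
next
  case (smult a f)
  then show ?case
    using linear_maps_smult[OF \<phi>, of a f] linear_maps_smult[OF \<psi>, of a f] by simp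
qed

text \<open>The supports of \<open>f\<close>, \<open>g\<close> and their sum differ, with
  cancellation possible in the last. A common finite index set lets their sums be added term by
  term.\<close>

lemma free_lift_superset:
  assumes N: "module R N" and b: "b \<in> S \<rightarrow> carrier N" and f: "f \<in> free_carrier R S"
    and T: "finite T" "{c. f c \<noteq> \<zero>} \<subseteq> T" "T \<subseteq> S"
  shows "free_lift R N b f = (\<Oplus>\<^bsub>N\<^esub>c\<in>T. f c \<odot>\<^bsub>N\<^esub> b c)"
proof -
  interpret N: module R N by fact
  have "b c \<in> carrier N" if "c \<in> T" for c
    using b T(3) that by blast
  then show ?thesis
    unfolding free_lift_def using T free_carrierD(1)[OF f]
    by (intro N.M.add.finprod_mono_neutral_cong_left) auto
qed

lemma free_lift_linear:
  assumes N: "module R N" and b: "b \<in> S \<rightarrow> carrier N"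
  shows "free_lift R N b \<in> linear_maps R (free_mod R S) N"
proof -
  interpret N: module R N by fact
  have bc: "b c \<in> carrier N" if "c \<in> S" for c
    using b that by blast
  have closed: "free_lift R N b f \<in> carrier N" if f: "f \<in> free_carrier R S" for f
    unfolding free_lift_def using free_carrierD[OF f] bc by (intro N.M.finsum_closed) blast
  show ?thesis
  proof (rule linear_mapsI)
    fix f g assume "f \<in> carrier (free_mod R S)" "g \<in> carrier (free_mod R S)"
    then have f: "f \<in> free_carrier R S" and g: "g \<in> free_carrier R S" by simp_all
    let ?T = "{c. f c \<noteq> \<zero>} \<union> {c. g c \<noteq> \<zero>}"
    have T: "finite ?T" "?T \<subseteq> S"
      using free_carrierD[OF f] free_carrierD[OF g] by auto
    have s: "{c. f c \<oplus> g c \<noteq> \<zero>} \<subseteq> ?T" by auto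
    have cl: "f c \<odot>\<^bsub>N\<^esub> b c \<in> carrier N" "g c \<odot>\<^bsub>N\<^esub> b c \<in> carrier N" if "c \<in> ?T" for c
      using T(2) that free_carrierD(1)[OF f] free_carrierD(1)[OF g] bc by blast+
    have "free_lift R N b (\<lambda>c. f c \<oplus> g c) = (\<Oplus>\<^bsub>N\<^esub>c\<in>?T. (f c \<oplus> g c) \<odot>\<^bsub>N\<^esub> b c)"
      by (rule free_lift_superset[OF N b free_carrier_add[OF f g] T(1) s T(2)])
    also have "\<dots> = (\<Oplus>\<^bsub>N\<^esub>c\<in>?T. f c \<odot>\<^bsub>N\<^esub> b c \<oplus>\<^bsub>N\<^esub> g c \<odot>\<^bsub>N\<^esub> b c)"
      using T(2) free_carrierD(1)[OF f] free_carrierD(1)[OF g] bc cl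
      by (intro N.M.finsum_cong') (auto intro!: N.smult_l_distr)
    also have "\<dots> = (\<Oplus>\<^bsub>N\<^esub>c\<in>?T. f c \<odot>\<^bsub>N\<^esub> b c) \<oplus>\<^bsub>N\<^esub> (\<Oplus>\<^bsub>N\<^esub>c\<in>?T. g c \<odot>\<^bsub>N\<^esub> b c)"
      using cl by (intro N.M.finsum_addf) auto
    also have "\<dots> = free_lift R N b f \<oplus>\<^bsub>N\<^esub> free_lift R N b g"
      using free_lift_superset[OF N b f T(1) _ T(2)] free_lift_superset[OF N b g T(1) _ T(2)] by auto
    finally show "free_lift R N b (f \<oplus>\<^bsub>free_mod R S\<^esub> g) = free_lift R N b f \<oplus>\<^bsub>N\<^esub> free_lift R N b g"
      by simp
  next
    fix a f assume a: "a \<in> carrier R" and "f \<in> carrier (free_mod R S)"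
    then have f: "f \<in> free_carrier R S" by simp
    let ?T = "{c. f c \<noteq> \<zero>}"
    note T = free_carrierD(3,4)[OF f]
    have s: "{c. a \<otimes> f c \<noteq> \<zero>} \<subseteq> ?T" using a by auto
    have cl: "f c \<odot>\<^bsub>N\<^esub> b c \<in> carrier N" if "c \<in> ?T" for c
      using T(2) that free_carrierD(1)[OF f] bc by blast
    have "free_lift R N b (\<lambda>c. a \<otimes> f c) = (\<Oplus>\<^bsub>N\<^esub>c\<in>?T. (a \<otimes> f c) \<odot>\<^bsub>N\<^esub> b c)"
      by (rule free_lift_superset[OF N b free_carrier_smult[OF a f] T(1) s T(2)])
    also have "\<dots> = (\<Oplus>\<^bsub>N\<^esub>c\<in>?T. a \<odot>\<^bsub>N\<^esub> (f c \<odot>\<^bsub>N\<^esub> b c))"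
      using T(2) a free_carrierD(1)[OF f] bc cl
      by (intro N.M.finsum_cong') (auto intro!: N.smult_assoc1)
    also have "\<dots> = a \<odot>\<^bsub>N\<^esub> free_lift R N b f"
      unfolding free_lift_def using T(1) a cl by (intro N.finsum_smult_ldistr[symmetric]) auto
    finally show "free_lift R N b (a \<odot>\<^bsub>free_mod R S\<^esub> f) = a \<odot>\<^bsub>N\<^esub> free_lift R N b f"
      by simp
  qed (simp add: closed)
qed

lemma free_lift_delta:
  assumes N: "module R N" and b: "b \<in> S \<rightarrow> carrier N" and c: "c \<in> S"
  shows "free_lift R N b (delta R c) = b c"
proof -
  interpret N: module R N by fact
  have "free_lift R N b (delta R c) = (\<Oplus>\<^bsub>N\<^esub>c'\<in>{c}. delta R c c' \<odot>\<^bsub>N\<^esub> b c')"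
    using c by (intro free_lift_superset[OF N b free_carrier_delta[OF c]]) (auto simp: delta_def)
  also have "\<dots> = b c"
    using b c by (simp add: delta_def Pi_iff)
  finally show ?thesis .
qed

end

section \<open>Chains\<close>

lemma enn2real_add:
  assumes "a < \<infinity>" "b < \<infinity>"
  shows "enn2real (a + b) = enn2real a + enn2real b"
  using assms by (cases a; cases b) (auto simp: ennreal_plus[symmetric] simp del: ennreal_plus)


lemma enn2real_eq_iff:
  assumes "a < \<infinity>" "b < \<infinity>"
  shows "enn2real a = enn2real b \<longleftrightarrow> a = b"
  using assms by (cases a; cases b) auto

lemma chain_length_Cons: "chain_length d (x # y # zs) = d x y + chain_length d (y # zs)"
  by (simp add: chain_length_def sum.lessThan_Suc_shift del: sum.lessThan_Suc)

lemma chain_length_single [simp]: "chain_length d [x] = 0"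
  by (simp add: chain_length_def)

text \<open>The point \<open>a\<close> belongs to both pieces, so that no step of the chain is lost
  at the cut.\<close>

lemma chain_length_append:
  "chain_length d (as @ a # bs) = chain_length d (as @ [a]) + chain_length d (a # bs)"
proof (induction as)
  case (Cons x as)
  then show ?case by (cases as) (simp_all add: chain_length_Cons add.assoc)
qed simp

lemma chain_length_snoc:
  assumes "xs \<noteq> []"
  shows "chain_length d (xs @ [y]) = chain_length d xs + d (last xs) y"
proof -
  have "xs = butlast xs @ [last xs]" using assms by simp
  then show ?thesis
    using chain_length_append[of d "butlast xs" "last xs" "[y]"]
    by (simp add: chain_length_Cons) (metis append.assoc append_Cons append_Nil)
qed

lemma length_omit_nth: "i < length xs \<Longrightarrow> length (omit_nth i xs) = length xs - 1"
  by (simp add: omit_nth_def)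

lemma nth_omit_nth:
  assumes "i < length xs" "j < length xs - 1"
  shows "omit_nth i xs ! j = (if j < i then xs ! j else xs ! Suc j)"
  using assms by (auto simp: omit_nth_def nth_append)

lemma set_omit_nth: "set (omit_nth i xs) \<subseteq> set xs"
  by (auto simp: omit_nth_def dest: in_set_takeD in_set_dropD)

lemma omit_nth_append: "i < length xs \<Longrightarrow> omit_nth i (xs @ ys) = omit_nth i xs @ ys"
  by (simp add: omit_nth_def)

lemma omit_nth_snoc: "omit_nth (length xs) (xs @ [y]) = xs"
  by (simp add: omit_nth_def)

text \<open>Replacing the two steps around the omitted point by a single one changes the sum by the
  betweenness equation alone. It is an identity in \<open>ennreal\<close>, so infinite lengths are
  included.\<close>

lemma chain_length_omit_nth:
  assumes "0 < i" "Suc i < length ws" "between d (ws ! (i - 1)) (ws ! i) (ws ! Suc i)"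
  shows "chain_length d (omit_nth i ws) = chain_length d ws"
proof -
  define as where "as = take (i - 1) ws"
  define bs where "bs = drop (Suc (Suc i)) ws"
  let ?a = "ws ! (i - 1)" and ?b = "ws ! i" and ?c = "ws ! Suc i"
  have ws: "ws = as @ ?a # ?b # ?c # bs"
    using assms(1,2) unfolding as_def bs_def
    by (metis Cons_nth_drop_Suc One_nat_def Suc_lessD Suc_pred append_take_drop_id)
  have "length as = i - 1"
    using assms by (simp add: as_def)
  moreover have "omit_nth i (as @ ?a # ?b # ?c # bs) = as @ ?a # ?c # bs" if "length as = i - 1"
    using that assms(1) by (cases i) (simp_all add: omit_nth_def)
  ultimately have om: "omit_nth i ws = as @ ?a # ?c # bs"
    using ws by metis
  have "chain_length d ws = chain_length d (as @ [?a]) + (d ?a ?b + (d ?b ?c + chain_length d (?c # bs)))"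
    by (subst ws, subst chain_length_append) (simp add: chain_length_Cons)
  moreover have "chain_length d (omit_nth i ws) = chain_length d (as @ [?a]) + (d ?a ?c + chain_length d (?c # bs))"
    unfolding om by (subst chain_length_append) (simp add: chain_length_Cons)
  ultimately show ?thesis
    using assms(3) by (simp add: between_def add.assoc[symmetric])
qed

section \<open>Nondegenerate chains\<close>

definition nondeg :: "'x list \<Rightarrow> bool" where
  "nondeg xs \<longleftrightarrow> (\<forall>i. Suc i < length xs \<longrightarrow> xs ! i \<noteq> xs ! Suc i)"

lemma nondeg_snoc:
  assumes "nondeg xs" "xs \<noteq> []" "last xs \<noteq> y"
  shows "nondeg (xs @ [y])"
  unfolding nondeg_def
proof (intro allI impI)
  fix i assume "Suc i < length (xs @ [y])"
  then show "(xs @ [y]) ! i \<noteq> (xs @ [y]) ! Suc i"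
  proof (cases "Suc i < length xs")
    case False
    then have "i = length xs - 1"
      using \<open>Suc i < length (xs @ [y])\<close> by simp
    then show ?thesis
      using assms(2,3) by (simp add: nth_append last_conv_nth)
  qed (use assms(1) in \<open>simp add: nondeg_def nth_append\<close>)
qed

lemma nondeg_butlast:
  assumes "nondeg xs"
  shows "nondeg (butlast xs)"
  using assms by (simp add: nondeg_def nth_butlast)

lemma nondeg_butlast_last_neq:
  assumes "nondeg xs" "length xs = Suc (Suc n)"
  shows "last (butlast xs) \<noteq> last xs"
proof -
  have "xs \<noteq> []" "butlast xs \<noteq> []"
    using assms(2) by (auto simp: butlast_conv_take)
  then show ?thesis
    using assms by (simp add: nondeg_def last_conv_nth nth_butlast)
qed

abbreviation clen :: "('x \<Rightarrow> 'x \<Rightarrow> ennreal) \<Rightarrow> 'x list \<Rightarrow> real" where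
  "clen d xs \<equiv> enn2real (chain_length d xs)"

text \<open>
  The basis of the \<open>n\<close>-th normalised bar module over \<open>y\<close> in degree \<open>g\<close>: the list \<open>xs\<close> stands for
  \<open>(x\<^sub>0, \<dots>, x\<^sub>n, y)\<close>, in which \<open>x\<^sub>n = y\<close> is allowed.
\<close>

definition bar_chains :: "'x set \<Rightarrow> ('x \<Rightarrow> 'x \<Rightarrow> ennreal) \<Rightarrow> nat \<Rightarrow> 'x \<Rightarrow> real \<Rightarrow> 'x list set" where
  "bar_chains X d n y g = {xs. length xs = Suc n \<and> set xs \<subseteq> X \<and> nondeg xs \<and>
     chain_length d (xs @ [y]) < \<infinity> \<and> clen d (xs @ [y]) = g}"

abbreviation face_between :: "('x \<Rightarrow> 'x \<Rightarrow> ennreal) \<Rightarrow> 'x \<Rightarrow> nat \<Rightarrow> 'x list \<Rightarrow> bool" where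
  "face_between d y i xs \<equiv> between d (xs ! (i - 1)) (xs ! i) ((xs @ [y]) ! Suc i)"

locale graded_quasimetric = cring K + quasimetric_space X d
  for K :: "('k, 'z) ring_scheme" (structure) and X :: "'x set" and d +
  fixes G :: "real set"
  assumes subgroup_G: "subgroup G real_add_group"
    and dist_G: "\<lbrakk>x \<in> X; y \<in> X; d x y < \<infinity>\<rbrakk> \<Longrightarrow> rdist d x y \<in> G"
begin

section \<open>Betweenness in a quasimetric space, and bases of the bar modules\<close>

lemma dist_self [simp]: "x \<in> X \<Longrightarrow> d x x = 0"
  by (simp add: dist_zero_iff)

lemma between_self [simp]:
  "\<lbrakk>x \<in> X; y \<in> X\<rbrakk> \<Longrightarrow> between d x y y" "\<lbrakk>x \<in> X; y \<in> X\<rbrakk> \<Longrightarrow> between d x x y"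
  by (simp_all add: between_def)

text \<open>Going from \<open>x\<close> to \<open>y\<close> and back would have length
  \<open>d x x = 0\<close>, so \<open>d x y = 0\<close>. This keeps faces nondegenerate and removes
  the unwanted terms at the augmentation.\<close>

lemma between_imp_eq: "\<lbrakk>x \<in> X; y \<in> X; between d x y x\<rbrakk> \<Longrightarrow> x = y"
  using dist_zero_iff[of x y] by (simp add: between_def)

lemma dist_finite: "\<lbrakk>x \<in> X; y \<in> X; z \<in> X; d x y < \<infinity>; d y z < \<infinity>\<rbrakk> \<Longrightarrow> d x z < \<infinity>"
  using triangle[of x y z] by (metis ennreal_add_less_top infinity_ennreal_def le_less_trans)

lemma rdist_triangle:
  assumes "x \<in> X" "y \<in> X" "z \<in> X" "d x y < \<infinity>" "d y z < \<infinity>"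
  shows "rdist d x z \<le> rdist d x y + rdist d y z"
proof -
  have "enn2real (d x z) \<le> enn2real (d x y + d y z)"
    using assms triangle[of x y z] by (intro enn2real_mono) auto
  then show ?thesis using assms by (simp add: enn2real_add)
qed

lemma between_iff_real:
  assumes "x \<in> X" "y \<in> X" "z \<in> X" "d x y < \<infinity>" "d y z < \<infinity>"
  shows "between d x y z \<longleftrightarrow> rdist d x y + rdist d y z = rdist d x z"
proof -
  have "d x y + d y z < \<infinity>" "d x z < \<infinity>"
    using dist_finite[OF assms] assms(4,5) by simp_all
  then have "d x y + d y z = d x z \<longleftrightarrow> enn2real (d x y + d y z) = enn2real (d x z)"
    by (simp add: enn2real_eq_iff)
  then show ?thesis using assms by (simp add: between_def enn2real_add)
qed

text \<open>Both sides say that the path from \<open>a\<close> through \<open>b\<close> and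
  \<open>c\<close> to \<open>e\<close> is as short as the direct step; each betweenness is equality
  in a triangle inequality. Functoriality of the bar action and its compatibility with the last face
  both come from here.\<close>

lemma between_assoc:
  assumes X: "a \<in> X" "b \<in> X" "c \<in> X" "e \<in> X" and fin: "d a b < \<infinity>" "d b c < \<infinity>" "d c e < \<infinity>"
  shows "between d a b c \<and> between d a c e \<longleftrightarrow> between d b c e \<and> between d a b e"
proof -
  have ac: "d a c < \<infinity>" and be: "d b e < \<infinity>"
    using dist_finite X fin by blast+
  show ?thesis
    using between_iff_real[OF X(1,2,3) fin(1,2)] between_iff_real[OF X(1,3,4) ac fin(3)]
      between_iff_real[OF X(2,3,4) fin(2,3)] between_iff_real[OF X(1,2,4) fin(1) be]
      rdist_triangle[OF X(1,2,3) fin(1,2)] rdist_triangle[OF X(1,3,4) ac fin(3)]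
      rdist_triangle[OF X(2,3,4) fin(2,3)] rdist_triangle[OF X(1,2,4) fin(1) be]
    by linarith
qed

lemma bar_chainsD:
  assumes "xs \<in> bar_chains X d n y g"
  shows "length xs = Suc n" "xs \<noteq> []" "set xs \<subseteq> X" "last xs \<in> X" "nondeg xs"
    "chain_length d xs < \<infinity>" "d (last xs) y < \<infinity>"
    "chain_length d xs + d (last xs) y < \<infinity>" "clen d xs + rdist d (last xs) y = g"
    "\<And>i. i \<le> n \<Longrightarrow> xs ! i \<in> X"
proof -
  show "length xs = Suc n" "set xs \<subseteq> X" "nondeg xs"
    using assms by (auto simp: bar_chains_def)
  then show ne: "xs \<noteq> []"
    by auto
  show "last xs \<in> X"
    using last_in_set[OF ne] \<open>set xs \<subseteq> X\<close> by blast
  show "xs ! i \<in> X" if "i \<le> n" for i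
    using that \<open>length xs = Suc n\<close> \<open>set xs \<subseteq> X\<close> by (simp add: subset_iff)
  show s: "chain_length d xs + d (last xs) y < \<infinity>"
    using assms chain_length_snoc[OF ne, of d y] by (simp add: bar_chains_def)
  then show "chain_length d xs < \<infinity>" "d (last xs) y < \<infinity>"
    by simp_all
  then show "clen d xs + rdist d (last xs) y = g"
    using assms chain_length_snoc[OF ne, of d y] by (simp add: bar_chains_def enn2real_add)
qed

lemma bar_chainsI:
  assumes "length xs = Suc n" "set xs \<subseteq> X" "nondeg xs" "chain_length d xs < \<infinity>" "d (last xs) y < \<infinity>"
    "clen d xs + rdist d (last xs) y = g"
  shows "xs \<in> bar_chains X d n y g"
proof -
  have "xs \<noteq> []" using assms by auto
  then show ?thesis
    using assms chain_length_snoc[of xs d y] by (simp add: bar_chains_def enn2real_add)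
qed

text \<open>Degrees are finite sums of distances, which lie in the subgroup \<open>G\<close>. So the
  bar modules vanish outside \<open>G\<close>, as objects of the graded category must.\<close>

lemma bar_chains_degree:
  assumes "xs \<in> bar_chains X d n y g" "y \<in> X"
  shows "g \<in> G"
proof -
  have add: "a + b \<in> G" if "a \<in> G" "b \<in> G" for a b
    using subgroup.m_closed[OF subgroup_G that] by (simp add: real_add_group_def)
  have zero: "0 \<in> G"
    using subgroup.one_closed[OF subgroup_G] by (simp add: real_add_group_def)
  have "clen d zs \<in> G" if "set zs \<subseteq> X" "zs \<noteq> []" "chain_length d zs < \<infinity>" for zs
    using that
  proof (induction zs rule: induct_list012)
    case (3 x y zs)
    then show ?case
      by (auto simp: chain_length_Cons enn2real_add intro!: add dist_G)
  qed (use zero in auto)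
  note len = this
  note xs = bar_chainsD[OF assms(1)]
  show ?thesis
    using add[OF len[OF xs(3,2,6)] dist_G[OF xs(4) assms(2) xs(7)]] xs(9) by simp
qed

text \<open>The list stays the same while its implicit final step grows from
  \<open>d (last xs) y\<close> to \<open>d (last xs) z\<close>; betweenness says that the growth is
  \<open>d y z\<close>.\<close>

lemma bar_chains_act:
  assumes "xs \<in> bar_chains X d n y g" "y \<in> X" "z \<in> X" "d y z < \<infinity>" "between d (last xs) y z"
  shows "xs \<in> bar_chains X d n z (g + rdist d y z)"
proof -
  note xs = bar_chainsD[OF assms(1)]
  have "rdist d (last xs) y + rdist d y z = rdist d (last xs) z"
    using between_iff_real[OF xs(4) assms(2,3) xs(7) assms(4)] assms(5) by simp
  then show ?thesis
    using xs dist_finite[OF xs(4) assms(2,3) xs(7) assms(4)] by (intro bar_chainsI) auto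
qed

lemma bar_chains_gen:
  assumes "length xs = Suc n" "set xs \<subseteq> X" "nondeg xs" "chain_length d xs < \<infinity>"
  shows "xs \<in> bar_chains X d n (last xs) (clen d xs)"
proof -
  have "xs \<noteq> []" using assms(1) by auto
  then have "last xs \<in> X" using assms(2) last_in_set[of xs] by blast
  then show ?thesis using assms by (intro bar_chainsI) auto
qed

text \<open>The new final step, from \<open>y\<close> to the base point \<open>y\<close>, has length
  0, so the degree is kept.\<close>

lemma bar_chains_snoc:
  assumes xs: "xs \<in> bar_chains X d n y g" and y: "y \<in> X" and ne: "last xs \<noteq> y"
  shows "xs @ [y] \<in> bar_chains X d (Suc n) y g"
  using bar_chainsD[OF xs] y ne chain_length_snoc[of xs d y] nondeg_snoc
  by (intro bar_chainsI) (auto simp: enn2real_add)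

lemma last_omit_nth:
  assumes "length xs = Suc n" "i < n"
  shows "last (omit_nth i xs) = last xs"
  using assms by (simp add: omit_nth_def last_append)

lemma omit_nth_last:
  assumes "length xs = Suc n"
  shows "omit_nth n xs = butlast xs"
  using assms by (simp add: omit_nth_def butlast_conv_take)

text \<open>Removing an interior point of the chain extended by \<open>y\<close> keeps the length by
  betweenness. It cannot create a repetition: if both neighbours of the removed point agreed,
  betweenness would force that point to equal them.\<close>

lemma bar_chains_omit_nth:
  assumes xs: "xs \<in> bar_chains X d (Suc n) y g" and i: "i \<in> {1..Suc n}" and b: "face_between d y i xs"
  shows "omit_nth i xs \<in> bar_chains X d n y g"
proof -
  note xs' = bar_chainsD[OF xs]
  have "chain_length d (omit_nth i xs @ [y]) = chain_length d (xs @ [y])"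
  proof -
    have "between d ((xs @ [y]) ! (i - 1)) ((xs @ [y]) ! i) ((xs @ [y]) ! Suc i)"
      using b i xs'(1) by (auto simp: nth_append)
    then show ?thesis
      using chain_length_omit_nth[of i "xs @ [y]" d] i xs'(1) by (simp add: omit_nth_append)
  qed
  moreover have "nondeg (omit_nth i xs)"
    unfolding nondeg_def
  proof (intro allI impI)
    fix j assume j: "Suc j < length (omit_nth i xs)"
    then have jn: "Suc j < Suc n" using i xs'(1) by (simp add: length_omit_nth)
    have nd: "\<And>k. Suc k < Suc (Suc n) \<Longrightarrow> xs ! k \<noteq> xs ! Suc k"
      using xs'(1,5) by (simp add: nondeg_def)
    have eqs: "omit_nth i xs ! j = (if j < i then xs ! j else xs ! Suc j)"
      "omit_nth i xs ! Suc j = (if Suc j < i then xs ! Suc j else xs ! Suc (Suc j))"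
      using i xs'(1) jn by (simp_all add: nth_omit_nth)
    show "omit_nth i xs ! j \<noteq> omit_nth i xs ! Suc j"
    proof (cases "Suc j = i")
      case True
      have "xs ! j \<noteq> xs ! Suc (Suc j)"
      proof
        assume "xs ! j = xs ! Suc (Suc j)"
        then have "between d (xs ! j) (xs ! Suc j) (xs ! j)"
          using b True jn xs'(1) by (auto simp: nth_append)
        then have "xs ! j = xs ! Suc j"
          using jn xs'(10) by (intro between_imp_eq) auto
        then show False using nd jn by auto
      qed
      then show ?thesis using eqs True by simp
    qed (use eqs nd jn in auto)
  qed
  ultimately show ?thesis
    using xs i xs'(1) set_omit_nth[of i xs] by (auto simp: bar_chains_def length_omit_nth)
qed

end

section \<open>The normalised bar resolution\<close>

context graded_quasimetric
begin

definition sg :: "nat \<Rightarrow> 'k" where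
  "sg i = (if even i then \<one> else \<ominus> \<one>)"

lemma sg_closed [simp]: "sg i \<in> carrier K"
  by (simp add: sg_def)

lemma sg_Suc: "sg (Suc i) = \<ominus> sg i"
  by (simp add: sg_def)

lemma sg_sq [simp]: "sg i \<otimes> sg i = \<one>"
  by (simp add: sg_def l_minus r_minus)

abbreviation bmod :: "nat \<Rightarrow> 'x \<Rightarrow> real \<Rightarrow> ('k, 'x list \<Rightarrow> 'k) module" where
  "bmod n y g \<equiv> free_mod K (bar_chains X d n y g)"

text \<open>The list does not record the point \<open>y\<close>, so a generator and its nonzero
  images over other points are the same function \<open>delta K xs\<close>. Acting merely deletes
  the coefficients at those \<open>xs\<close> for which \<open>y\<close> is not between
  \<open>last xs\<close> and \<open>z\<close>.\<close>

definition bar :: "nat \<Rightarrow> ('x, 'k, 'x list \<Rightarrow> 'k) distance_module" where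
  "bar n = \<lparr>fib = (\<lambda>y g. bmod n y g),
     act = (\<lambda>y z g f xs. if between d (last xs) y z then f xs else \<zero>)\<rparr>"

definition bar_face :: "'x \<Rightarrow> nat \<Rightarrow> 'x list \<Rightarrow> 'x list \<Rightarrow> 'k" where
  "bar_face y i xs = (if face_between d y i xs then delta K (omit_nth i xs) else (\<lambda>_. \<zero>))"

text \<open>Face 0 would require the first two points to coincide and is absent, but the signs keep
  the cosimplicial numbering. Face \<open>Suc n\<close> removes the last listed point, whose right
  neighbour is the base point \<open>y\<close>.\<close>

definition bar_bd :: "nat \<Rightarrow> 'x \<Rightarrow> real \<Rightarrow> 'x list \<Rightarrow> 'x list \<Rightarrow> 'k" where
  "bar_bd n y g xs = (\<Oplus>\<^bsub>bmod n y g\<^esub>i\<in>{1..Suc n}. sg i \<odot>\<^bsub>bmod n y g\<^esub> bar_face y i xs)"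

definition bar_diff :: "nat \<Rightarrow> 'x \<Rightarrow> real \<Rightarrow> ('x list \<Rightarrow> 'k) \<Rightarrow> 'x list \<Rightarrow> 'k" where
  "bar_diff n y g = free_lift K (bmod n y g) (bar_bd n y g)"

text \<open>The contraction over a fixed \<open>y\<close>. Where the chain already ends in
  \<open>y\<close>, appending it would be degenerate, and the value is zero. The map is linear in
  each fibre separately, which is where exactness is tested.\<close>

definition bar_cone :: "nat \<Rightarrow> 'x \<Rightarrow> real \<Rightarrow> ('x list \<Rightarrow> 'k) \<Rightarrow> 'x list \<Rightarrow> 'k" where
  "bar_cone n y g = free_lift K (bmod (Suc n) y g)
     (\<lambda>xs. if last xs = y then (\<lambda>_. \<zero>) else delta K (xs @ [y]))"

text \<open>A one-point chain at distance 0 from \<open>y\<close> can only be \<open>[y]\<close>, so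
  in degree 0 this reads off the coefficient of the unique basis element.\<close>

definition bar_aug :: "'x \<Rightarrow> real \<Rightarrow> ('x list \<Rightarrow> 'k) \<Rightarrow> 'k" where
  "bar_aug y g f = (if g = 0 then f [y] else \<zero>)"

lemma fib_bar [simp]: "fib (bar n) y g = bmod n y g"
  by (simp add: bar_def)

lemma act_bar: "act (bar n) y z g f = (\<lambda>xs. if between d (last xs) y z then f xs else \<zero>)"
  by (simp add: bar_def)

lemma act_bar_delta:
  "act (bar n) y z g (delta K xs) = (if between d (last xs) y z then delta K xs else (\<lambda>_. \<zero>))"
  by (auto simp: act_bar delta_def fun_eq_iff)

lemma act_bar_linear:
  assumes "y \<in> X" "z \<in> X" "d y z < \<infinity>"
  shows "act (bar n) y z g \<in> linear_maps K (bmod n y g) (bmod n z (g + rdist d y z))"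
proof (rule linear_mapsI)
  fix f assume "f \<in> carrier (bmod n y g)"
  then have f: "f \<in> free_carrier K (bar_chains X d n y g)" by simp
  have "act (bar n) y z g f \<in> free_carrier K (bar_chains X d n z (g + rdist d y z))"
  proof (rule free_carrierI)
    show "finite {xs. act (bar n) y z g f xs \<noteq> \<zero>}"
      by (rule finite_subset[OF _ free_carrierD(3)[OF f]]) (auto simp: act_bar)
    show "act (bar n) y z g f xs = \<zero>" if "xs \<notin> bar_chains X d n z (g + rdist d y z)" for xs
      using that free_carrierD(2)[OF f, of xs] bar_chains_act[OF _ assms, of xs n g]
      by (auto simp: act_bar)
  qed (use free_carrierD(1)[OF f] in \<open>simp add: act_bar\<close>)
  then show "act (bar n) y z g f \<in> carrier (bmod n z (g + rdist d y z))" by simp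
qed (auto simp: act_bar fun_eq_iff)

lemma graded_bar: "graded_distance_module K X d G (bar n)"
proof -
  have "is_distance_module K X d (bar n)"
  proof (rule is_distance_moduleI)
    show "module K (fib (bar n) x g)" for x g
      by (simp add: module_free_mod)
    show "act (bar n) x y g \<in> linear_maps K (fib (bar n) x g) (fib (bar n) y (g + rdist d x y))"
      if "x \<in> X" "y \<in> X" "d x y < \<infinity>" for x y g
      using act_bar_linear[OF that] by simp
    show "act (bar n) x x g f = f" if "x \<in> X" "f \<in> carrier (fib (bar n) x g)" for x f g
    proof (rule ext)
      fix xs
      show "act (bar n) x x g f xs = f xs"
        using that free_carrierD(2)[of f K "bar_chains X d n x g" xs] bar_chainsD(4)[of xs n x g]
        by (cases "xs \<in> bar_chains X d n x g") (auto simp: act_bar)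
    qed
    show "act (bar n) y z (g + rdist d x y) (act (bar n) x y g f) =
        (if between d x y z then act (bar n) x z g f
         else \<zero>\<^bsub>fib (bar n) z (g + rdist d x y + rdist d y z)\<^esub>)"
      if h: "x \<in> X" "y \<in> X" "z \<in> X" "d x y < \<infinity>" "d y z < \<infinity>" "f \<in> carrier (fib (bar n) x g)"
      for x y z f g
    proof (rule ext)
      fix xs
      show "act (bar n) y z (g + rdist d x y) (act (bar n) x y g f) xs =
        (if between d x y z then act (bar n) x z g f
         else \<zero>\<^bsub>fib (bar n) z (g + rdist d x y + rdist d y z)\<^esub>) xs"
      proof (cases "xs \<in> bar_chains X d n x g")
        case True
        \<comment> \<open>Acting twice keeps \<open>xs\<close> if \<open>x\<close> is between
          \<open>last xs\<close> and \<open>y\<close>, and \<open>y\<close> between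
          \<open>last xs\<close> and \<open>z\<close>; associativity of betweenness turns this into
          the condition of the composition law.\<close>
        from between_assoc[OF bar_chainsD(4)[OF True] h(1-3) bar_chainsD(7)[OF True] h(4,5)]
        show ?thesis by (auto simp: act_bar)
      next
        case False
        then have "f xs = \<zero>" using h(6) by (auto dest: free_carrierD(2))
        then show ?thesis by (simp add: act_bar)
      qed
    qed
  qed
  moreover have "carrier (fib (bar n) y g) = {\<zero>\<^bsub>fib (bar n) y g\<^esub>}" if "y \<in> X" "g \<notin> G" for y g
  proof -
    have "bar_chains X d n y g = {}"
      using that bar_chains_degree by blast
    then show ?thesis
      using free_carrier_zero by (auto dest: free_carrierD(2))
  qed
  ultimately show ?thesis
    by (simp add: graded_distance_module_def)
qed

lemmas bar_module = graded_imp_distance_module[OF graded_bar]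

lemma bar_face_closed:
  assumes "xs \<in> bar_chains X d (Suc n) y g" "i \<in> {1..Suc n}"
  shows "bar_face y i xs \<in> free_carrier K (bar_chains X d n y g)"
  using assms by (simp add: bar_face_def free_carrier_zero free_carrier_delta bar_chains_omit_nth)

lemma bar_bd_closed:
  "bar_bd n y g \<in> bar_chains X d (Suc n) y g \<rightarrow> carrier (bmod n y g)"
proof
  fix xs assume xs: "xs \<in> bar_chains X d (Suc n) y g"
  interpret N: module K "bmod n y g" by (rule module_free_mod)
  show "bar_bd n y g xs \<in> carrier (bmod n y g)"
    unfolding bar_bd_def using bar_face_closed[OF xs]
    by (intro N.M.finsum_closed Pi_I N.smult_closed) simp_all
qed

lemma bar_diff_linear: "bar_diff n y g \<in> linear_maps K (bmod (Suc n) y g) (bmod n y g)"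
  unfolding bar_diff_def by (rule free_lift_linear[OF module_free_mod bar_bd_closed])

lemma bar_diff_delta:
  "xs \<in> bar_chains X d (Suc n) y g \<Longrightarrow> bar_diff n y g (delta K xs) = bar_bd n y g xs"
  unfolding bar_diff_def by (rule free_lift_delta[OF module_free_mod bar_bd_closed])

lemma bar_cone_closed:
  assumes "y \<in> X"
  shows "(\<lambda>xs. if last xs = y then (\<lambda>_. \<zero>) else delta K (xs @ [y]))
    \<in> bar_chains X d n y g \<rightarrow> carrier (bmod (Suc n) y g)"
  using assms by (simp add: free_carrier_zero free_carrier_delta bar_chains_snoc)

lemma bar_cone_linear: "y \<in> X \<Longrightarrow> bar_cone n y g \<in> linear_maps K (bmod n y g) (bmod (Suc n) y g)"
  unfolding bar_cone_def by (rule free_lift_linear[OF module_free_mod bar_cone_closed])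

lemma bar_cone_delta:
  "\<lbrakk>y \<in> X; xs \<in> bar_chains X d n y g\<rbrakk> \<Longrightarrow>
    bar_cone n y g (delta K xs) = (if last xs = y then (\<lambda>_. \<zero>) else delta K (xs @ [y]))"
  unfolding bar_cone_def by (rule free_lift_delta[OF module_free_mod bar_cone_closed])

text \<open>Boundaries enter the later computations through linear maps applied to them: the action,
  the cone and the extension of a cochain. Each is then treated face by face.\<close>

lemma linear_bar_bd:
  assumes \<phi>: "\<phi> \<in> linear_maps K (bmod n y g) N" and N: "module K N"
    and xs: "xs \<in> bar_chains X d (Suc n) y g"
  shows "\<phi> (bar_bd n y g xs) = (\<Oplus>\<^bsub>N\<^esub>i\<in>{1..Suc n}. sg i \<odot>\<^bsub>N\<^esub> \<phi> (bar_face y i xs))"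
proof -
  interpret B: module K "bmod n y g" by (rule module_free_mod)
  interpret N: module K N by (rule N)
  have cl: "bar_face y i xs \<in> carrier (bmod n y g)" if "i \<in> {1..Suc n}" for i
    using bar_face_closed[OF xs that] by simp
  have "\<phi> (bar_bd n y g xs) = (\<Oplus>\<^bsub>N\<^esub>i\<in>{1..Suc n}. \<phi> (sg i \<odot>\<^bsub>bmod n y g\<^esub> bar_face y i xs))"
    unfolding bar_bd_def using cl
    by (intro linear_maps_finsum[OF \<phi> module_free_mod N] Pi_I B.smult_closed) simp_all
  also have "\<dots> = (\<Oplus>\<^bsub>N\<^esub>i\<in>{1..Suc n}. sg i \<odot>\<^bsub>N\<^esub> \<phi> (bar_face y i xs))"
    using cl linear_maps_closed[OF \<phi>]
    by (intro N.M.finsum_cong' Pi_I N.smult_closed linear_maps_smult[OF \<phi>]) auto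
  finally show ?thesis .
qed

text \<open>A face that keeps the last point does not see whether the base point is \<open>y\<close>
  or \<open>z\<close>. For the last face, with \<open>a\<close> and \<open>b\<close> the last two
  points, both sides demand that the path through \<open>a\<close>, \<open>b\<close>,
  \<open>y\<close>, \<open>z\<close> be as short as the direct step.\<close>

lemma act_bar_face:
  assumes xs: "xs \<in> bar_chains X d (Suc n) y g" and yz: "y \<in> X" "z \<in> X" "d y z < \<infinity>"
    and i: "i \<in> {1..Suc n}"
  shows "act (bar n) y z g (bar_face y i xs) =
    (if between d (last xs) y z then bar_face z i xs else (\<lambda>_. \<zero>))"
proof -
  note xs' = bar_chainsD[OF xs]
  show ?thesis
  proof (cases "i = Suc n")
    case False
    then have "last (omit_nth i xs) = last xs" "(xs @ [y]) ! Suc i = (xs @ [z]) ! Suc i"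
      using i xs'(1) last_omit_nth[of xs "Suc n" i] by (simp_all add: nth_append)
    then show ?thesis
      by (auto simp: bar_face_def act_bar_delta) (simp add: act_bar)
  next
    case True
    let ?a = "xs ! n" and ?b = "xs ! Suc n"
    have b: "last xs = ?b" "(xs @ [y]) ! Suc i = y" "(xs @ [z]) ! Suc i = z"
      using True xs'(1,2) by (simp_all add: last_conv_nth nth_append)
    have ne: "butlast xs \<noteq> []"
      using xs'(1) by (cases xs) auto
    then have la: "last (butlast xs) = ?a"
      using xs'(1) by (simp add: last_conv_nth nth_butlast)
    then have "last (omit_nth i xs) = ?a"
      using True xs'(1) by (simp add: omit_nth_last)
    moreover have "between d ?a ?b y \<and> between d ?a y z \<longleftrightarrow> between d ?b y z \<and> between d ?a ?b z"
      if "d ?a ?b < \<infinity>"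
      using that between_assoc[OF xs'(10) xs'(10) yz(1,2) that] xs'(7) yz(3) b(1) by simp
    moreover have "d ?a ?b < \<infinity>"
    proof -
      have "xs = butlast xs @ [last xs]" using xs'(2) by simp
      then have "chain_length d xs = chain_length d (butlast xs) + d (last (butlast xs)) (last xs)"
        using chain_length_snoc[OF ne, of d "last xs"] by simp
      then have "d (last (butlast xs)) (last xs) < \<infinity>"
        using xs'(6) by simp
      then show ?thesis
        using la b(1) by simp
    qed
    ultimately show ?thesis
      using True b by (auto simp: bar_face_def act_bar_delta) (auto simp: act_bar)
  qed
qed

lemma bar_diff_hom: "dm_fun X (bar (Suc n)) (bar_diff n) \<in> dm_hom K X d (bar (Suc n)) (bar n)"
proof (rule dm_fun_hom[OF bar_module])
  show "bar_diff n x g \<in> linear_maps K (fib (bar (Suc n)) x g) (fib (bar n) x g)" for x g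
    by (simp add: bar_diff_linear)
  fix y z g f
  assume yz: "y \<in> X" "z \<in> X" "d y z < \<infinity>" and "f \<in> carrier (fib (bar (Suc n)) y g)"
  then have f: "f \<in> free_carrier K (bar_chains X d (Suc n) y g)" by simp
  let ?g = "g + rdist d y z"
  \<comment> \<open>Both sides are linear in \<open>f\<close>, so basis elements suffice; there the
    claim is that each face commutes with the action.\<close>
  have "(\<lambda>f. act (bar n) y z g (bar_diff n y g f)) f = (\<lambda>f. bar_diff n z ?g (act (bar (Suc n)) y z g f)) f"
  proof (rule linear_maps_free_eqI[OF module_free_mod _ _ _ f])
    show "(\<lambda>f. act (bar n) y z g (bar_diff n y g f)) \<in> linear_maps K (bmod (Suc n) y g) (bmod n z ?g)"
      by (rule linear_maps_comp[OF bar_diff_linear act_bar_linear[OF yz]])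
    show "(\<lambda>f. bar_diff n z ?g (act (bar (Suc n)) y z g f)) \<in> linear_maps K (bmod (Suc n) y g) (bmod n z ?g)"
      by (rule linear_maps_comp[OF act_bar_linear[OF yz] bar_diff_linear])
    fix xs assume xs: "xs \<in> bar_chains X d (Suc n) y g"
    interpret N: module K "bmod n z ?g" by (rule module_free_mod)
    have "act (bar n) y z g (bar_bd n y g xs) =
        (\<Oplus>\<^bsub>bmod n z ?g\<^esub>i\<in>{1..Suc n}. sg i \<odot>\<^bsub>bmod n z ?g\<^esub> act (bar n) y z g (bar_face y i xs))"
      by (rule linear_bar_bd[OF act_bar_linear[OF yz] module_free_mod xs])
    also have "\<dots> = (if between d (last xs) y z then bar_bd n z ?g xs else (\<lambda>_. \<zero>))"
    proof (cases "between d (last xs) y z")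
      case True
      then have xs': "xs \<in> bar_chains X d (Suc n) z ?g"
        by (rule bar_chains_act[OF xs yz])
      have "(\<Oplus>\<^bsub>bmod n z ?g\<^esub>i\<in>{1..Suc n}. sg i \<odot>\<^bsub>bmod n z ?g\<^esub> act (bar n) y z g (bar_face y i xs))
          = (\<Oplus>\<^bsub>bmod n z ?g\<^esub>i\<in>{1..Suc n}. sg i \<odot>\<^bsub>bmod n z ?g\<^esub> bar_face z i xs)"
        using True bar_face_closed[OF xs']
        by (intro N.M.finsum_cong' Pi_I N.smult_closed) (simp_all add: act_bar_face[OF xs yz])
      with True show ?thesis by (simp add: bar_bd_def)
    next
      case False
      have "(\<Oplus>\<^bsub>bmod n z ?g\<^esub>i\<in>{1..Suc n}. sg i \<odot>\<^bsub>bmod n z ?g\<^esub> act (bar n) y z g (bar_face y i xs))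
          = (\<Oplus>\<^bsub>bmod n z ?g\<^esub>i\<in>{1..Suc n}. \<zero>\<^bsub>bmod n z ?g\<^esub>)"
        using False by (intro N.M.finsum_cong') (simp_all add: act_bar_face[OF xs yz] free_carrier_zero)
      with False show ?thesis using N.M.finsum_zero by simp
    qed
    also have "\<dots> = bar_diff n z ?g (act (bar (Suc n)) y z g (delta K xs))"
      using bar_diff_delta[of xs n z ?g] bar_chains_act[OF xs yz]
        linear_maps_zero[OF bar_diff_linear module_free_mod module_free_mod]
      by (simp add: act_bar_delta)
    finally show "act (bar n) y z g (bar_diff n y g (delta K xs)) =
        bar_diff n z ?g (act (bar (Suc n)) y z g (delta K xs))"
      by (simp add: bar_diff_delta[OF xs])
  qed
  then show "act (bar n) y z g (bar_diff n y g f) = bar_diff n z ?g (act (bar (Suc n)) y z g f)"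
    by simp
qed


section \<open>The contracting homotopy in positive degrees\<close>

lemma bar_bd_insert:
  assumes xs: "xs \<in> bar_chains X d (Suc (Suc n)) y g"
  shows "bar_bd (Suc n) y g xs =
    (\<Oplus>\<^bsub>bmod (Suc n) y g\<^esub>i\<in>{1..Suc n}. sg i \<odot>\<^bsub>bmod (Suc n) y g\<^esub> bar_face y i xs)
      \<oplus>\<^bsub>bmod (Suc n) y g\<^esub> sg (Suc (Suc n)) \<odot>\<^bsub>bmod (Suc n) y g\<^esub> bar_face y (Suc (Suc n)) xs"
proof -
  interpret B: module K "bmod (Suc n) y g" by (rule module_free_mod)
  have cl: "sg i \<odot>\<^bsub>bmod (Suc n) y g\<^esub> bar_face y i xs \<in> carrier (bmod (Suc n) y g)"
    if "i \<in> {1..Suc (Suc n)}" for i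
    using bar_face_closed[OF xs that] by (intro B.smult_closed) simp_all
  have "{1..Suc (Suc n)} = insert (Suc (Suc n)) {1..Suc n}" by auto
  then have "bar_bd (Suc n) y g xs = sg (Suc (Suc n)) \<odot>\<^bsub>bmod (Suc n) y g\<^esub> bar_face y (Suc (Suc n)) xs
      \<oplus>\<^bsub>bmod (Suc n) y g\<^esub> (\<Oplus>\<^bsub>bmod (Suc n) y g\<^esub>i\<in>{1..Suc n}. sg i \<odot>\<^bsub>bmod (Suc n) y g\<^esub> bar_face y i xs)"
    unfolding bar_bd_def using cl by (simp only:, intro B.M.finsum_insert) (simp_all del: free_mod_simps)
  then show ?thesis
    using cl by (subst B.M.a_comm) (auto intro!: B.M.finsum_closed simp del: free_mod_simps)
qed

text \<open>If the chain does not end in \<open>y\<close>, the final face of its cone undoes the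
  cone and gives the last term, while the other faces commute with coning. If it ends in
  \<open>y\<close>, its cone is zero; all faces but the last still end in \<open>y\<close> and have
  zero cone, and the last face loses \<open>y\<close> and regains it by coning, with the sign
  opposite to the last term.\<close>

lemma bar_homotopy_delta:
  assumes y: "y \<in> X" and xs: "xs \<in> bar_chains X d (Suc n) y g"
  shows "bar_diff (Suc n) y g (bar_cone (Suc n) y g (delta K xs)) =
    bar_cone n y g (bar_diff n y g (delta K xs)) \<oplus>\<^bsub>bmod (Suc n) y g\<^esub>
      sg (Suc (Suc n)) \<odot>\<^bsub>bmod (Suc n) y g\<^esub> delta K xs"
proof -
  interpret B: module K "bmod (Suc n) y g" by (rule module_free_mod)
  note xs' = bar_chainsD[OF xs]
  have dx: "delta K xs \<in> carrier (bmod (Suc n) y g)"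
    using free_carrier_delta[OF xs] by simp
  have cl: "bar_cone n y g (bar_face y i xs) \<in> carrier (bmod (Suc n) y g)" if "i \<in> {1..Suc n}" for i
    using bar_face_closed[OF xs that] by (intro linear_maps_closed[OF bar_cone_linear[OF y]]) simp
  have rhs: "bar_cone n y g (bar_diff n y g (delta K xs)) =
      (\<Oplus>\<^bsub>bmod (Suc n) y g\<^esub>i\<in>{1..Suc n}. sg i \<odot>\<^bsub>bmod (Suc n) y g\<^esub> bar_cone n y g (bar_face y i xs))"
    unfolding bar_diff_delta[OF xs]
    by (rule linear_bar_bd[OF bar_cone_linear[OF y] module_free_mod xs])
  have cone_zero: "bar_cone n y g (\<lambda>_. \<zero>) = (\<lambda>_. \<zero>)"
    using linear_maps_zero[OF bar_cone_linear[OF y] module_free_mod module_free_mod, of n g] by simp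
  have last_omit: "last (omit_nth i xs) = last xs" "(xs @ [y]) ! Suc i = xs ! Suc i" if "i \<in> {1..n}" for i
    using that xs'(1) last_omit_nth[of xs "Suc n" i] by (simp_all add: nth_append)
  have ne: "butlast xs \<noteq> []"
    using xs'(1) by (cases xs) auto
  have la: "last (butlast xs) = xs ! n"
    using ne xs'(1) by (simp add: last_conv_nth nth_butlast)
  have lx: "last xs = xs ! Suc n" "(xs @ [y]) ! Suc (Suc n) = y"
    using xs'(1,2) by (simp_all add: last_conv_nth nth_append)
  have om: "omit_nth (Suc n) xs = butlast xs"
    using xs'(1) by (simp add: omit_nth_last)
  show ?thesis
  proof (cases "last xs = y")
    case False
    have xsy: "xs @ [y] \<in> bar_chains X d (Suc (Suc n)) y g"
      by (rule bar_chains_snoc[OF xs y False])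
    have face: "bar_cone n y g (bar_face y i xs) = bar_face y i (xs @ [y])" if i: "i \<in> {1..Suc n}" for i
    proof -
      have fb: "face_between d y i (xs @ [y]) = face_between d y i xs"
        using i xs'(1) by (auto simp: nth_append)
      \<comment> \<open>Only the last face exposes a new end point. Were it \<open>y\<close>, the
        removed point would be between \<open>y\<close> and \<open>y\<close>, hence equal to
        \<open>y\<close>.\<close>
      have "last (omit_nth i xs) \<noteq> y" if b: "face_between d y i xs"
      proof (cases "i = Suc n")
        case True
        then have "between d (xs ! n) (last xs) y"
          using b lx by simp
        then show ?thesis
          using between_imp_eq[of y "last xs"] False True om la y xs'(4) by auto
      qed (use last_omit False i in auto)
      then show ?thesis
        using fb i xs'(1) bar_cone_delta[OF y bar_chains_omit_nth[OF xs i]]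
        by (simp add: bar_face_def cone_zero omit_nth_append)
    qed
    \<comment> \<open>Removing the appended \<open>y\<close> is always allowed, since its right
      neighbour is the base point \<open>y\<close> itself.\<close>
    have "bar_face y (Suc (Suc n)) (xs @ [y]) = delta K xs"
      using xs'(1,4) lx omit_nth_snoc[of xs y] y by (simp add: bar_face_def nth_append)
    moreover have "(\<Oplus>\<^bsub>bmod (Suc n) y g\<^esub>i\<in>{1..Suc n}. sg i \<odot>\<^bsub>bmod (Suc n) y g\<^esub> bar_cone n y g (bar_face y i xs))
       = (\<Oplus>\<^bsub>bmod (Suc n) y g\<^esub>i\<in>{1..Suc n}. sg i \<odot>\<^bsub>bmod (Suc n) y g\<^esub> bar_face y i (xs @ [y]))"
      using cl by (intro B.M.finsum_cong' Pi_I B.smult_closed)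
        (simp_all only: face sg_closed)
    ultimately show ?thesis
      using False bar_bd_insert[OF xsy] unfolding rhs bar_cone_delta[OF y xs]
      by (simp add: bar_diff_delta[OF xsy])
  next
    case True
    have face0: "bar_cone n y g (bar_face y i xs) = (\<lambda>_. \<zero>)" if i: "i \<in> {1..n}" for i
      using i True last_omit bar_cone_delta[OF y bar_chains_omit_nth[OF xs, of i]]
      by (simp add: bar_face_def cone_zero)
    have "face_between d y (Suc n) xs"
      using True lx y xs'(10)[of n] by simp
    moreover have "last (butlast xs) \<noteq> y"
      using nondeg_butlast_last_neq[OF xs'(5,1)] True by simp
    moreover have "butlast xs @ [y] = xs"
      using True xs'(2) by (metis append_butlast_last_id)
    ultimately have face1: "bar_cone n y g (bar_face y (Suc n) xs) = delta K xs"
      using bar_cone_delta[OF y bar_chains_omit_nth[OF xs, of "Suc n"]] om by (simp add: bar_face_def)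
    have "(\<Oplus>\<^bsub>bmod (Suc n) y g\<^esub>i\<in>{1..Suc n}. sg i \<odot>\<^bsub>bmod (Suc n) y g\<^esub> bar_cone n y g (bar_face y i xs))
        = (\<Oplus>\<^bsub>bmod (Suc n) y g\<^esub>i\<in>{Suc n}. sg i \<odot>\<^bsub>bmod (Suc n) y g\<^esub> bar_cone n y g (bar_face y i xs))"
    proof (rule B.M.add.finprod_mono_neutral_cong_right)
      show "sg i \<odot>\<^bsub>bmod (Suc n) y g\<^esub> bar_cone n y g (bar_face y i xs) = \<zero>\<^bsub>bmod (Suc n) y g\<^esub>"
        if "i \<in> {1..Suc n} - {Suc n}" for i
        using that face0[of i] by auto
    qed (use cl in \<open>auto simp del: free_mod_simps intro!: B.smult_closed\<close>)
    also have "\<dots> = sg (Suc n) \<odot>\<^bsub>bmod (Suc n) y g\<^esub> delta K xs"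
      using face1 dx B.M.finsum_insert[of "{}" "Suc n" "\<lambda>i. sg i \<odot>\<^bsub>bmod (Suc n) y g\<^esub> bar_cone n y g (bar_face y i xs)"]
        B.M.finsum_empty B.smult_closed[OF sg_closed dx] B.M.r_zero by (simp del: free_mod_simps)
    finally have hD: "bar_cone n y g (bar_diff n y g (delta K xs)) = sg (Suc n) \<odot>\<^bsub>bmod (Suc n) y g\<^esub> delta K xs"
      unfolding rhs .
    have cone: "bar_cone (Suc n) y g (delta K xs) = (\<lambda>_. \<zero>)"
      using True bar_cone_delta[OF y xs] by simp
    have diff: "bar_diff (Suc n) y g (\<lambda>_. \<zero>) = (\<lambda>_. \<zero>)"
      using linear_maps_zero[OF bar_diff_linear module_free_mod module_free_mod, of "Suc n" y g] by simp
    show ?thesis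
      unfolding hD cone diff by (auto simp: sg_Suc delta_def fun_eq_iff l_minus l_neg)
  qed
qed

lemma bar_homotopy:
  assumes y: "y \<in> X" and f: "f \<in> free_carrier K (bar_chains X d (Suc n) y g)"
  shows "bar_diff (Suc n) y g (bar_cone (Suc n) y g f) =
    bar_cone n y g (bar_diff n y g f) \<oplus>\<^bsub>bmod (Suc n) y g\<^esub> sg (Suc (Suc n)) \<odot>\<^bsub>bmod (Suc n) y g\<^esub> f"
proof -
  have l: "(\<lambda>f. bar_diff (Suc n) y g (bar_cone (Suc n) y g f)) \<in> linear_maps K (bmod (Suc n) y g) (bmod (Suc n) y g)"
    by (rule linear_maps_comp[OF bar_cone_linear[OF y] bar_diff_linear])
  have r: "(\<lambda>f. bar_cone n y g (bar_diff n y g f) \<oplus>\<^bsub>bmod (Suc n) y g\<^esub> sg (Suc (Suc n)) \<odot>\<^bsub>bmod (Suc n) y g\<^esub> f)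
    \<in> linear_maps K (bmod (Suc n) y g) (bmod (Suc n) y g)"
    by (intro linear_maps_add_map linear_maps_comp[OF bar_diff_linear bar_cone_linear[OF y]]
      linear_maps_smult_map linear_maps_id module_free_mod sg_closed)
  show ?thesis
    using linear_maps_free_eqI[OF module_free_mod l r bar_homotopy_delta[OF y] f] .
qed

section \<open>Generators and the universal property of the bar modules\<close>

definition bar_gens :: "nat \<Rightarrow> 'x list set" where
  "bar_gens n = {xs. length xs = Suc n \<and> set xs \<subseteq> X \<and> nondeg xs \<and> chain_length d xs < \<infinity>}"

lemma bar_gens_iff: "xs \<in> bar_gens n \<longleftrightarrow> xs \<in> finite_chains X d n \<and> nondeg xs"
  by (auto simp: bar_gens_def finite_chains_def)

lemma bar_gensD:
  assumes "xs \<in> bar_gens n"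
  shows "xs \<in> bar_chains X d n (last xs) (clen d xs)" "last xs \<in> X"
proof -
  show "xs \<in> bar_chains X d n (last xs) (clen d xs)"
    using assms by (intro bar_chains_gen) (auto simp: bar_gens_def)
  then show "last xs \<in> X" by (rule bar_chainsD)
qed

lemma bar_chains_gens: "xs \<in> bar_chains X d n y g \<Longrightarrow> xs \<in> bar_gens n"
  using bar_chainsD[of xs n y g] by (simp add: bar_gens_def)

lemma act_bar_gen:
  assumes "xs \<in> bar_chains X d n y g" "y \<in> X"
  shows "act (bar n) (last xs) y (clen d xs) (delta K xs) = delta K xs"
  using bar_chainsD(4)[OF assms(1)] assms(2) by (simp add: act_bar_delta)

text \<open>A basis element over \<open>y\<close> is the generator over \<open>last xs\<close>
  carried along the action, so naturality leaves no freedom elsewhere.\<close>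

lemma bar_hom_eqI:
  assumes N: "is_distance_module K X d N"
    and \<phi>: "\<phi> \<in> dm_hom K X d (bar n) N" and \<psi>: "\<psi> \<in> dm_hom K X d (bar n) N"
    and eq: "\<And>xs. xs \<in> bar_gens n \<Longrightarrow>
      \<phi> (last xs) (clen d xs) (delta K xs) = \<psi> (last xs) (clen d xs) (delta K xs)"
  shows "\<phi> = \<psi>"
proof (rule dm_hom_eqI[OF \<phi> \<psi>])
  fix y g f assume y: "y \<in> X" and "f \<in> carrier (fib (bar n) y g)"
  then have f: "f \<in> free_carrier K (bar_chains X d n y g)" by simp
  have lin: "\<phi> y g \<in> linear_maps K (bmod n y g) (fib N y g)" "\<psi> y g \<in> linear_maps K (bmod n y g) (fib N y g)"
    using dm_hom_linear[OF \<phi> y, of g] dm_hom_linear[OF \<psi> y, of g] by simp_all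
  show "\<phi> y g f = \<psi> y g f"
  proof (rule linear_maps_free_eqI[OF dm_module[OF N y] lin _ f])
    fix xs assume xs: "xs \<in> bar_chains X d n y g"
    note xs' = bar_chainsD[OF xs]
    have gen: "delta K xs \<in> carrier (fib (bar n) (last xs) (clen d xs))"
      using free_carrier_delta[OF bar_gensD(1)[OF bar_chains_gens[OF xs]]] by simp
    show "\<phi> y g (delta K xs) = \<psi> y g (delta K xs)"
      using dm_hom_act[OF \<phi> xs'(4) y xs'(7) gen] dm_hom_act[OF \<psi> xs'(4) y xs'(7) gen]
        eq[OF bar_chains_gens[OF xs]] xs'(9) act_bar_gen[OF xs y] by simp
  qed
qed

definition bar_ext ::
  "nat \<Rightarrow> ('x, 'k, 'b) distance_module \<Rightarrow> ('x list \<Rightarrow> 'b) \<Rightarrow> 'x \<Rightarrow> real \<Rightarrow> ('x list \<Rightarrow> 'k) \<Rightarrow> 'b" where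
  "bar_ext n N \<alpha> = dm_fun X (bar n)
     (\<lambda>y g. free_lift K (fib N y g) (\<lambda>xs. act N (last xs) y (clen d xs) (\<alpha> xs)))"

text \<open>The universal property of the free distance module on \<open>bar_gens n\<close>.
  Naturality forces the value on every basis element; the forced values are natural because the
  action of \<open>N\<close> composes to zero where the bar action deletes a chain.\<close>

lemma
  assumes N: "is_distance_module K X d N"
    and \<alpha>: "\<And>xs. xs \<in> bar_gens n \<Longrightarrow> \<alpha> xs \<in> carrier (fib N (last xs) (clen d xs))"
  shows bar_ext_hom: "bar_ext n N \<alpha> \<in> dm_hom K X d (bar n) N"
    and bar_ext_delta: "\<lbrakk>y \<in> X; xs \<in> bar_chains X d n y g\<rbrakk> \<Longrightarrow>
      bar_ext n N \<alpha> y g (delta K xs) = act N (last xs) y (clen d xs) (\<alpha> xs)"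
    and bar_ext_gen: "xs \<in> bar_gens n \<Longrightarrow> bar_ext n N \<alpha> (last xs) (clen d xs) (delta K xs) = \<alpha> xs"
proof -
  let ?b = "\<lambda>y xs. act N (last xs) y (clen d xs) (\<alpha> xs)"
  have b: "?b y \<in> bar_chains X d n y g \<rightarrow> carrier (fib N y g)" if "y \<in> X" for y g
  proof
    fix xs assume xs: "xs \<in> bar_chains X d n y g"
    note xs' = bar_chainsD[OF xs]
    show "?b y xs \<in> carrier (fib N y g)"
      using linear_maps_closed[OF dm_act[OF N xs'(4) that xs'(7)] \<alpha>[OF bar_chains_gens[OF xs]]] xs'(9)
      by simp
  qed
  have lin: "free_lift K (fib N y g) (?b y) \<in> linear_maps K (bmod n y g) (fib N y g)" if "y \<in> X" for y g
    by (rule free_lift_linear[OF dm_module[OF N that] b[OF that]])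
  have delta: "free_lift K (fib N y g) (?b y) (delta K xs) = ?b y xs"
    if "y \<in> X" "xs \<in> bar_chains X d n y g" for y g xs
    by (rule free_lift_delta[OF dm_module[OF N that(1)] b[OF that(1)] that(2)])
  show "bar_ext n N \<alpha> \<in> dm_hom K X d (bar n) N"
    unfolding bar_ext_def
  proof (rule dm_fun_hom[OF bar_module])
    show "free_lift K (fib N y g) (?b y) \<in> linear_maps K (fib (bar n) y g) (fib N y g)"
      if "y \<in> X" for y g
      using lin[OF that] by simp
    fix y z g f
    assume yz: "y \<in> X" "z \<in> X" "d y z < \<infinity>" and "f \<in> carrier (fib (bar n) y g)"
    then have f: "f \<in> free_carrier K (bar_chains X d n y g)" by simp
    let ?g = "g + rdist d y z"
    have l: "(\<lambda>f. act N y z g (free_lift K (fib N y g) (?b y) f)) \<in> linear_maps K (bmod n y g) (fib N z ?g)"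
      by (rule linear_maps_comp[OF lin[OF yz(1)] dm_act[OF N yz]])
    have r: "(\<lambda>f. free_lift K (fib N z ?g) (?b z) (act (bar n) y z g f)) \<in> linear_maps K (bmod n y g) (fib N z ?g)"
      by (rule linear_maps_comp[OF act_bar_linear[OF yz] lin[OF yz(2)]])
    have gen: "act N y z g (free_lift K (fib N y g) (?b y) (delta K xs)) =
        free_lift K (fib N z ?g) (?b z) (act (bar n) y z g (delta K xs))"
      if xs: "xs \<in> bar_chains X d n y g" for xs
    proof -
      note xs' = bar_chainsD[OF xs]
      have "act N y z g (?b y xs) = (if between d (last xs) y z then ?b z xs else \<zero>\<^bsub>fib N z ?g\<^esub>)"
        using dm_act_act[OF N xs'(4) yz(1,2) xs'(7) yz(3) \<alpha>[OF bar_chains_gens[OF xs]]] xs'(9) by simp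
      also have "\<dots> = free_lift K (fib N z ?g) (?b z) (act (bar n) y z g (delta K xs))"
        using delta[OF yz(2) bar_chains_act[OF xs yz]]
          linear_maps_zero[OF lin[OF yz(2)] module_free_mod dm_module[OF N yz(2)], of ?g]
        by (simp add: act_bar_delta)
      finally show ?thesis by (simp add: delta[OF yz(1) xs])
    qed
    show "act N y z g (free_lift K (fib N y g) (?b y) f) =
        free_lift K (fib N z ?g) (?b z) (act (bar n) y z g f)"
      using linear_maps_free_eqI[OF dm_module[OF N yz(2)] l r gen f] .
  qed
  show d': "bar_ext n N \<alpha> y g (delta K xs) = ?b y xs" if "y \<in> X" "xs \<in> bar_chains X d n y g" for y g xs
    using that free_carrier_delta[OF that(2)] by (simp add: bar_ext_def delta)
  show "bar_ext n N \<alpha> (last xs) (clen d xs) (delta K xs) = \<alpha> xs" if "xs \<in> bar_gens n" for xs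
    using d'[OF bar_gensD(2,1)[OF that]] dm_act_self[OF N bar_gensD(2)[OF that] \<alpha>[OF that]] by simp
qed

text \<open>Preimages are chosen for the generators only and then extended freely; the composite
  with \<open>e\<close> is \<open>f\<close> because both are determined by their values on
  generators. The element types of \<open>B\<close> and \<open>C\<close> are arbitrary.\<close>

lemma bar_lift:
  assumes B: "is_distance_module K X d B" and C: "is_distance_module K X d C"
    and e: "e \<in> dm_hom K X d B C" and surj: "dm_surj X B C e" and f: "f \<in> dm_hom K X d (bar n) C"
  shows "\<exists>h\<in>dm_hom K X d (bar n) B. dm_comp X (bar n) e h = f"
proof -
  have "\<exists>b\<in>carrier (fib B (last xs) (clen d xs)). e (last xs) (clen d xs) b = f (last xs) (clen d xs) (delta K xs)"
    if "xs \<in> bar_gens n" for xs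
  proof -
    have "f (last xs) (clen d xs) (delta K xs) \<in> carrier (fib C (last xs) (clen d xs))"
      using dm_hom_closed[OF f bar_gensD(2)[OF that], of "delta K xs"]
        free_carrier_delta[OF bar_gensD(1)[OF that]] by simp
    then show ?thesis
      using surj bar_gensD(2)[OF that] unfolding dm_surj_def by (metis (no_types, lifting) imageE)
  qed
  then obtain \<alpha> where \<alpha>: "\<And>xs. xs \<in> bar_gens n \<Longrightarrow> \<alpha> xs \<in> carrier (fib B (last xs) (clen d xs))"
    and e\<alpha>: "\<And>xs. xs \<in> bar_gens n \<Longrightarrow> e (last xs) (clen d xs) (\<alpha> xs) = f (last xs) (clen d xs) (delta K xs)"
    by metis
  note h = bar_ext_hom[OF B \<alpha>]
  have "dm_comp X (bar n) e (bar_ext n B \<alpha>) = f"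
  proof (rule bar_hom_eqI[OF C dm_comp_hom[OF bar_module h e] f])
    fix xs assume xs: "xs \<in> bar_gens n"
    show "dm_comp X (bar n) e (bar_ext n B \<alpha>) (last xs) (clen d xs) (delta K xs) = f (last xs) (clen d xs) (delta K xs)"
      using bar_gensD[OF xs] bar_ext_gen[OF B \<alpha> xs] e\<alpha>[OF xs] free_carrier_delta[OF bar_gensD(1)[OF xs]] by simp
  qed
  with h show ?thesis by blast
qed

section \<open>The trivial module, the augmentation and the bottom of the contraction\<close>

abbreviation triv :: "('x, 'k, 'k) distance_module" where
  "triv \<equiv> trivial_distance_module K"

lemma fib_triv_simps [simp]:
  "carrier (fib triv y g) = (if g = 0 then carrier K else {\<zero>})"
  "\<zero>\<^bsub>fib triv y g\<^esub> = \<zero>"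
  "a \<oplus>\<^bsub>fib triv y g\<^esub> b = a \<oplus> b"
  "a \<odot>\<^bsub>fib triv y g\<^esub> b = a \<otimes> b"
  "act triv x y g a = (if x = y then a else \<zero>)"
  by (simp_all add: trivial_distance_module_def)

lemma module_fib_triv: "module K (fib triv y g)"
proof -
  have ag: "abelian_group (fib triv y g)"
  proof (rule abelian_groupI)
    fix a assume a: "a \<in> carrier (fib triv y g)"
    then show "\<exists>b\<in>carrier (fib triv y g). b \<oplus>\<^bsub>fib triv y g\<^esub> a = \<zero>\<^bsub>fib triv y g\<^esub>"
      by (intro bexI[of _ "\<ominus> a"]) (auto simp: l_neg split: if_splits)
  qed (auto simp: a_ac split: if_splits)
  show ?thesis
    by (rule moduleI[OF is_cring ag]) (auto simp: l_distr r_distr m_assoc split: if_splits)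
qed

lemma graded_triv: "graded_distance_module K X d G triv"
proof -
  have zero: "0 \<in> G"
    using subgroup.one_closed[OF subgroup_G] by (simp add: real_add_group_def)
  have "is_distance_module K X d triv"
  proof (rule is_distance_moduleI)
    show "act triv x y g \<in> linear_maps K (fib triv x g) (fib triv y (g + rdist d x y))"
      if "x \<in> X" "y \<in> X" "d x y < \<infinity>" for x y g
      using that by (intro linear_mapsI) (auto split: if_splits)
    show "act triv y z (g + rdist d x y) (act triv x y g m) = (if between d x y z then act triv x z g m
         else \<zero>\<^bsub>fib triv z (g + rdist d x y + rdist d y z)\<^esub>)"
      if "x \<in> X" "y \<in> X" "z \<in> X" for x y z g m
      \<comment> \<open>The critical case is \<open>x = z\<close> different from \<open>y\<close>:
        the composite is zero although \<open>act triv x z\<close> is the identity, and betweenness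
        does fail there.\<close>
      using that between_imp_eq[of x y] by auto
  qed (simp_all add: module_fib_triv)
  with zero show ?thesis
    by (auto simp: graded_distance_module_def)
qed

lemma bar_aug_linear: "bar_aug y g \<in> linear_maps K (bmod 0 y g) (fib triv y g)"
  by (rule linear_mapsI) (auto simp: bar_aug_def free_carrierD(1))

lemma bar_aug_hom: "dm_fun X (bar 0) bar_aug \<in> dm_hom K X d (bar 0) triv"
proof (rule dm_fun_hom[OF bar_module])
  show "bar_aug y g \<in> linear_maps K (fib (bar 0) y g) (fib triv y g)" for y g
    by (simp add: bar_aug_linear)
  show "act triv y z g (bar_aug y g f) = bar_aug z (g + rdist d y z) (act (bar 0) y z g f)"
    if "y \<in> X" "z \<in> X" "d y z < \<infinity>" "f \<in> carrier (fib (bar 0) y g)" for y z g f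
  proof (cases "y = z")
    case True
    then show ?thesis
      using that dm_act_self[OF bar_module that(1,4)] by simp
  next
    case False
    \<comment> \<open>After the action the augmentation reads the coefficient of \<open>[z]\<close>,
      which is kept only if \<open>y\<close> is between \<open>z\<close> and
      \<open>z\<close>.\<close>
    then have "\<not> between d z y z"
      using between_imp_eq[of z y] that by auto
    with False show ?thesis by (simp add: bar_aug_def act_bar)
  qed
qed

lemma singleton_bar_chains: "y \<in> X \<Longrightarrow> [y] \<in> bar_chains X d 0 y 0"
  by (intro bar_chainsI) (auto simp: nondeg_def)

lemma bar_aug_surj: "dm_surj X (bar 0) triv (dm_fun X (bar 0) bar_aug)"
  unfolding dm_surj_def
proof (intro ballI allI equalityI subsetI)
  fix y g k assume y: "y \<in> X" and k: "k \<in> carrier (fib triv y g)"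
  show "k \<in> dm_fun X (bar 0) bar_aug y g ` carrier (fib (bar 0) y g)"
  proof (cases "g = 0")
    case True
    have f: "(\<lambda>c. k \<otimes> delta K [y] c) \<in> free_carrier K (bar_chains X d 0 y g)"
      using k True free_carrier_smult[OF _ free_carrier_delta[OF singleton_bar_chains[OF y]]] by simp
    moreover have "dm_fun X (bar 0) bar_aug y g (\<lambda>c. k \<otimes> delta K [y] c) = k"
      using y f k True by (simp add: bar_aug_def delta_def)
    ultimately show ?thesis by (metis fib_bar free_mod_simps(1) image_eqI)
  next
    case False
    have z: "(\<lambda>_. \<zero>) \<in> free_carrier K (bar_chains X d 0 y g)"
      by (rule free_carrier_zero)
    then have "dm_fun X (bar 0) bar_aug y g (\<lambda>_. \<zero>) = k"
      using y k False by (simp add: bar_aug_def)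
    with z show ?thesis by (metis fib_bar free_mod_simps(1) image_eqI)
  qed
qed (use dm_hom_closed[OF bar_aug_hom] in blast)

lemma bar_bd_0:
  assumes xs: "xs \<in> bar_chains X d (Suc 0) y g"
  shows "bar_bd 0 y g xs = sg 1 \<odot>\<^bsub>bmod 0 y g\<^esub> bar_face y 1 xs"
proof -
  interpret B: module K "bmod 0 y g" by (rule module_free_mod)
  have "sg 1 \<odot>\<^bsub>bmod 0 y g\<^esub> bar_face y 1 xs \<in> carrier (bmod 0 y g)"
    using bar_face_closed[OF xs, of 1] by (intro B.smult_closed) simp_all
  then show ?thesis
    using B.M.finsum_insert[of "{}" 1 "\<lambda>i. sg i \<odot>\<^bsub>bmod 0 y g\<^esub> bar_face y i xs"] B.M.finsum_empty B.M.r_zero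
    unfolding bar_bd_def by (simp del: free_mod_simps)
qed

lemma bar_aug_diff:
  assumes y: "y \<in> X" and f: "f \<in> free_carrier K (bar_chains X d (Suc 0) y g)"
  shows "bar_aug y g (bar_diff 0 y g f) = \<zero>"
proof -
  have l: "(\<lambda>f. bar_aug y g (bar_diff 0 y g f)) \<in> linear_maps K (bmod (Suc 0) y g) (fib triv y g)"
    by (rule linear_maps_comp[OF bar_diff_linear bar_aug_linear])
  have r: "(\<lambda>f. \<zero>\<^bsub>fib triv y g\<^esub>) \<in> linear_maps K (bmod (Suc 0) y g) (fib triv y g)"
    by (rule linear_maps_zero_map[OF module_fib_triv])
  have "bar_aug y g (bar_diff 0 y g (delta K xs)) = \<zero>\<^bsub>fib triv y g\<^esub>"
    if xs: "xs \<in> bar_chains X d (Suc 0) y g" for xs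
  proof -
    note xs' = bar_chainsD[OF xs]
    obtain a b where ab: "xs = [a, b]"
      using xs'(1) by (metis (no_types, opaque_lifting) Suc_length_conv length_0_conv)
    have "a \<noteq> b" using xs'(5) by (simp add: nondeg_def ab)
    \<comment> \<open>Face 1 of \<open>[a, b]\<close> leaves \<open>[a]\<close>, which the
      augmentation sees only for \<open>a = y\<close>; but then \<open>b\<close> would have to be
      between \<open>a\<close> and \<open>a\<close>.\<close>
    then have "\<not> between d a b a"
      using between_imp_eq[of a b] xs'(3) ab by auto
    then have "bar_aug y g (bar_face y 1 xs) = \<zero>"
      by (auto simp: bar_aug_def bar_face_def delta_def ab omit_nth_def)
    moreover have "bar_aug y g (sg 1 \<odot>\<^bsub>bmod 0 y g\<^esub> bar_face y 1 xs) =
        sg 1 \<odot>\<^bsub>fib triv y g\<^esub> bar_aug y g (bar_face y 1 xs)"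
      using bar_face_closed[OF xs, of 1] by (intro linear_maps_smult[OF bar_aug_linear]) simp_all
    ultimately show ?thesis
      by (simp add: bar_diff_delta[OF xs] bar_bd_0[OF xs] del: free_mod_simps)
  qed
  then show ?thesis
    using linear_maps_free_eqI[OF module_fib_triv l r _ f] by simp
qed

text \<open>Here the section of the augmentation that sends 1 to \<open>[y]\<close> enters. The
  identity stands on the left with a plus sign because the cone \<open>[x, y]\<close> loses
  \<open>y\<close> through face 1, whose sign is -1.\<close>

lemma bar_homotopy_0:
  assumes y: "y \<in> X" and f: "f \<in> free_carrier K (bar_chains X d 0 y g)"
  shows "bar_diff 0 y g (bar_cone 0 y g f) \<oplus>\<^bsub>bmod 0 y g\<^esub> f = (\<lambda>c. bar_aug y g f \<otimes> delta K [y] c)"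
proof -
  have l: "(\<lambda>f. bar_diff 0 y g (bar_cone 0 y g f) \<oplus>\<^bsub>bmod 0 y g\<^esub> f) \<in> linear_maps K (bmod 0 y g) (bmod 0 y g)"
    by (intro linear_maps_add_map linear_maps_comp[OF bar_cone_linear[OF y] bar_diff_linear]
      linear_maps_id module_free_mod)
  have r: "(\<lambda>f c. bar_aug y g f \<otimes> delta K [y] c) \<in> linear_maps K (bmod 0 y g) (bmod 0 y g)"
  proof (rule linear_mapsI)
    fix f assume "f \<in> carrier (bmod 0 y g)"
    then have "bar_aug y g f \<in> carrier K" "g \<noteq> 0 \<Longrightarrow> bar_aug y g f = \<zero>"
      by (auto simp: bar_aug_def free_carrierD(1))
    moreover have "(\<lambda>c. \<zero> \<otimes> delta K [y] c) = (\<lambda>_. \<zero>)"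
      by (auto simp: delta_def)
    ultimately show "(\<lambda>c. bar_aug y g f \<otimes> delta K [y] c) \<in> carrier (bmod 0 y g)"
      using free_carrier_smult[OF _ free_carrier_delta[OF singleton_bar_chains[OF y]]] free_carrier_zero
      by (cases "g = 0") auto
  qed (auto simp: bar_aug_def delta_def fun_eq_iff free_carrierD(1))
  have "bar_diff 0 y g (bar_cone 0 y g (delta K xs)) \<oplus>\<^bsub>bmod 0 y g\<^esub> delta K xs =
      (\<lambda>c. bar_aug y g (delta K xs) \<otimes> delta K [y] c)" if xs: "xs \<in> bar_chains X d 0 y g" for xs
  proof -
    note xs' = bar_chainsD[OF xs]
    obtain x where x: "xs = [x]"
      using xs'(1) by (metis (no_types, opaque_lifting) Suc_length_conv length_0_conv)
    show ?thesis
    proof (cases "x = y")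
      case True
      have "g = 0" using xs'(9) x True y by simp
      moreover have cone: "bar_cone 0 y g (delta K xs) = (\<lambda>_. \<zero>)"
        using True x bar_cone_delta[OF y xs] by simp
      moreover have diff: "bar_diff 0 y g (\<lambda>_. \<zero>) = (\<lambda>_. \<zero>)"
        using linear_maps_zero[OF bar_diff_linear module_free_mod module_free_mod, of 0 y g] by simp
      ultimately show ?thesis
        using True x unfolding cone diff by (auto simp: bar_aug_def delta_def fun_eq_iff)
    next
      case False
      have xsy: "[x, y] \<in> bar_chains X d (Suc 0) y g"
        using bar_chains_snoc[OF xs y] x False by simp
      have "bar_face y 1 [x, y] = delta K [x]"
        using xs'(4) y x by (simp add: bar_face_def omit_nth_def)
      then have "bar_diff 0 y g (bar_cone 0 y g (delta K xs)) = (\<lambda>c. \<ominus> \<one> \<otimes> delta K [x] c)"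
        using False x bar_cone_delta[OF y xs] bar_diff_delta[OF xsy] bar_bd_0[OF xsy] by (simp add: sg_def)
      then show ?thesis
        using False x by (auto simp: bar_aug_def delta_def fun_eq_iff l_neg)
    qed
  qed
  then show ?thesis
    using linear_maps_free_eqI[OF module_free_mod l r _ f] by simp
qed

text \<open>It suffices to look at cones, since every generator of \<open>bar (Suc (Suc n))\<close> is a cone.\<close>

lemma bar_diff_diff_from_cones:
  assumes cone: "\<And>y g ws. \<lbrakk>y \<in> X; ws \<in> bar_chains X d (Suc n) y g\<rbrakk> \<Longrightarrow>
      bar_diff n y g (bar_diff (Suc n) y g (bar_cone (Suc n) y g (delta K ws))) = (\<lambda>_. \<zero>)"
    and y: "y \<in> X" and f: "f \<in> free_carrier K (bar_chains X d (Suc (Suc n)) y g)"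
  shows "bar_diff n y g (bar_diff (Suc n) y g f) = (\<lambda>_. \<zero>)"
proof -
  let ?D = "\<lambda>n. dm_fun X (bar (Suc n)) (bar_diff n)"
  let ?DD = "dm_comp X (bar (Suc (Suc n))) (?D n) (?D (Suc n))"
  let ?Z = "dm_fun X (bar (Suc (Suc n))) (\<lambda>y g f. \<zero>\<^bsub>fib (bar n) y g\<^esub>)"
  have closed: "bar_diff m y g u \<in> free_carrier K (bar_chains X d m y g)"
    if "u \<in> free_carrier K (bar_chains X d (Suc m) y g)" for m y g u
    using linear_maps_closed[OF bar_diff_linear, of u m y g] that by simp
  have "?DD = ?Z"
  proof (rule bar_hom_eqI[OF bar_module dm_comp_hom[OF bar_module bar_diff_hom bar_diff_hom]
        dm_zero_hom[OF bar_module bar_module]])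
    fix xs assume xs: "xs \<in> bar_gens (Suc (Suc n))"
    let ?y = "last xs" and ?ws = "butlast xs"
    have len: "length xs = Suc (Suc (Suc n))" "set xs \<subseteq> X" "nondeg xs" "chain_length d xs < \<infinity>"
      using xs by (auto simp: bar_gens_def)
    have xs_eq: "?ws @ [?y] = xs"
      using len(1) by (intro append_butlast_last_id) auto
    have ws: "?ws \<in> bar_chains X d (Suc n) ?y (clen d xs)"
      using len nondeg_butlast[OF len(3)] by (auto simp: bar_chains_def xs_eq dest: in_set_butlastD)
    \<comment> \<open>Nondegeneracy of \<open>xs\<close> says that \<open>butlast xs\<close> does
      not end in \<open>last xs\<close>, so this cone is not zero and gives back
      \<open>xs\<close>.\<close>
    have "delta K xs = bar_cone (Suc n) ?y (clen d xs) (delta K ?ws)"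
      using bar_cone_delta[OF bar_gensD(2)[OF xs] ws] nondeg_butlast_last_neq[OF len(3,1)] xs_eq by simp
    then show "?DD ?y (clen d xs) (delta K xs) = ?Z ?y (clen d xs) (delta K xs)"
      using cone[OF bar_gensD(2)[OF xs] ws] bar_gensD(2)[OF xs] closed
        free_carrier_delta[OF bar_gensD(1)[OF xs]] by simp
  qed
  then have "?DD y g f = ?Z y g f" by simp
  then show ?thesis using y f closed by simp
qed

text \<open>On a cone the homotopy identity gives \<open>D D h = (D h) D + s D\<close>, and applied
  again \<open>h D D + (s' + s) D\<close> with opposite signs \<open>s'\<close> and
  \<open>s\<close>; the first term vanishes by induction. At the bottom \<open>D h + id\<close>
  factors through the augmentation, which kills \<open>D\<close>.\<close>

lemma bar_diff_diff:
  assumes "y \<in> X" "f \<in> free_carrier K (bar_chains X d (Suc (Suc n)) y g)"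
  shows "bar_diff n y g (bar_diff (Suc n) y g f) = (\<lambda>_. \<zero>)"
  using assms
proof (induction n arbitrary: y g f)
  case 0
  show ?case
  proof (rule bar_diff_diff_from_cones[OF _ 0])
    fix y g ws assume y: "y \<in> X" and ws: "ws \<in> bar_chains X d (Suc 0) y g"
    let ?B = "bmod 0 y g" and ?u = "bar_diff 0 y g (delta K ws)"
    have dw: "delta K ws \<in> free_carrier K (bar_chains X d (Suc 0) y g)"
      by (rule free_carrier_delta[OF ws])
    have u: "?u \<in> free_carrier K (bar_chains X d 0 y g)"
      using linear_maps_closed[OF bar_diff_linear, of "delta K ws"] dw by simp
    have cu: "bar_cone 0 y g ?u \<in> carrier (bmod (Suc 0) y g)"
      using linear_maps_closed[OF bar_cone_linear[OF y]] u by simp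
    have "bar_diff (Suc 0) y g (bar_cone (Suc 0) y g (delta K ws)) =
        bar_cone 0 y g ?u \<oplus>\<^bsub>bmod (Suc 0) y g\<^esub> delta K ws"
      using free_carrierD(1)[OF dw] unfolding bar_homotopy[OF y dw] by (simp add: sg_def)
    then have "bar_diff 0 y g (bar_diff (Suc 0) y g (bar_cone (Suc 0) y g (delta K ws))) =
        bar_diff 0 y g (bar_cone 0 y g ?u) \<oplus>\<^bsub>?B\<^esub> ?u"
      using linear_maps_add[OF bar_diff_linear cu, of "delta K ws"] dw by simp
    also have "\<dots> = (\<lambda>_. \<zero>)"
      unfolding bar_homotopy_0[OF y u] bar_aug_diff[OF y dw] by (auto simp: delta_def)
    finally show "bar_diff 0 y g (bar_diff (Suc 0) y g (bar_cone (Suc 0) y g (delta K ws))) = (\<lambda>_. \<zero>)" .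
  qed
next
  case (Suc n)
  show ?case
  proof (rule bar_diff_diff_from_cones[OF _ Suc.prems])
    fix y g ws assume y: "y \<in> X" and ws: "ws \<in> bar_chains X d (Suc (Suc n)) y g"
    let ?B = "bmod (Suc n) y g" and ?u = "bar_diff (Suc n) y g (delta K ws)"
    let ?s = "sg (Suc (Suc (Suc n)))"
    have dw: "delta K ws \<in> free_carrier K (bar_chains X d (Suc (Suc n)) y g)"
      by (rule free_carrier_delta[OF ws])
    have u: "?u \<in> free_carrier K (bar_chains X d (Suc n) y g)"
      using linear_maps_closed[OF bar_diff_linear, of "delta K ws"] dw by simp
    have cu: "bar_cone (Suc n) y g ?u \<in> carrier (bmod (Suc (Suc n)) y g)"
      using linear_maps_closed[OF bar_cone_linear[OF y]] u by simp
    have sw: "?s \<odot>\<^bsub>bmod (Suc (Suc n)) y g\<^esub> delta K ws \<in> carrier (bmod (Suc (Suc n)) y g)"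
      using free_carrier_smult[OF sg_closed dw] by simp
    have "bar_diff (Suc n) y g (bar_diff (Suc (Suc n)) y g (bar_cone (Suc (Suc n)) y g (delta K ws))) =
        bar_diff (Suc n) y g (bar_cone (Suc n) y g ?u) \<oplus>\<^bsub>?B\<^esub>
        bar_diff (Suc n) y g (?s \<odot>\<^bsub>bmod (Suc (Suc n)) y g\<^esub> delta K ws)"
      unfolding bar_homotopy[OF y dw] by (rule linear_maps_add[OF bar_diff_linear cu sw])
    also have "bar_diff (Suc n) y g (?s \<odot>\<^bsub>bmod (Suc (Suc n)) y g\<^esub> delta K ws) = ?s \<odot>\<^bsub>?B\<^esub> ?u"
      using dw by (intro linear_maps_smult[OF bar_diff_linear]) simp_all
    also have "bar_diff (Suc n) y g (bar_cone (Suc n) y g ?u) =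
        bar_cone n y g (bar_diff n y g ?u) \<oplus>\<^bsub>?B\<^esub> sg (Suc (Suc n)) \<odot>\<^bsub>?B\<^esub> ?u"
      by (rule bar_homotopy[OF y u])
    also have "bar_diff n y g ?u = (\<lambda>_. \<zero>)"
      by (rule Suc.IH[OF y dw])
    also have "bar_cone n y g (\<lambda>_. \<zero>) = (\<lambda>_. \<zero>)"
      using linear_maps_zero[OF bar_cone_linear[OF y] module_free_mod module_free_mod, of n g] by simp
    also have "((\<lambda>_. \<zero>) \<oplus>\<^bsub>?B\<^esub> sg (Suc (Suc n)) \<odot>\<^bsub>?B\<^esub> ?u) \<oplus>\<^bsub>?B\<^esub> ?s \<odot>\<^bsub>?B\<^esub> ?u = (\<lambda>_. \<zero>)"
      using free_carrierD(1)[OF u] by (simp add: sg_Suc l_minus l_neg r_neg)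
    finally show "bar_diff (Suc n) y g (bar_diff (Suc (Suc n)) y g
        (bar_cone (Suc (Suc n)) y g (delta K ws))) = (\<lambda>_. \<zero>)" .
  qed
qed

section \<open>Exactness of the bar complex\<close>

lemma bar_exact:
  "dm_exact X (bar (Suc (Suc n))) (bar (Suc n)) (bar n)
     (dm_fun X (bar (Suc (Suc n))) (bar_diff (Suc n))) (dm_fun X (bar (Suc n)) (bar_diff n))"
  unfolding dm_exact_def
proof (intro ballI allI equalityI subsetI)
  fix y g f assume y: "y \<in> X"
    and "f \<in> dm_fun X (bar (Suc (Suc n))) (bar_diff (Suc n)) y g ` carrier (fib (bar (Suc (Suc n))) y g)"
  then obtain u where u: "u \<in> free_carrier K (bar_chains X d (Suc (Suc n)) y g)"
    and f: "f = bar_diff (Suc n) y g u"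
    by auto
  have "f \<in> free_carrier K (bar_chains X d (Suc n) y g)"
    unfolding f using linear_maps_closed[OF bar_diff_linear, of u] u by simp
  then show "f \<in> {m \<in> carrier (fib (bar (Suc n)) y g).
      dm_fun X (bar (Suc n)) (bar_diff n) y g m = \<zero>\<^bsub>fib (bar n) y g\<^esub>}"
    using y bar_diff_diff[OF y u] by (simp add: f)
next
  fix y g f assume y: "y \<in> X" and "f \<in> {m \<in> carrier (fib (bar (Suc n)) y g).
      dm_fun X (bar (Suc n)) (bar_diff n) y g m = \<zero>\<^bsub>fib (bar n) y g\<^esub>}"
  then have f: "f \<in> free_carrier K (bar_chains X d (Suc n) y g)" and z: "bar_diff n y g f = (\<lambda>_. \<zero>)"
    by auto
  \<comment> \<open>On a cycle the homotopy identity reads \<open>D h f = s f\<close> with a sign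
    \<open>s\<close>, so \<open>s\<close> times the cone of \<open>f\<close> is a preimage.\<close>
  let ?s = "sg (Suc (Suc n))" and ?u = "bar_cone (Suc n) y g f"
  have u: "?u \<in> free_carrier K (bar_chains X d (Suc (Suc n)) y g)"
    using linear_maps_closed[OF bar_cone_linear[OF y], of f] f by simp
  have su: "?s \<odot>\<^bsub>bmod (Suc (Suc n)) y g\<^esub> ?u \<in> free_carrier K (bar_chains X d (Suc (Suc n)) y g)"
    using free_carrier_smult[OF sg_closed u] by simp
  have "bar_cone n y g (\<lambda>_. \<zero>) = (\<lambda>_. \<zero>)"
    using linear_maps_zero[OF bar_cone_linear[OF y] module_free_mod module_free_mod, of n g] by simp
  then have "bar_diff (Suc n) y g ?u = ?s \<odot>\<^bsub>bmod (Suc n) y g\<^esub> f"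
    using free_carrierD(1)[OF f] by (simp add: bar_homotopy[OF y f] z)
  then have "bar_diff (Suc n) y g (?s \<odot>\<^bsub>bmod (Suc (Suc n)) y g\<^esub> ?u) = f"
    using linear_maps_smult[OF bar_diff_linear sg_closed, of ?u] u free_carrierD(1)[OF f]
    by (simp add: m_assoc[symmetric])
  with su y show "f \<in> dm_fun X (bar (Suc (Suc n))) (bar_diff (Suc n)) y g ` carrier (fib (bar (Suc (Suc n))) y g)"
    by (intro image_eqI[of _ _ "?s \<odot>\<^bsub>bmod (Suc (Suc n)) y g\<^esub> ?u"]) (simp_all del: free_mod_simps(4))
qed

lemma bar_exact_0:
  "dm_exact X (bar (Suc 0)) (bar 0) triv (dm_fun X (bar (Suc 0)) (bar_diff 0)) (dm_fun X (bar 0) bar_aug)"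
  unfolding dm_exact_def
proof (intro ballI allI equalityI subsetI)
  fix y g f assume y: "y \<in> X"
    and "f \<in> dm_fun X (bar (Suc 0)) (bar_diff 0) y g ` carrier (fib (bar (Suc 0)) y g)"
  then obtain u where u: "u \<in> free_carrier K (bar_chains X d (Suc 0) y g)" and f: "f = bar_diff 0 y g u"
    by auto
  have "f \<in> free_carrier K (bar_chains X d 0 y g)"
    unfolding f using linear_maps_closed[OF bar_diff_linear, of u] u by simp
  then show "f \<in> {m \<in> carrier (fib (bar 0) y g). dm_fun X (bar 0) bar_aug y g m = \<zero>\<^bsub>fib triv y g\<^esub>}"
    using y bar_aug_diff[OF y u] by (simp add: f)
next
  fix y g f assume y: "y \<in> X"
    and "f \<in> {m \<in> carrier (fib (bar 0) y g). dm_fun X (bar 0) bar_aug y g m = \<zero>\<^bsub>fib triv y g\<^esub>}"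
  then have f: "f \<in> free_carrier K (bar_chains X d 0 y g)" and z: "bar_aug y g f = \<zero>"
    by auto
  \<comment> \<open>With zero augmentation the bottom identity becomes \<open>D h f = - f\<close>,
    so the preimage is minus the cone.\<close>
  let ?u = "bar_cone 0 y g f"
  have u: "?u \<in> free_carrier K (bar_chains X d (Suc 0) y g)"
    using linear_maps_closed[OF bar_cone_linear[OF y], of f] f by simp
  have su: "\<ominus> \<one> \<odot>\<^bsub>bmod (Suc 0) y g\<^esub> ?u \<in> free_carrier K (bar_chains X d (Suc 0) y g)"
    using free_carrier_smult[OF _ u, of "\<ominus> \<one>"] by simp
  have Du: "bar_diff 0 y g ?u c \<in> carrier K" for c
    using linear_maps_closed[OF bar_diff_linear, of ?u] u free_carrierD(1) by fastforce
  have "bar_diff 0 y g ?u c \<oplus> f c = \<zero>" for c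
    using fun_cong[OF bar_homotopy_0[OF y f], of c] by (simp add: z delta_def split: if_splits)
  then have "f c = \<ominus> (bar_diff 0 y g ?u c)" for c
    using Du free_carrierD(1)[OF f] by (metis a_comm minus_equality)
  then have "bar_diff 0 y g (\<ominus> \<one> \<odot>\<^bsub>bmod (Suc 0) y g\<^esub> ?u) = f"
    using linear_maps_smult[OF bar_diff_linear, of "\<ominus> \<one>" ?u 0 y g] u Du
    by (simp add: fun_eq_iff l_minus)
  with su y show "f \<in> dm_fun X (bar (Suc 0)) (bar_diff 0) y g ` carrier (fib (bar (Suc 0)) y g)"
    by (intro image_eqI[of _ _ "\<ominus> \<one> \<odot>\<^bsub>bmod (Suc 0) y g\<^esub> ?u"]) (simp_all del: free_mod_simps(4))
qed

end

section \<open>Encoding the bar resolution\<close>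

text \<open>Every bar fibre consists of finitely supported functions on lists, so one pair
  \<open>e\<close>, \<open>v\<close> serves all degrees and all base points.\<close>

locale encoded_bar = graded_quasimetric K X d G
  for K :: "('k, 'z) ring_scheme" (structure) and X :: "'x set" and d G +
  fixes e :: "('x list \<Rightarrow> 'k) \<Rightarrow> 'p" and v :: "'p \<Rightarrow> 'x list \<Rightarrow> 'k"
  assumes decode: "f \<in> free_carrier K UNIV \<Longrightarrow> v (e f) = f"
begin

lemma decode_free [simp]: "f \<in> free_carrier K S \<Longrightarrow> v (e f) = f"
  using decode free_carrier_mono[of S UNIV K] by blast

lemma decode_bar: "m \<in> carrier (fib (bar n) x g) \<Longrightarrow> v (e m) = m"
  by simp

definition ebar :: "nat \<Rightarrow> ('x, 'k, 'p) distance_module" where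
  "ebar n = dm_copy e v (bar n)"

definition enc :: "nat \<Rightarrow> 'x \<Rightarrow> real \<Rightarrow> ('x list \<Rightarrow> 'k) \<Rightarrow> 'p" where
  "enc n = dm_fun X (bar n) (\<lambda>x g. e)"

definition dec :: "nat \<Rightarrow> 'x \<Rightarrow> real \<Rightarrow> 'p \<Rightarrow> 'x list \<Rightarrow> 'k" where
  "dec n = dm_fun X (ebar n) (\<lambda>x g. v)"

definition ebar_diff :: "nat \<Rightarrow> 'x \<Rightarrow> real \<Rightarrow> 'p \<Rightarrow> 'p" where
  "ebar_diff n = dm_comp X (ebar (Suc n)) (enc n)
     (dm_comp X (ebar (Suc n)) (dm_fun X (bar (Suc n)) (bar_diff n)) (dec (Suc n)))"

definition ebar_aug :: "'x \<Rightarrow> real \<Rightarrow> 'p \<Rightarrow> 'k" where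
  "ebar_aug = dm_comp X (ebar 0) (dm_fun X (bar 0) bar_aug) (dec 0)"

lemma carrier_ebar [simp]: "carrier (fib (ebar n) y g) = e ` free_carrier K (bar_chains X d n y g)"
  by (simp add: ebar_def)

lemma zero_ebar [simp]: "\<zero>\<^bsub>fib (ebar n) y g\<^esub> = e (\<lambda>_. \<zero>)"
  by (simp add: ebar_def)

lemma graded_ebar: "graded_distance_module K X d G (ebar n)"
  unfolding ebar_def by (rule graded_distance_module_dm_copy[where e = e and v = v, OF graded_bar decode_bar])

lemmas ebar_module = graded_imp_distance_module[OF graded_ebar]

lemma enc_hom: "enc n \<in> dm_hom K X d (bar n) (ebar n)"
  unfolding enc_def ebar_def by (rule dm_copy_encode[where e = e and v = v, OF bar_module decode_bar])

lemma dec_hom: "dec n \<in> dm_hom K X d (ebar n) (bar n)"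
  unfolding dec_def ebar_def by (rule dm_copy_decode[where e = e and v = v, OF bar_module decode_bar])

lemma enc_apply [simp]:
  "\<lbrakk>y \<in> X; f \<in> free_carrier K (bar_chains X d n y g)\<rbrakk> \<Longrightarrow> enc n y g f = e f"
  by (simp add: enc_def)

lemma dec_apply [simp]:
  "\<lbrakk>y \<in> X; f \<in> free_carrier K (bar_chains X d n y g)\<rbrakk> \<Longrightarrow> dec n y g (e f) = f"
  by (simp add: dec_def)

lemma ebar_diff_hom: "ebar_diff n \<in> dm_hom K X d (ebar (Suc n)) (ebar n)"
  unfolding ebar_diff_def
  by (rule dm_comp_hom[OF ebar_module dm_comp_hom[OF ebar_module dec_hom bar_diff_hom] enc_hom])

lemma ebar_aug_hom: "ebar_aug \<in> dm_hom K X d (ebar 0) triv"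
  unfolding ebar_aug_def by (rule dm_comp_hom[OF ebar_module dec_hom bar_aug_hom])

lemma bar_diff_closed:
  "f \<in> free_carrier K (bar_chains X d (Suc n) y g) \<Longrightarrow> bar_diff n y g f \<in> free_carrier K (bar_chains X d n y g)"
  using linear_maps_closed[OF bar_diff_linear, of f n y g] by simp

lemma ebar_diff_apply [simp]:
  "\<lbrakk>y \<in> X; f \<in> free_carrier K (bar_chains X d (Suc n) y g)\<rbrakk> \<Longrightarrow> ebar_diff n y g (e f) = e (bar_diff n y g f)"
  by (simp add: ebar_diff_def bar_diff_closed)

lemma ebar_aug_apply [simp]:
  "\<lbrakk>y \<in> X; f \<in> free_carrier K (bar_chains X d 0 y g)\<rbrakk> \<Longrightarrow> ebar_aug y g (e f) = bar_aug y g f"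
  by (simp add: ebar_aug_def)

lemma encode_eq_iff:
  "\<lbrakk>f \<in> free_carrier K S; f' \<in> free_carrier K T\<rbrakk> \<Longrightarrow> e f = e f' \<longleftrightarrow> f = f'"
  by (metis decode_free)

lemma ebar_hom_eqI:
  assumes N: "is_distance_module K X d N"
    and \<phi>: "\<phi> \<in> dm_hom K X d (ebar n) N" and \<psi>: "\<psi> \<in> dm_hom K X d (ebar n) N"
    and eq: "\<And>xs. xs \<in> bar_gens n \<Longrightarrow>
      \<phi> (last xs) (clen d xs) (e (delta K xs)) = \<psi> (last xs) (clen d xs) (e (delta K xs))"
  shows "\<phi> = \<psi>"
proof (rule dm_hom_eqI[OF \<phi> \<psi>])
  have "dm_comp X (bar n) \<phi> (enc n) = dm_comp X (bar n) \<psi> (enc n)"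
  proof (rule bar_hom_eqI[OF N dm_comp_hom[OF bar_module enc_hom \<phi>] dm_comp_hom[OF bar_module enc_hom \<psi>]])
    fix xs assume xs: "xs \<in> bar_gens n"
    then show "dm_comp X (bar n) \<phi> (enc n) (last xs) (clen d xs) (delta K xs) =
        dm_comp X (bar n) \<psi> (enc n) (last xs) (clen d xs) (delta K xs)"
      using eq[OF xs] bar_gensD(2)[OF xs] free_carrier_delta[OF bar_gensD(1)[OF xs]] by simp
  qed
  then have "dm_comp X (bar n) \<phi> (enc n) y g f = dm_comp X (bar n) \<psi> (enc n) y g f" for y g f
    by simp
  then have "\<phi> y g (e f) = \<psi> y g (e f)"
    if "y \<in> X" "f \<in> free_carrier K (bar_chains X d n y g)" for y g f
    using that by (metis dm_comp_apply enc_apply fib_bar free_mod_simps(1))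
  then show "\<phi> y g m = \<psi> y g m" if "y \<in> X" "m \<in> carrier (fib (ebar n) y g)" for y g m
    using that by auto
qed

text \<open>A free lift for \<open>bar n\<close> is made along the encoding and carried back by
  decoding. The test objects have their elements in \<open>'p\<close>, the element type of
  \<open>ebar n\<close>, as the definition of projectivity asks.\<close>

lemma ebar_projective: "dm_projective K X d G (ebar n)"
  unfolding dm_projective_def
proof (intro conjI allI impI)
  fix B C :: "('x, 'k, 'p) distance_module" and s f
  assume B: "graded_distance_module K X d G B" and C: "graded_distance_module K X d G C"
    and s: "s \<in> dm_hom K X d B C" and surj: "dm_surj X B C s" and f: "f \<in> dm_hom K X d (ebar n) C"
  obtain h where h: "h \<in> dm_hom K X d (bar n) B"
    and eq: "dm_comp X (bar n) s h = dm_comp X (bar n) f (enc n)"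
    using bar_lift[OF graded_imp_distance_module[OF B] graded_imp_distance_module[OF C] s surj
      dm_comp_hom[OF bar_module enc_hom f]] by blast
  have h': "dm_comp X (ebar n) h (dec n) \<in> dm_hom K X d (ebar n) B"
    by (rule dm_comp_hom[OF ebar_module dec_hom h])
  have "dm_comp X (ebar n) s (dm_comp X (ebar n) h (dec n)) = f"
  proof (rule dm_hom_eqI[OF dm_comp_hom[OF ebar_module h' s] f])
    fix y g m assume y: "y \<in> X" and m: "m \<in> carrier (fib (ebar n) y g)"
    then obtain u where u: "u \<in> free_carrier K (bar_chains X d n y g)" "m = e u" by auto
    have "dm_comp X (bar n) s h y g u = dm_comp X (bar n) f (enc n) y g u"
      by (simp add: eq)
    then show "dm_comp X (ebar n) s (dm_comp X (ebar n) h (dec n)) y g m = f y g m"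
      using y u by simp
  qed
  with h' show "\<exists>h\<in>dm_hom K X d (ebar n) B. dm_comp X (ebar n) s h = f" by blast
qed (rule graded_ebar)

lemma ebar_resolution: "projective_resolution K X d G triv ebar ebar_diff ebar_aug"
  unfolding projective_resolution_def
proof (intro conjI allI ebar_projective ebar_diff_hom ebar_aug_hom)
  have aug: "ebar_aug y g ` carrier (fib (ebar 0) y g) = bar_aug y g ` free_carrier K (bar_chains X d 0 y g)"
    if "y \<in> X" for y g
    using that by (auto simp: image_image intro!: image_cong)
  have aug': "dm_fun X (bar 0) bar_aug y g ` free_carrier K (bar_chains X d 0 y g) =
      bar_aug y g ` free_carrier K (bar_chains X d 0 y g)" if "y \<in> X" for y g
    using that by (intro image_cong) simp_all
  show "dm_surj X (ebar 0) triv ebar_aug"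
    using bar_aug_surj aug aug' by (simp add: dm_surj_def del: carrier_ebar)
  have diff: "ebar_diff n y g ` carrier (fib (ebar (Suc n)) y g) =
      e ` bar_diff n y g ` free_carrier K (bar_chains X d (Suc n) y g)" if "y \<in> X" for n y g
    using that by (auto simp: image_image intro!: image_cong)
  have diff': "dm_fun X (bar (Suc n)) (bar_diff n) y g ` free_carrier K (bar_chains X d (Suc n) y g) =
      bar_diff n y g ` free_carrier K (bar_chains X d (Suc n) y g)" if "y \<in> X" for n y g
    using that by (intro image_cong) simp_all
  \<comment> \<open>Kernels of the encoded maps are encoded kernels, so exactness can be read off
    before encoding.\<close>
  have ker: "{m \<in> carrier (fib (ebar n) y g). R m} = e ` {f \<in> free_carrier K (bar_chains X d n y g). R (e f)}"
    for n y g R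
    by auto
  show "dm_exact X (ebar (Suc 0)) (ebar 0) triv (ebar_diff 0) ebar_aug"
    unfolding dm_exact_def
  proof (intro ballI allI)
    fix y g assume y: "y \<in> X"
    have "bar_diff 0 y g ` free_carrier K (bar_chains X d (Suc 0) y g) =
        {f \<in> free_carrier K (bar_chains X d 0 y g). bar_aug y g f = \<zero>}"
      using bar_exact_0 y diff'[OF y, of 0 g] by (auto simp: dm_exact_def)
    also have "\<dots> = {f \<in> free_carrier K (bar_chains X d 0 y g). ebar_aug y g (e f) = \<zero>}"
      using y by auto
    finally show "ebar_diff 0 y g ` carrier (fib (ebar (Suc 0)) y g) =
        {m \<in> carrier (fib (ebar 0) y g). ebar_aug y g m = \<zero>\<^bsub>fib triv y g\<^esub>}"
      unfolding diff[OF y] ker by simp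
  qed
  fix n
  show "dm_exact X (ebar (Suc (Suc n))) (ebar (Suc n)) (ebar n) (ebar_diff (Suc n)) (ebar_diff n)"
    unfolding dm_exact_def
  proof (intro ballI allI)
    fix y g assume y: "y \<in> X"
    have "bar_diff (Suc n) y g ` free_carrier K (bar_chains X d (Suc (Suc n)) y g) =
        {f \<in> free_carrier K (bar_chains X d (Suc n) y g). bar_diff n y g f = (\<lambda>_. \<zero>)}"
      using bar_exact[of n] y diff'[OF y, of "Suc n" g] by (auto simp: dm_exact_def)
    \<comment> \<open>Injectivity of \<open>e\<close> on finitely supported functions turns
      vanishing of the differential into equality of codes.\<close>
    also have "\<dots> = {f \<in> free_carrier K (bar_chains X d (Suc n) y g). ebar_diff n y g (e f) = e (\<lambda>_. \<zero>)}"
      using y encode_eq_iff[OF bar_diff_closed free_carrier_zero, of _ n y g] by auto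
    finally show "ebar_diff (Suc n) y g ` carrier (fib (ebar (Suc (Suc n))) y g) =
        {m \<in> carrier (fib (ebar (Suc n)) y g). ebar_diff n y g m = \<zero>\<^bsub>fib (ebar n) y g\<^esub>}"
      unfolding diff[OF y] ker by simp
  qed
qed

end

section \<open>An injective encoding of finitely supported functions by lists\<close>

lemma flatten_inj:
  "concat (map (\<lambda>(c, k). map Inl c @ [Inr (Inr (Inl k))]) ps) =
   (concat (map (\<lambda>(c, k). map Inl c @ [Inr (Inr (Inl k))]) qs) :: ('x + 'r + 'k + 'a) list) \<Longrightarrow> ps = qs"
proof (induction ps arbitrary: qs)
  case Nil
  then show ?case by (cases qs) auto
next
  case (Cons p ps)
  \<comment> \<open>A block is a run of \<open>Inl\<close> entries closed by its coefficient, the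
    first entry that is not \<open>Inl\<close>; so the end of the first block can be
    located.\<close>
  have step: "c = c' \<and> k = k' \<and> r = r'"
    if "map Inl c @ Inr (Inr (Inl k)) # r = (map Inl c' @ Inr (Inr (Inl k')) # r' :: ('x + 'r + 'k + 'a) list)"
    for c c' k k' r r'
    using that
  proof (induction c arbitrary: c')
    case Nil
    then show ?case by (cases c') auto
  next
    case (Cons x c)
    then show ?case by (cases c') auto
  qed
  obtain c k where p: "p = (c, k)" by fastforce
  obtain q qs' where qs: "qs = q # qs'"
    using Cons.prems p by (cases qs) auto
  obtain c' k' where q: "q = (c', k')" by fastforce
  have "c = c' \<and> k = k' \<and> concat (map (\<lambda>(c, k). map Inl c @ [Inr (Inr (Inl k))]) ps) =
      (concat (map (\<lambda>(c, k). map Inl c @ [Inr (Inr (Inl k))]) qs') :: ('x + 'r + 'k + 'a) list)"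
    using Cons.prems by (intro step) (simp add: p qs q)
  then show ?case
    using Cons.IH[of qs'] by (simp add: p qs q)
qed

text \<open>A finitely supported function is determined by the finite set of its pairs of chain and
  nonzero coefficient. Any chosen enumeration of this set is flattened to one list, from which the
  set is recovered.\<close>

lemma ex_encoding:
  fixes K :: "('k, 'z) ring_scheme"
  obtains e :: "('x list \<Rightarrow> 'k) \<Rightarrow> ('x, 'k, 'a) resolution_elem"
  where "inj_on e (free_carrier K UNIV)"
proof -
  let ?flat = "\<lambda>ps. concat (map (\<lambda>(c, k). map Inl c @ [Inr (Inr (Inl k))]) ps) :: ('x, 'k, 'a) resolution_elem"
  let ?graph = "\<lambda>f :: 'x list \<Rightarrow> 'k. (\<lambda>c. (c, f c)) ` {c. f c \<noteq> \<zero>\<^bsub>K\<^esub>}"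
  have "\<exists>ps. set ps = ?graph f" if "f \<in> free_carrier K UNIV" for f
    using free_carrierD(3)[OF that] by (intro finite_list) simp
  then obtain L where L: "\<And>f. f \<in> free_carrier K UNIV \<Longrightarrow> set (L f) = ?graph f"
    by metis
  have "inj_on (\<lambda>f. ?flat (L f)) (free_carrier K UNIV)"
  proof (rule inj_onI)
    fix f f' assume f: "f \<in> free_carrier K UNIV" "f' \<in> free_carrier K UNIV" and eq: "?flat (L f) = ?flat (L f')"
    have "L f = L f'" by (rule flatten_inj[OF eq])
    then have g: "?graph f = ?graph f'"
      using L[OF f(1)] L[OF f(2)] by simp
    show "f = f'"
    proof (rule ext)
      fix c
      have "f c = f' c" if "f c \<noteq> \<zero>\<^bsub>K\<^esub>"
      proof -
        have "(c, f c) \<in> ?graph f" using that by blast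
        then show ?thesis unfolding g by auto
      qed
      moreover have "f c = f' c" if "f' c \<noteq> \<zero>\<^bsub>K\<^esub>"
      proof -
        have "(c, f' c) \<in> ?graph f'" using that by blast
        then show ?thesis unfolding g[symmetric] by auto
      qed
      ultimately show "f c = f' c" by metis
    qed
  qed
  then show thesis by (rule that)
qed

section \<open>Normalised magnitude cochains as morphisms out of the bar resolution\<close>

text \<open>Surjectivity one degree below finds preimages of the cochains that bound an image, and
  injectivity one degree above shows that preimages of cocycles are cocycles.\<close>

lemma cohomology_module_iso_chain_iso:
  assumes C: "\<And>i. module K (C i)" and \<delta>: "\<And>i. \<delta> i \<in> linear_maps K (C i) (C (Suc i))"
    and C': "\<And>i. module K (C' i)" and \<delta>': "\<And>i. \<delta>' i \<in> linear_maps K (C' i) (C' (Suc i))"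
    and f: "\<And>i. f i \<in> linear_maps K (C i) (C' i)"
    and bij: "\<And>i. bij_betw (f i) (carrier (C i)) (carrier (C' i))"
    and chain: "\<And>i u. u \<in> carrier (C i) \<Longrightarrow> f (Suc i) (\<delta> i u) = \<delta>' i (f i u)"
  shows "module_iso K (cohomology C \<delta> n) (cohomology C' \<delta>' n)"
proof (rule cohomology_module_iso[where C = C and \<delta> = \<delta> and C' = C' and \<delta>' = \<delta>' and f = "f n",
      OF C \<delta> C' \<delta>' f])
  have f0: "f i \<zero>\<^bsub>C i\<^esub> = \<zero>\<^bsub>C' i\<^esub>" for i
    by (rule linear_maps_zero[OF f C C'])
  have zero: "\<zero>\<^bsub>C i\<^esub> \<in> carrier (C i)" for i
    using C[of i] by (simp add: abelian_group_def abelian_monoid.zero_closed module_def)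
  have inj: "u = w" if "f i u = f i w" "u \<in> carrier (C i)" "w \<in> carrier (C i)" for i u w
    using that bij[of i] by (auto simp: bij_betw_def dest: inj_onD)
  note d\<delta> = linear_maps_closed[OF \<delta>] and fc = linear_maps_closed[OF f]
  show "f n z \<in> cocycles C' \<delta>' n" if "z \<in> cocycles C \<delta> n" for z
    using that by (auto simp: cocycles_def fc chain[symmetric] f0)
  show "f n z \<in> coboundaries C' \<delta>' n" if "z \<in> coboundaries C \<delta> n" for z
    using that by (cases n) (auto simp: coboundaries_def f0 chain fc)
  show "z \<in> coboundaries C \<delta> n" if z: "z \<in> cocycles C \<delta> n" and fz: "f n z \<in> coboundaries C' \<delta>' n" for z
  proof (cases n)
    case 0
    then have "f 0 z = f 0 \<zero>\<^bsub>C 0\<^esub>" "z \<in> carrier (C 0)"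
      using z fz by (auto simp: cocycles_def coboundaries_def f0)
    then show ?thesis
      using 0 inj[of 0 z] zero by (simp add: coboundaries_def)
  next
    case (Suc k)
    then obtain w where w: "w \<in> carrier (C' k)" "f n z = \<delta>' k w"
      using fz by (auto simp: coboundaries_def)
    then obtain u where u: "u \<in> carrier (C k)" "w = f k u"
      using bij[of k] by (auto simp: bij_betw_def)
    then have "f n z = f n (\<delta> k u)"
      using w Suc chain by simp
    then have "z = \<delta> k u"
      using z u d\<delta>[of u k] Suc by (intro inj[of n]) (auto simp: cocycles_def)
    then show ?thesis using u Suc by (auto simp: coboundaries_def)
  qed
  show "\<exists>z\<in>cocycles C \<delta> n. w \<ominus>\<^bsub>C' n\<^esub> f n z \<in> coboundaries C' \<delta>' n" if w: "w \<in> cocycles C' \<delta>' n" for w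
  proof -
    obtain z where z: "z \<in> carrier (C n)" "w = f n z"
      using w bij[of n] by (auto simp: cocycles_def bij_betw_def)
    then have "f (Suc n) (\<delta> n z) = f (Suc n) \<zero>\<^bsub>C (Suc n)\<^esub>"
      using w chain by (simp add: cocycles_def f0)
    then have "z \<in> cocycles C \<delta> n"
      using z(1) inj[of "Suc n" "\<delta> n z"] d\<delta>[OF z(1)] zero by (simp add: cocycles_def)
    moreover have "w \<ominus>\<^bsub>C' n\<^esub> f n z = \<zero>\<^bsub>C' n\<^esub>"
      using z fc[of z n] C'[of n]
      by (simp add: a_minus_def abelian_group.r_neg module_def)
    moreover have "\<zero>\<^bsub>C' n\<^esub> \<in> coboundaries C' \<delta>' n"
      using submodule.axioms(1)[OF submodule_coboundaries[where C = C' and \<delta> = \<delta>' and n = n, OF C' \<delta>']]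
      by (auto dest: subgroup.one_closed)
    ultimately show ?thesis by (intro bexI[of _ z]) simp_all
  qed
qed

lemma is_distance_module_shift:
  assumes M: "is_distance_module K X d M"
  shows "is_distance_module K X d (shift M l)"
proof (rule is_distance_moduleI)
  show "act (shift M l) x y g \<in> linear_maps K (fib (shift M l) x g) (fib (shift M l) y (g + rdist d x y))"
    if "x \<in> X" "y \<in> X" "d x y < \<infinity>" for x y g
    using dm_act[OF M that, of "g - l"] by (simp add: shift_def algebra_simps)
  show "act (shift M l) y z (g + rdist d x y) (act (shift M l) x y g m) =
      (if between d x y z then act (shift M l) x z g m
       else \<zero>\<^bsub>fib (shift M l) z (g + rdist d x y + rdist d y z)\<^esub>)"
    if "x \<in> X" "y \<in> X" "z \<in> X" "d x y < \<infinity>" "d y z < \<infinity>" "m \<in> carrier (fib (shift M l) x g)" for x y z m g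
  proof -
    \<comment> \<open>Degrees are rewritten so that the composition law of \<open>M\<close> at
      \<open>g - l\<close> applies literally.\<close>
    have eq: "g + rdist d x y - l = g - l + rdist d x y"
      "g + rdist d x y + rdist d y z - l = g - l + rdist d x y + rdist d y z" by simp_all
    show ?thesis
      using dm_act_act[OF M that(1-5), of m "g - l"] that(6)
      unfolding shift_def distance_module.simps eq .
  qed
qed (auto simp: shift_def dm_module[OF M] dm_act_self[OF M])

section \<open>Degenerate chains as repetitions\<close>

lemma chain_length_butlast:
  assumes "length xs = Suc (Suc n)"
  shows "chain_length d xs = chain_length d (butlast xs) + d (xs ! n) (xs ! Suc n)"
    and "last (butlast xs) = xs ! n" "last xs = xs ! Suc n"
proof -
  have ne: "butlast xs \<noteq> []" "xs \<noteq> []"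
    using assms by (auto simp: butlast_conv_take)
  have "chain_length d xs = chain_length d (butlast xs) + d (last (butlast xs)) (last xs)"
    using chain_length_snoc[OF ne(1), of d "last xs"] ne(2) by simp
  moreover show "last (butlast xs) = xs ! n" "last xs = xs ! Suc n"
    using ne assms by (simp_all add: last_conv_nth nth_butlast)
  ultimately show "chain_length d xs = chain_length d (butlast xs) + d (xs ! n) (xs ! Suc n)"
    by simp
qed

context graded_quasimetric
begin

lemma chain_length_repeat_nth:
  assumes "i < length xs" "set xs \<subseteq> X"
  shows "chain_length d (repeat_nth i xs) = chain_length d xs"
proof -
  have xs: "xs = take i xs @ xs ! i # drop (Suc i) xs"
    using assms(1) by (rule id_take_nth_drop)
  have rep: "repeat_nth i xs = take i xs @ xs ! i # xs ! i # drop (Suc i) xs"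
    using assms(1) by (simp add: repeat_nth_def take_Suc_conv_app_nth Cons_nth_drop_Suc)
  have "d (xs ! i) (xs ! i) = 0"
    using assms by (simp add: subset_iff)
  then have "chain_length d (repeat_nth i xs) =
      chain_length d (take i xs @ [xs ! i]) + chain_length d (xs ! i # drop (Suc i) xs)"
    unfolding rep by (subst chain_length_append) (simp add: chain_length_Cons)
  also have "\<dots> = chain_length d (take i xs @ xs ! i # drop (Suc i) xs)"
    by (rule chain_length_append[symmetric])
  finally show ?thesis
    using xs by simp
qed

lemma repeat_nth_finite_chains:
  assumes xs: "xs \<in> finite_chains X d n" and i: "i \<le> n"
  shows "repeat_nth i xs \<in> finite_chains X d (Suc n)" "\<not> nondeg (repeat_nth i xs)"
    "last (repeat_nth i xs) = last xs" "chain_length d (repeat_nth i xs) = chain_length d xs"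
proof -
  have len: "length xs = Suc n" "set xs \<subseteq> X" using xs by (auto simp: finite_chains_def)
  show cl: "chain_length d (repeat_nth i xs) = chain_length d xs"
    using chain_length_repeat_nth[of i xs] len i by simp
  have "set (repeat_nth i xs) \<subseteq> set xs"
    by (auto simp: repeat_nth_def dest: in_set_takeD in_set_dropD)
  then show "repeat_nth i xs \<in> finite_chains X d (Suc n)"
    using xs i cl by (auto simp: finite_chains_def repeat_nth_def)
  show "last (repeat_nth i xs) = last xs"
    using len i by (simp add: repeat_nth_def)
  have "repeat_nth i xs ! i = repeat_nth i xs ! Suc i" "Suc i < length (repeat_nth i xs)"
    using len i by (simp_all add: repeat_nth_def nth_append)
  then show "\<not> nondeg (repeat_nth i xs)" by (auto simp: nondeg_def)
qed

text \<open>Deleting one of two equal neighbours and repeating the other restores the chain. Hence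
  the codegeneracies, which evaluate at chains with a repetition, together detect the values at all
  degenerate chains.\<close>

lemma degenerate_repeat_nth:
  assumes xs: "xs \<in> finite_chains X d (Suc n)" and "\<not> nondeg xs"
  obtains i ws where "i \<le> n" "ws \<in> finite_chains X d n" "xs = repeat_nth i ws"
proof -
  have len: "length xs = Suc (Suc n)" "set xs \<subseteq> X" using xs by (auto simp: finite_chains_def)
  obtain i where i: "Suc i < length xs" "xs ! i = xs ! Suc i"
    using assms(2) by (auto simp: nondeg_def)
  let ?ws = "omit_nth i xs"
  have wl: "length ?ws = Suc n" using i len by (simp add: length_omit_nth)
  have eq: "xs = repeat_nth i ?ws"
  proof (rule nth_equalityI)
    show "length xs = length (repeat_nth i ?ws)"
      using wl i len by (simp add: repeat_nth_def)
    fix j assume j: "j < length xs"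
    show "xs ! j = repeat_nth i ?ws ! j"
    proof (cases "j \<le> i")
      case True
      then have "repeat_nth i ?ws ! j = ?ws ! j"
        using wl i len by (simp add: repeat_nth_def nth_append)
      then show ?thesis
        using True i len nth_omit_nth[of i xs j] by (cases "j = i") auto
    next
      case False
      then have "repeat_nth i ?ws ! j = ?ws ! (j - 1)"
        using wl i len j by (cases "i = n"; cases "j = Suc n") (auto simp: repeat_nth_def nth_append min_def)
      then show ?thesis
        using False i len j nth_omit_nth[of i xs "j - 1"] by auto
    qed
  qed
  have ws: "set ?ws \<subseteq> X" using set_omit_nth[of i xs] len by blast
  then have "chain_length d ?ws = chain_length d xs"
    using chain_length_repeat_nth[of i ?ws] eq wl i len by simp
  then have "?ws \<in> finite_chains X d n"
    using xs ws wl by (simp add: finite_chains_def)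
  with eq i len show thesis by (intro that[of i ?ws]) auto
qed

end

section \<open>The modules of magnitude cochains\<close>

locale magnitude_cochains = graded_quasimetric K X d G
  for K :: "('k, 'z) ring_scheme" (structure) and X :: "'x set" and d G +
  fixes M :: "('x, 'k, 'm) distance_module" and l :: real
  assumes M: "is_distance_module K X d M"
begin

abbreviation N :: "('x, 'k, 'm) distance_module" where "N \<equiv> shift M l"

lemmas N = is_distance_module_shift[OF M, of l]

text \<open>The degree \<open>- l + |xs|\<close> of \<open>M\<close> is degree \<open>|xs|\<close>
  of the shift by \<open>l\<close>, and \<open>|xs|\<close> is the degree of the generator
  \<open>xs\<close> of the bar module. This is the origin of the shift inside
  \<open>Ext\<close>.\<close>

lemma mc_coeff_eq: "mc_coeff d M l xs = fib N (last xs) (clen d xs)"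
  by (simp add: mc_coeff_def mc_degree_def shift_def algebra_simps)

lemma act_eq: "act M x y (mc_degree d l xs) = act N x y (clen d xs)"
  by (simp add: mc_degree_def shift_def algebra_simps)

lemma finite_chainsD:
  assumes "xs \<in> finite_chains X d n"
  shows "length xs = Suc n" "set xs \<subseteq> X" "chain_length d xs < \<infinity>" "last xs \<in> X"
    "\<And>i. i \<le> n \<Longrightarrow> xs ! i \<in> X" "module K (mc_coeff d M l xs)"
proof -
  show "length xs = Suc n" "set xs \<subseteq> X" "chain_length d xs < \<infinity>"
    using assms by (auto simp: finite_chains_def)
  then show l: "last xs \<in> X" and "\<And>i. i \<le> n \<Longrightarrow> xs ! i \<in> X"
    using last_in_set[of xs] by (fastforce simp: subset_iff)+
  then show "module K (mc_coeff d M l xs)"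
    unfolding mc_coeff_eq by (intro dm_module[OF N])
qed

lemma MC_simps [simp]:
  "carrier (MC X d M l n) = (\<Pi>\<^sub>E xs\<in>finite_chains X d n. carrier (mc_coeff d M l xs))"
  "\<zero>\<^bsub>MC X d M l n\<^esub> = (\<lambda>xs\<in>finite_chains X d n. \<zero>\<^bsub>mc_coeff d M l xs\<^esub>)"
  "\<alpha> \<oplus>\<^bsub>MC X d M l n\<^esub> \<beta> = (\<lambda>xs\<in>finite_chains X d n. \<alpha> xs \<oplus>\<^bsub>mc_coeff d M l xs\<^esub> \<beta> xs)"
  "c \<odot>\<^bsub>MC X d M l n\<^esub> \<alpha> = (\<lambda>xs\<in>finite_chains X d n. c \<odot>\<^bsub>mc_coeff d M l xs\<^esub> \<alpha> xs)"
  by (simp_all add: MC_def)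

lemma module_MC: "module K (MC X d M l n)"
proof -
  note mod = finite_chainsD(6)
  have ag: "abelian_group (mc_coeff d M l xs)" if "xs \<in> finite_chains X d n" for xs
    using mod[OF that] by (simp add: module_def)
  note am = abelian_group.axioms(1)[OF ag]
  have group: "abelian_group (MC X d M l n)"
  proof (rule abelian_groupI)
    fix \<alpha> assume "\<alpha> \<in> carrier (MC X d M l n)"
    then have \<alpha>: "\<alpha> \<in> (\<Pi>\<^sub>E xs\<in>finite_chains X d n. carrier (mc_coeff d M l xs))" by simp
    let ?\<beta> = "\<lambda>xs\<in>finite_chains X d n. \<ominus>\<^bsub>mc_coeff d M l xs\<^esub> \<alpha> xs"
    have "?\<beta> \<in> carrier (MC X d M l n)"
      using \<alpha> by (auto intro!: abelian_group.a_inv_closed[OF ag])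
    moreover have "?\<beta> \<oplus>\<^bsub>MC X d M l n\<^esub> \<alpha> = \<zero>\<^bsub>MC X d M l n\<^esub>"
      using \<alpha> by (auto intro!: restrict_ext abelian_group.l_neg[OF ag])
    ultimately show "\<exists>\<beta>\<in>carrier (MC X d M l n). \<beta> \<oplus>\<^bsub>MC X d M l n\<^esub> \<alpha> = \<zero>\<^bsub>MC X d M l n\<^esub>"
      by blast
    show "\<zero>\<^bsub>MC X d M l n\<^esub> \<oplus>\<^bsub>MC X d M l n\<^esub> \<alpha> = \<alpha>"
      using \<alpha> by (auto simp: fun_eq_iff PiE_iff extensional_def intro!: abelian_monoid.l_zero[OF am])
  next
    fix \<alpha> \<beta> assume "\<alpha> \<in> carrier (MC X d M l n)" "\<beta> \<in> carrier (MC X d M l n)"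
    then show "\<alpha> \<oplus>\<^bsub>MC X d M l n\<^esub> \<beta> \<in> carrier (MC X d M l n)"
        "\<alpha> \<oplus>\<^bsub>MC X d M l n\<^esub> \<beta> = \<beta> \<oplus>\<^bsub>MC X d M l n\<^esub> \<alpha>"
      by (auto simp: PiE_iff intro!: restrict_ext abelian_monoid.a_closed[OF am] abelian_monoid.a_comm[OF am])
  next
    fix \<alpha> \<beta> \<gamma> assume "\<alpha> \<in> carrier (MC X d M l n)" "\<beta> \<in> carrier (MC X d M l n)" "\<gamma> \<in> carrier (MC X d M l n)"
    then show "\<alpha> \<oplus>\<^bsub>MC X d M l n\<^esub> \<beta> \<oplus>\<^bsub>MC X d M l n\<^esub> \<gamma> = \<alpha> \<oplus>\<^bsub>MC X d M l n\<^esub> (\<beta> \<oplus>\<^bsub>MC X d M l n\<^esub> \<gamma>)"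
      by (auto simp: PiE_iff intro!: restrict_ext abelian_monoid.a_assoc[OF am])
  qed (auto intro!: abelian_monoid.zero_closed[OF am])
  show ?thesis
  proof (rule moduleI[OF is_cring group])
    show "\<one> \<odot>\<^bsub>MC X d M l n\<^esub> \<alpha> = \<alpha>" if "\<alpha> \<in> carrier (MC X d M l n)" for \<alpha>
      using that by (auto simp: fun_eq_iff PiE_iff extensional_def intro!: module.smult_one[OF mod])
  next
    fix a \<alpha> assume "a \<in> carrier K" "\<alpha> \<in> carrier (MC X d M l n)"
    then show "a \<odot>\<^bsub>MC X d M l n\<^esub> \<alpha> \<in> carrier (MC X d M l n)"
      by (auto simp: PiE_iff intro!: module.smult_closed[OF mod])
  next
    fix a b \<alpha> assume "a \<in> carrier K" "b \<in> carrier K" "\<alpha> \<in> carrier (MC X d M l n)"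
    then show "(a \<oplus> b) \<odot>\<^bsub>MC X d M l n\<^esub> \<alpha> = a \<odot>\<^bsub>MC X d M l n\<^esub> \<alpha> \<oplus>\<^bsub>MC X d M l n\<^esub> b \<odot>\<^bsub>MC X d M l n\<^esub> \<alpha>"
      "(a \<otimes> b) \<odot>\<^bsub>MC X d M l n\<^esub> \<alpha> = a \<odot>\<^bsub>MC X d M l n\<^esub> (b \<odot>\<^bsub>MC X d M l n\<^esub> \<alpha>)"
      by (auto simp: PiE_iff intro!: restrict_ext module.smult_l_distr[OF mod] module.smult_assoc1[OF mod])
  next
    fix a \<alpha> \<beta> assume "a \<in> carrier K" "\<alpha> \<in> carrier (MC X d M l n)" "\<beta> \<in> carrier (MC X d M l n)"
    then show "a \<odot>\<^bsub>MC X d M l n\<^esub> (\<alpha> \<oplus>\<^bsub>MC X d M l n\<^esub> \<beta>) = a \<odot>\<^bsub>MC X d M l n\<^esub> \<alpha> \<oplus>\<^bsub>MC X d M l n\<^esub> a \<odot>\<^bsub>MC X d M l n\<^esub> \<beta>"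
      by (auto simp: PiE_iff intro!: restrict_ext module.smult_r_distr[OF mod])
  qed
qed

lemma MC_eval_linear:
  "xs \<in> finite_chains X d n \<Longrightarrow> (\<lambda>\<alpha>. \<alpha> xs) \<in> linear_maps K (MC X d M l n) (mc_coeff d M l xs)"
  by (rule linear_mapsI) (auto simp: PiE_iff)

text \<open>Every degenerate chain repeats a point of a shorter one, so the codegeneracies test
  exactly the degenerate chains. Normalised cochains thus amount to choices of values on
  \<open>bar_gens n\<close>.\<close>

lemma carrier_normalised_MC:
  "\<alpha> \<in> carrier (normalised_MC X d M l n) \<longleftrightarrow> \<alpha> \<in> carrier (MC X d M l n) \<and>
    (\<forall>xs\<in>finite_chains X d n. \<not> nondeg xs \<longrightarrow> \<alpha> xs = \<zero>\<^bsub>mc_coeff d M l xs\<^esub>)"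
proof (cases n)
  case 0
  then have "nondeg xs" if "xs \<in> finite_chains X d n" for xs
    using that by (simp add: finite_chains_def nondeg_def)
  with 0 show ?thesis by (auto simp: normalised_MC_def)
next
  case (Suc k)
  have "(\<forall>i\<le>k. codegeneracy X d k i \<alpha> = \<zero>\<^bsub>MC X d M l k\<^esub>) \<longleftrightarrow>
      (\<forall>xs\<in>finite_chains X d n. \<not> nondeg xs \<longrightarrow> \<alpha> xs = \<zero>\<^bsub>mc_coeff d M l xs\<^esub>)"
  proof
    assume h: "\<forall>i\<le>k. codegeneracy X d k i \<alpha> = \<zero>\<^bsub>MC X d M l k\<^esub>"
    show "\<forall>xs\<in>finite_chains X d n. \<not> nondeg xs \<longrightarrow> \<alpha> xs = \<zero>\<^bsub>mc_coeff d M l xs\<^esub>"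
    proof (intro ballI impI)
      fix xs assume "xs \<in> finite_chains X d n" "\<not> nondeg xs"
      then obtain i ws where i: "i \<le> k" and ws: "ws \<in> finite_chains X d k" and xs: "xs = repeat_nth i ws"
        using degenerate_repeat_nth Suc by metis
      have "codegeneracy X d k i \<alpha> ws = \<zero>\<^bsub>MC X d M l k\<^esub> ws"
        using h i by simp
      then show "\<alpha> xs = \<zero>\<^bsub>mc_coeff d M l xs\<^esub>"
        using ws repeat_nth_finite_chains(3,4)[OF ws i] by (simp add: codegeneracy_def xs mc_coeff_eq)
    qed
  next
    assume h: "\<forall>xs\<in>finite_chains X d n. \<not> nondeg xs \<longrightarrow> \<alpha> xs = \<zero>\<^bsub>mc_coeff d M l xs\<^esub>"
    show "\<forall>i\<le>k. codegeneracy X d k i \<alpha> = \<zero>\<^bsub>MC X d M l k\<^esub>"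
    proof (intro allI impI)
      fix i assume i: "i \<le> k"
      show "codegeneracy X d k i \<alpha> = \<zero>\<^bsub>MC X d M l k\<^esub>"
        unfolding codegeneracy_def MC_simps
      proof (rule restrict_ext)
        fix ws assume ws: "ws \<in> finite_chains X d k"
        show "\<alpha> (repeat_nth i ws) = \<zero>\<^bsub>mc_coeff d M l ws\<^esub>"
          using h repeat_nth_finite_chains[OF ws i] Suc by (simp add: mc_coeff_eq)
      qed
    qed
  qed
  moreover have "(\<forall>i<Suc k. Q i) \<longleftrightarrow> (\<forall>i\<le>k. Q i)" for Q by (simp add: less_Suc_eq_le)
  ultimately show ?thesis
    by (simp add: normalised_MC_def Suc del: MC_simps)
qed

lemma normalised_MC_simps [simp]:
  "\<zero>\<^bsub>normalised_MC X d M l n\<^esub> = \<zero>\<^bsub>MC X d M l n\<^esub>"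
  "\<alpha> \<oplus>\<^bsub>normalised_MC X d M l n\<^esub> \<beta> = \<alpha> \<oplus>\<^bsub>MC X d M l n\<^esub> \<beta>"
  "c \<odot>\<^bsub>normalised_MC X d M l n\<^esub> \<alpha> = c \<odot>\<^bsub>MC X d M l n\<^esub> \<alpha>"
  by (simp_all add: normalised_MC_def)

lemma module_normalised_MC: "module K (normalised_MC X d M l n)"
proof -
  interpret MC: module K "MC X d M l n" by (rule module_MC)
  let ?H = "carrier (normalised_MC X d M l n)"
  note mod = finite_chainsD(6)
  have "submodule ?H K (MC X d M l n)"
  proof (rule MC.submoduleI)
    show "?H \<subseteq> carrier (MC X d M l n)"
      by (auto simp only: carrier_normalised_MC)
    show "\<zero>\<^bsub>MC X d M l n\<^esub> \<in> ?H"
      unfolding carrier_normalised_MC using MC.M.zero_closed by simp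
    show "\<ominus>\<^bsub>MC X d M l n\<^esub> \<alpha> \<in> ?H" if "\<alpha> \<in> ?H" for \<alpha>
    proof -
      have \<alpha>: "\<alpha> \<in> carrier (MC X d M l n)" using that by (simp only: carrier_normalised_MC)
      have "(\<ominus>\<^bsub>MC X d M l n\<^esub> \<alpha>) xs = \<ominus>\<^bsub>mc_coeff d M l xs\<^esub> \<alpha> xs" if "xs \<in> finite_chains X d n" for xs
        by (rule linear_maps_minus[OF MC_eval_linear[OF that] module_MC mod[OF that] \<alpha>])
      moreover have "\<ominus>\<^bsub>mc_coeff d M l xs\<^esub> \<zero>\<^bsub>mc_coeff d M l xs\<^esub> = \<zero>\<^bsub>mc_coeff d M l xs\<^esub>"
        if "xs \<in> finite_chains X d n" for xs
      proof -
        interpret V: module K "mc_coeff d M l xs" by (rule mod[OF that])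
        show ?thesis by (rule V.M.minus_equality) simp_all
      qed
      ultimately show ?thesis
        using that MC.M.a_inv_closed[OF \<alpha>] unfolding carrier_normalised_MC by simp
    qed
    show "\<alpha> \<oplus>\<^bsub>MC X d M l n\<^esub> \<beta> \<in> ?H" if "\<alpha> \<in> ?H" "\<beta> \<in> ?H" for \<alpha> \<beta>
    proof -
      have "\<zero>\<^bsub>mc_coeff d M l xs\<^esub> \<oplus>\<^bsub>mc_coeff d M l xs\<^esub> \<zero>\<^bsub>mc_coeff d M l xs\<^esub> = \<zero>\<^bsub>mc_coeff d M l xs\<^esub>"
        if "xs \<in> finite_chains X d n" for xs
        using mod[OF that] by (simp add: module_def abelian_group_def abelian_monoid.r_zero abelian_monoid.zero_closed)
      then show ?thesis
        using that MC.M.a_closed[of \<alpha> \<beta>] unfolding carrier_normalised_MC by simp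
    qed
    show "a \<odot>\<^bsub>MC X d M l n\<^esub> \<alpha> \<in> ?H" if "a \<in> carrier K" "\<alpha> \<in> ?H" for a \<alpha>
      using that MC.smult_closed[of a \<alpha>] module.smult_r_null[OF mod]
      unfolding carrier_normalised_MC by simp
  qed
  then have "module K (MC X d M l n \<lparr>carrier := ?H\<rparr>)"
    by (rule submodule.submodule_is_module[OF _ module_MC])
  then show ?thesis
    by (simp add: normalised_MC_def)
qed

end

section \<open>Cofaces and the differential on normalised cochains\<close>

context magnitude_cochains
begin

text \<open>The cofaces up to \<open>n\<close> share one shape, omitting a point or giving zero; the
  top coface \<open>Suc n\<close> uses the action of \<open>M\<close> instead.\<close>

definition face_ok :: "nat \<Rightarrow> 'x list \<Rightarrow> bool" where
  "face_ok i xs \<longleftrightarrow> (if i = 0 then xs ! 0 = xs ! 1 else between d (xs ! (i - 1)) (xs ! i) (xs ! (i + 1)))"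

text \<open>The end point and the length survive, so the cochain value at the shorter chain already
  lies in the coefficient module of \<open>xs\<close>.\<close>

lemma omit_nth_face:
  assumes xs: "xs \<in> finite_chains X d (Suc n)" and i: "i \<le> n" and ok: "face_ok i xs"
  shows "omit_nth i xs \<in> finite_chains X d n" "last (omit_nth i xs) = last xs"
    "chain_length d (omit_nth i xs) = chain_length d xs"
proof -
  note xs' = finite_chainsD[OF xs]
  show cl: "chain_length d (omit_nth i xs) = chain_length d xs"
  proof (cases "i = 0")
    case True
    obtain x ys where x: "xs = x # ys" using xs'(1) by (cases xs) auto
    obtain y zs where y: "ys = y # zs" using xs'(1) x by (cases ys) auto
    have "x = y" "x \<in> X" using ok True x y xs'(2) by (auto simp: face_ok_def)
    then show ?thesis using True x y by (simp add: omit_nth_def chain_length_Cons)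
  next
    case False
    then show ?thesis
      using ok i xs'(1) by (intro chain_length_omit_nth) (auto simp: face_ok_def)
  qed
  show "last (omit_nth i xs) = last xs"
    using last_omit_nth[of xs "Suc n" i] xs'(1) i by simp
  show "omit_nth i xs \<in> finite_chains X d n"
    using xs' i cl set_omit_nth[of i xs] by (auto simp: finite_chains_def length_omit_nth)
qed

lemma butlast_finite_chains:
  assumes xs: "xs \<in> finite_chains X d (Suc n)"
  shows "butlast xs \<in> finite_chains X d n" "d (xs ! n) (xs ! Suc n) < \<infinity>"
    "clen d (butlast xs) + rdist d (xs ! n) (xs ! Suc n) = clen d xs"
proof -
  note xs' = finite_chainsD[OF xs]
  note cl = chain_length_butlast(1)[OF xs'(1), of d]
  have fin: "chain_length d (butlast xs) < \<infinity>" "d (xs ! n) (xs ! Suc n) < \<infinity>"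
    using xs'(3) unfolding cl by simp_all
  then show "butlast xs \<in> finite_chains X d n" "d (xs ! n) (xs ! Suc n) < \<infinity>"
    using xs'(1,2) by (auto simp: finite_chains_def dest: in_set_butlastD)
  show "clen d (butlast xs) + rdist d (xs ! n) (xs ! Suc n) = clen d xs"
    unfolding cl by (rule enn2real_add[OF fin, symmetric])
qed

lemma coface_low:
  assumes "xs \<in> finite_chains X d (Suc n)" "i \<le> n"
  shows "coface X d M l n i \<alpha> xs = (if face_ok i xs then \<alpha> (omit_nth i xs) else \<zero>\<^bsub>mc_coeff d M l xs\<^esub>)"
  using assms by (simp add: coface_def face_ok_def)

lemma coface_top:
  assumes xs: "xs \<in> finite_chains X d (Suc n)"
  shows "coface X d M l n (Suc n) \<alpha> xs = act N (xs ! n) (xs ! Suc n) (clen d (butlast xs)) (\<alpha> (butlast xs))"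
  using xs omit_nth_last[of xs "Suc n"] finite_chainsD(1)[OF xs] by (simp add: coface_def act_eq)

lemma MC_apply_closed:
  "\<lbrakk>\<alpha> \<in> carrier (MC X d M l n); xs \<in> finite_chains X d n\<rbrakk> \<Longrightarrow> \<alpha> xs \<in> carrier (fib N (last xs) (clen d xs))"
  by (auto simp: mc_coeff_eq)

lemma coface_apply_closed:
  assumes \<alpha>: "\<alpha> \<in> carrier (MC X d M l n)" and xs: "xs \<in> finite_chains X d (Suc n)" and i: "i \<le> Suc n"
  shows "coface X d M l n i \<alpha> xs \<in> carrier (mc_coeff d M l xs)"
proof (cases "i = Suc n")
  case True
  note bl = butlast_finite_chains[OF xs] and xs' = finite_chainsD[OF xs]
  note cb = chain_length_butlast(2,3)[OF xs'(1)]
  have "\<alpha> (butlast xs) \<in> carrier (fib N (xs ! n) (clen d (butlast xs)))"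
    using MC_apply_closed[OF \<alpha> bl(1)] cb by simp
  then have "act N (xs ! n) (xs ! Suc n) (clen d (butlast xs)) (\<alpha> (butlast xs))
      \<in> carrier (fib N (xs ! Suc n) (clen d (butlast xs) + rdist d (xs ! n) (xs ! Suc n)))"
    using xs'(5) bl(2) by (intro linear_maps_closed[OF dm_act[OF N]]) auto
  then show ?thesis
    using True bl(3) cb by (simp add: coface_top[OF xs] mc_coeff_eq)
next
  case False
  interpret V: module K "mc_coeff d M l xs" by (rule finite_chainsD(6)[OF xs])
  from False i have i: "i \<le> n" by simp
  show ?thesis
    using omit_nth_face[OF xs i] MC_apply_closed[OF \<alpha>, of "omit_nth i xs"] V.M.zero_closed
    by (auto simp: coface_low[OF xs i] mc_coeff_eq)
qed

lemma coface_closed: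
  "\<lbrakk>\<alpha> \<in> carrier (MC X d M l n); i \<le> Suc n\<rbrakk> \<Longrightarrow> coface X d M l n i \<alpha> \<in> carrier (MC X d M l (Suc n))"
  using coface_apply_closed by (auto simp: PiE_iff coface_def extensional_def)

lemma mc_differential_closed:
  assumes \<alpha>: "\<alpha> \<in> carrier (MC X d M l n)"
  shows "mc_differential X d M l n \<alpha> \<in> carrier (MC X d M l (Suc n))"
proof -
  interpret MC: module K "MC X d M l (Suc n)" by (rule module_MC)
  show ?thesis
    unfolding mc_differential_def using coface_closed[OF \<alpha>]
    by (intro MC.M.finsum_closed) (auto simp del: MC_simps intro: MC.M.a_inv_closed)
qed

text \<open>Evaluation at \<open>xs\<close> is linear, so a sum of cochains becomes a sum in one
  coefficient module. The signs become scalars, to match the form of \<open>bar_bd\<close>.\<close>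

lemma mc_differential_apply:
  assumes \<alpha>: "\<alpha> \<in> carrier (MC X d M l n)" and xs: "xs \<in> finite_chains X d (Suc n)"
  shows "mc_differential X d M l n \<alpha> xs =
    (\<Oplus>\<^bsub>mc_coeff d M l xs\<^esub>i\<in>{0..Suc n}. sg i \<odot>\<^bsub>mc_coeff d M l xs\<^esub> coface X d M l n i \<alpha> xs)"
proof -
  interpret MC: module K "MC X d M l (Suc n)" by (rule module_MC)
  interpret V: module K "mc_coeff d M l xs" by (rule finite_chainsD(6)[OF xs])
  note ev = MC_eval_linear[OF xs]
  let ?t = "\<lambda>i. if even i then coface X d M l n i \<alpha> else \<ominus>\<^bsub>MC X d M l (Suc n)\<^esub> coface X d M l n i \<alpha>"
  have t: "?t i \<in> carrier (MC X d M l (Suc n))" if "i \<in> {0..Suc n}" for i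
    using that coface_closed[OF \<alpha>, of i] MC.M.a_inv_closed by auto
  have eq: "?t i xs = sg i \<odot>\<^bsub>mc_coeff d M l xs\<^esub> coface X d M l n i \<alpha> xs" if i: "i \<in> {0..Suc n}" for i
  proof -
    have c: "coface X d M l n i \<alpha> \<in> carrier (MC X d M l (Suc n))"
      using coface_closed[OF \<alpha>, of i] i by simp
    have "(\<ominus>\<^bsub>MC X d M l (Suc n)\<^esub> coface X d M l n i \<alpha>) xs = \<ominus>\<^bsub>mc_coeff d M l xs\<^esub> coface X d M l n i \<alpha> xs"
      by (rule linear_maps_minus[OF ev MC.module_axioms V.module_axioms c])
    then show ?thesis
      using coface_apply_closed[OF \<alpha> xs, of i] i by (simp add: sg_def V.smult_l_minus)
  qed
  have "mc_differential X d M l n \<alpha> xs = (\<Oplus>\<^bsub>mc_coeff d M l xs\<^esub>i\<in>{0..Suc n}. ?t i xs)"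
    unfolding mc_differential_def using t
    by (intro linear_maps_finsum[OF ev MC.module_axioms V.module_axioms]) (simp_all del: MC_simps)
  also have "\<dots> = (\<Oplus>\<^bsub>mc_coeff d M l xs\<^esub>i\<in>{0..Suc n}. sg i \<odot>\<^bsub>mc_coeff d M l xs\<^esub> coface X d M l n i \<alpha> xs)"
    using coface_apply_closed[OF \<alpha> xs] by (intro V.M.finsum_cong' eq) auto
  finally show ?thesis .
qed

abbreviation NMC :: "nat \<Rightarrow> ('k, 'x list \<Rightarrow> 'm) module" where
  "NMC \<equiv> normalised_MC X d M l"

abbreviation mcd :: "nat \<Rightarrow> ('x list \<Rightarrow> 'm) \<Rightarrow> 'x list \<Rightarrow> 'm" where
  "mcd \<equiv> mc_differential X d M l"

lemma NMC_closed:
  assumes "\<alpha> \<in> carrier (NMC n)"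
  shows "\<alpha> \<in> carrier (MC X d M l n)"
    "\<lbrakk>xs \<in> finite_chains X d n; \<not> nondeg xs\<rbrakk> \<Longrightarrow> \<alpha> xs = \<zero>\<^bsub>mc_coeff d M l xs\<^esub>"
    "xs \<in> bar_gens n \<Longrightarrow> \<alpha> xs \<in> carrier (fib N (last xs) (clen d xs))"
  using assms MC_apply_closed[of \<alpha> n xs] unfolding carrier_normalised_MC bar_gens_iff by blast+

lemma NMC_eqI:
  assumes \<alpha>: "\<alpha> \<in> carrier (NMC n)" and \<beta>: "\<beta> \<in> carrier (NMC n)"
    and eq: "\<And>xs. xs \<in> bar_gens n \<Longrightarrow> \<alpha> xs = \<beta> xs"
  shows "\<alpha> = \<beta>"
proof (rule PiE_ext)
  show "\<alpha> \<in> (\<Pi>\<^sub>E xs\<in>finite_chains X d n. carrier (mc_coeff d M l xs))"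
    "\<beta> \<in> (\<Pi>\<^sub>E xs\<in>finite_chains X d n. carrier (mc_coeff d M l xs))"
    using NMC_closed(1)[OF \<alpha>] NMC_closed(1)[OF \<beta>] by simp_all
  show "\<alpha> xs = \<beta> xs" if "xs \<in> finite_chains X d n" for xs
    using eq[of xs] NMC_closed(2)[OF \<alpha> that] NMC_closed(2)[OF \<beta> that] that
    by (cases "nondeg xs") (auto simp: bar_gens_iff)
qed

text \<open>If \<open>x\<^sub>j = x\<^sub>j\<^sub>+\<^sub>1\<close> then only the cofaces \<open>j\<close> and \<open>j + 1\<close> can be nonzero, and they cancel.\<close>

lemma mc_differential_degenerate:
  assumes \<alpha>: "\<alpha> \<in> carrier (NMC n)" and xs: "xs \<in> finite_chains X d (Suc n)" and deg: "\<not> nondeg xs"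
  shows "mcd n \<alpha> xs = \<zero>\<^bsub>mc_coeff d M l xs\<^esub>"
proof -
  interpret V: module K "mc_coeff d M l xs" by (rule finite_chainsD(6)[OF xs])
  note \<alpha>' = NMC_closed(1)[OF \<alpha>] and xs' = finite_chainsD[OF xs]
  note bl = butlast_finite_chains[OF xs] and cb = chain_length_butlast(2,3)[OF xs'(1)]
  let ?V = "mc_coeff d M l xs"
  let ?t = "\<lambda>i. coface X d M l n i \<alpha> xs"
  obtain j where j: "j \<le> n" "xs ! j = xs ! Suc j"
    using deg xs'(1) by (auto simp: nondeg_def less_Suc_eq_le)
  have t: "?t i \<in> carrier ?V" if "i \<le> Suc n" for i
    by (rule coface_apply_closed[OF \<alpha>' xs that])
  \<comment> \<open>Omitting any other point leaves the equal pair adjacent, one position lower if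
    the omitted point precedes it.\<close>
  have deg_omit: "\<not> nondeg (omit_nth i xs)" if "i \<le> Suc n" "i \<noteq> j" "i \<noteq> Suc j" for i
  proof (cases "i < j")
    case True
    then have "omit_nth i xs ! (j - 1) = xs ! j" "omit_nth i xs ! Suc (j - 1) = xs ! Suc j"
      using that(1) xs'(1) j(1) nth_omit_nth[of i xs "j - 1"] nth_omit_nth[of i xs "Suc (j - 1)"] by auto
    moreover have "Suc (j - 1) < length (omit_nth i xs)"
      using True that(1) j(1) xs'(1) by (simp add: length_omit_nth)
    ultimately show ?thesis using j(2) unfolding nondeg_def by metis
  next
    case False
    then have "omit_nth i xs ! j = xs ! j" "omit_nth i xs ! Suc j = xs ! Suc j" "Suc j < length (omit_nth i xs)"
      using that xs'(1) j(1) nth_omit_nth[of i xs j] nth_omit_nth[of i xs "Suc j"]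
      by (auto simp: length_omit_nth)
    then show ?thesis using j(2) unfolding nondeg_def by metis
  qed
  have zero: "?t i = \<zero>\<^bsub>?V\<^esub>" if i: "i \<le> Suc n" "i \<noteq> j" "i \<noteq> Suc j" for i
  proof (cases "i = Suc n")
    case True
    have "\<alpha> (butlast xs) = \<zero>\<^bsub>mc_coeff d M l (butlast xs)\<^esub>"
      using NMC_closed(2)[OF \<alpha> bl(1)] deg_omit[OF i] True omit_nth_last[of xs "Suc n"] xs'(1) by simp
    then have "?t i = act N (xs ! n) (xs ! Suc n) (clen d (butlast xs)) \<zero>\<^bsub>fib N (xs ! n) (clen d (butlast xs))\<^esub>"
      using True cb by (simp add: coface_top[OF xs] mc_coeff_eq)
    also have "\<dots> = \<zero>\<^bsub>fib N (xs ! Suc n) (clen d (butlast xs) + rdist d (xs ! n) (xs ! Suc n))\<^esub>"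
      using xs'(5) bl(2) by (intro linear_maps_zero[OF dm_act[OF N]] dm_module[OF N]) auto
    finally show ?thesis
      using bl(3) cb by (simp add: mc_coeff_eq)
  next
    case False
    with i have i': "i \<le> n" by simp
    show ?thesis
      using omit_nth_face[OF xs i'] NMC_closed(2)[OF \<alpha>, of "omit_nth i xs"] deg_omit[OF i]
      by (auto simp: coface_low[OF xs i'] mc_coeff_eq)
  qed
  have omit_eq: "omit_nth (Suc j) xs = omit_nth j xs"
  proof (rule nth_equalityI)
    show "length (omit_nth (Suc j) xs) = length (omit_nth j xs)"
      using j(1) xs'(1) by (simp add: length_omit_nth)
    fix i assume "i < length (omit_nth (Suc j) xs)"
    then have i: "i < length xs - 1"
      using j(1) xs'(1) by (simp add: length_omit_nth)
    have "Suc j < length xs" "j < length xs"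
      using j(1) xs'(1) by simp_all
    then show "omit_nth (Suc j) xs ! i = omit_nth j xs ! i"
      using i j(2) by (cases "i = j") (simp_all add: nth_omit_nth less_Suc_eq)
  qed
  have "face_ok j xs"
    using j xs'(5) by (auto simp: face_ok_def)
  then have tj: "?t j = \<alpha> (omit_nth j xs)"
    using coface_low[OF xs j(1)] by simp
  \<comment> \<open>For \<open>j = n\<close> this is the top coface, and the action along
    \<open>xs ! n = xs ! Suc n\<close> is the identity.\<close>
  have tSj: "?t (Suc j) = \<alpha> (omit_nth j xs)"
  proof (cases "j = n")
    case True
    have "omit_nth j xs = butlast xs"
      using omit_eq omit_nth_last[of xs "Suc n"] xs'(1) True by simp
    moreover have "act N (xs ! n) (xs ! Suc n) (clen d (butlast xs)) (\<alpha> (butlast xs)) = \<alpha> (butlast xs)"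
      using j(2) True dm_act_self[OF N, of "xs ! n" "\<alpha> (butlast xs)"] MC_apply_closed[OF \<alpha>' bl(1)] cb xs'(5)[of n]
      by simp
    ultimately show ?thesis
      using True coface_top[OF xs] by simp
  next
    case False
    then have "Suc j \<le> n" using j by simp
    moreover have "face_ok (Suc j) xs"
      using j xs'(5)[of j] xs'(5)[of "Suc (Suc j)"] \<open>Suc j \<le> n\<close> by (auto simp: face_ok_def)
    ultimately show ?thesis
      using coface_low[OF xs] omit_eq by simp
  qed
  have "mcd n \<alpha> xs = (\<Oplus>\<^bsub>?V\<^esub>i\<in>{0..Suc n}. sg i \<odot>\<^bsub>?V\<^esub> ?t i)"
    by (rule mc_differential_apply[OF \<alpha>' xs])
  also have "\<dots> = (\<Oplus>\<^bsub>?V\<^esub>i\<in>{j, Suc j}. sg i \<odot>\<^bsub>?V\<^esub> ?t i)"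
    using j(1) t by (intro V.M.add.finprod_mono_neutral_cong_right) (auto simp: zero)
  also have "\<dots> = sg j \<odot>\<^bsub>?V\<^esub> ?t j \<oplus>\<^bsub>?V\<^esub> sg (Suc j) \<odot>\<^bsub>?V\<^esub> ?t j"
    using t[of j] t[of "Suc j"] j(1) tj tSj by simp
  also have "\<dots> = \<zero>\<^bsub>?V\<^esub>"
    using t[of j] j(1) by (simp add: sg_Suc V.smult_l_minus V.M.r_neg)
  finally show ?thesis .
qed

text \<open>Two alternating sums are matched face by face over the base point
  \<open>last xs\<close>: inner faces agree because the action from that point to itself is the
  identity, the last bar face is the top coface, and coface 0 vanishes on a nondegenerate
  chain.\<close>

lemma mc_differential_gen:
  assumes \<alpha>: "\<alpha> \<in> carrier (NMC n)" and xs: "xs \<in> bar_gens (Suc n)"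
  shows "mcd n \<alpha> xs = bar_ext n N \<alpha> (last xs) (clen d xs) (bar_diff n (last xs) (clen d xs) (delta K xs))"
proof -
  have fc: "xs \<in> finite_chains X d (Suc n)" and nd: "nondeg xs"
    using xs by (simp_all add: bar_gens_iff)
  interpret V: module K "mc_coeff d M l xs" by (rule finite_chainsD(6)[OF fc])
  note \<alpha>' = NMC_closed(1)[OF \<alpha>] and xs' = finite_chainsD[OF fc]
  note bl = butlast_finite_chains[OF fc] and cb = chain_length_butlast(2,3)[OF xs'(1)]
  note \<alpha>g = NMC_closed(3)[OF \<alpha>]
  let ?y = "last xs" and ?g = "clen d xs"
  let ?V = "mc_coeff d M l xs"
  let ?t = "\<lambda>i. coface X d M l n i \<alpha> xs"
  let ?\<phi> = "bar_ext n N \<alpha> ?y ?g"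
  have V_eq: "fib N ?y ?g = ?V" by (simp add: mc_coeff_eq)
  note mem = bar_gensD(1)[OF xs]
  have t: "?t i \<in> carrier ?V" if "i \<le> Suc n" for i
    by (rule coface_apply_closed[OF \<alpha>' fc that])
  have lin: "?\<phi> \<in> linear_maps K (bmod n ?y ?g) ?V"
    using dm_hom_linear[OF bar_ext_hom[where n = n, OF N \<alpha>g] xs'(4), where g = ?g] by (simp add: V_eq)
  have face: "?\<phi> (bar_face ?y i xs) = ?t i" if i: "i \<in> {1..Suc n}" for i
  proof (cases "i = Suc n")
    case True
    \<comment> \<open>The last listed point is the base point here, so betweenness holds
      automatically.\<close>
    have b: "face_between d ?y i xs"
      using True xs'(1,4,5) cb by (simp add: nth_append)
    have om: "omit_nth i xs = butlast xs"
      using True omit_nth_last[of xs "Suc n"] xs'(1) by simp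
    show ?thesis
      using b bar_ext_delta[OF N \<alpha>g xs'(4) bar_chains_omit_nth[OF mem i b]] coface_top[OF fc] True cb om
      by (simp add: bar_face_def)
  next
    case False
    with i have i': "i \<le> n" by simp
    have b: "face_between d ?y i xs \<longleftrightarrow> face_ok i xs"
      using i i' xs'(1) by (simp add: face_ok_def nth_append)
    show ?thesis
    proof (cases "face_ok i xs")
      case True
      note om = omit_nth_face[OF fc i' True]
      note ch = bar_chains_omit_nth[OF mem i iffD2[OF b True]]
      have "?\<phi> (delta K (omit_nth i xs)) = act N ?y ?y ?g (\<alpha> (omit_nth i xs))"
        using bar_ext_delta[OF N \<alpha>g xs'(4) ch] om by simp
      also have "\<dots> = \<alpha> (omit_nth i xs)"
        using MC_apply_closed[OF \<alpha>' om(1)] om by (intro dm_act_self[OF N xs'(4)]) simp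
      finally show ?thesis
        using True b by (simp add: bar_face_def coface_low[OF fc i'])
    next
      case False
      then show ?thesis
        using b linear_maps_zero[OF lin module_free_mod V.module_axioms]
        by (simp add: bar_face_def coface_low[OF fc i'])
    qed
  qed
  have "\<not> face_ok 0 xs"
    using nd xs'(1) by (auto simp: face_ok_def nondeg_def)
  then have t0: "?t 0 = \<zero>\<^bsub>?V\<^esub>"
    using coface_low[OF fc, of 0] by simp
  have "?\<phi> (bar_diff n ?y ?g (delta K xs)) = (\<Oplus>\<^bsub>?V\<^esub>i\<in>{1..Suc n}. sg i \<odot>\<^bsub>?V\<^esub> ?\<phi> (bar_face ?y i xs))"
    unfolding bar_diff_delta[OF mem] by (rule linear_bar_bd[OF lin V.module_axioms mem])
  also have "\<dots> = (\<Oplus>\<^bsub>?V\<^esub>i\<in>{1..Suc n}. sg i \<odot>\<^bsub>?V\<^esub> ?t i)"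
    using t by (intro V.M.finsum_cong') (auto simp: face)
  also have "\<dots> = (\<Oplus>\<^bsub>?V\<^esub>i\<in>{0..Suc n}. sg i \<odot>\<^bsub>?V\<^esub> ?t i)"
  proof (rule V.M.add.finprod_mono_neutral_cong_left)
    show "sg i \<odot>\<^bsub>?V\<^esub> ?t i = \<zero>\<^bsub>?V\<^esub>" if "i \<in> {0..Suc n} - {1..Suc n}" for i
    proof -
      have "i = 0" using that by auto
      then show ?thesis by (simp add: t0)
    qed
  qed (use t in auto)
  also have "\<dots> = mcd n \<alpha> xs"
    by (rule mc_differential_apply[OF \<alpha>' fc, symmetric])
  finally show ?thesis by simp
qed

lemma mc_differential_NMC:
  assumes "\<alpha> \<in> carrier (NMC n)"
  shows "mcd n \<alpha> \<in> carrier (NMC (Suc n))"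
  unfolding carrier_normalised_MC
  using mc_differential_closed[OF NMC_closed(1)[OF assms]] mc_differential_degenerate[OF assms] by blast

end

section \<open>Normalised cochains against morphisms from the encoded bar complex\<close>

locale encoded_cochains = magnitude_cochains K X d G M l + encoded_bar K X d G e v
  for K :: "('k, 'z) ring_scheme" (structure) and X :: "'x set" and d G
    and M :: "('x, 'k, 'm) distance_module" and l :: real
    and e :: "('x list \<Rightarrow> 'k) \<Rightarrow> 'p" and v
begin

definition cochain_hom :: "nat \<Rightarrow> ('x list \<Rightarrow> 'm) \<Rightarrow> 'x \<Rightarrow> real \<Rightarrow> 'p \<Rightarrow> 'm" where
  "cochain_hom n \<alpha> = dm_comp X (ebar n) (bar_ext n N \<alpha>) (dec n)"

lemma cochain_hom_hom:
  "\<alpha> \<in> carrier (NMC n) \<Longrightarrow> cochain_hom n \<alpha> \<in> dm_hom K X d (ebar n) N"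
  unfolding cochain_hom_def by (rule dm_comp_hom[OF ebar_module dec_hom bar_ext_hom[OF N NMC_closed(3)]])

lemma cochain_hom_apply:
  "\<lbrakk>y \<in> X; f \<in> free_carrier K (bar_chains X d n y g)\<rbrakk> \<Longrightarrow> cochain_hom n \<alpha> y g (e f) = bar_ext n N \<alpha> y g f"
  by (simp add: cochain_hom_def)

lemma encoded_gen:
  "xs \<in> bar_gens n \<Longrightarrow> e (delta K xs) \<in> carrier (fib (ebar n) (last xs) (clen d xs))"
  using free_carrier_delta[OF bar_gensD(1)] by auto

lemma cochain_hom_gen:
  "\<lbrakk>\<alpha> \<in> carrier (NMC n); xs \<in> bar_gens n\<rbrakk> \<Longrightarrow> cochain_hom n \<alpha> (last xs) (clen d xs) (e (delta K xs)) = \<alpha> xs"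
  using cochain_hom_apply[OF bar_gensD(2) free_carrier_delta[OF bar_gensD(1)]] bar_ext_gen[OF N NMC_closed(3)]
  by simp

lemma cochain_hom_linear: "cochain_hom n \<in> linear_maps K (NMC n) (dm_hom_module K X d (ebar n) N)"
proof (rule linear_mapsI)
  interpret NM: module K "NMC n" by (rule module_normalised_MC)
  note homs = cochain_hom_hom
  show "cochain_hom n \<alpha> \<in> carrier (dm_hom_module K X d (ebar n) N)" if "\<alpha> \<in> carrier (NMC n)" for \<alpha>
    using homs[OF that] by simp
  show "cochain_hom n (\<alpha> \<oplus>\<^bsub>NMC n\<^esub> \<beta>) = cochain_hom n \<alpha> \<oplus>\<^bsub>dm_hom_module K X d (ebar n) N\<^esub> cochain_hom n \<beta>"
    if ab: "\<alpha> \<in> carrier (NMC n)" "\<beta> \<in> carrier (NMC n)" for \<alpha> \<beta>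
    unfolding dm_hom_module_simps
  proof (rule ebar_hom_eqI[OF N homs[OF NM.M.a_closed[OF ab]] dm_add_hom[OF ebar_module N homs[OF ab(1)] homs[OF ab(2)]]])
    fix xs assume xs: "xs \<in> bar_gens n"
    show "cochain_hom n (\<alpha> \<oplus>\<^bsub>NMC n\<^esub> \<beta>) (last xs) (clen d xs) (e (delta K xs)) =
      dm_fun X (ebar n) (\<lambda>x g m. cochain_hom n \<alpha> x g m \<oplus>\<^bsub>fib N x g\<^esub> cochain_hom n \<beta> x g m)
        (last xs) (clen d xs) (e (delta K xs))"
      using xs cochain_hom_gen[OF NM.M.a_closed[OF ab] xs] encoded_gen[OF xs] bar_gensD(2)[OF xs]
      by (simp del: carrier_ebar add: cochain_hom_gen[OF ab(1)] cochain_hom_gen[OF ab(2)] bar_gens_iff mc_coeff_eq)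
  qed
  show "cochain_hom n (c \<odot>\<^bsub>NMC n\<^esub> \<alpha>) = c \<odot>\<^bsub>dm_hom_module K X d (ebar n) N\<^esub> cochain_hom n \<alpha>"
    if ca: "c \<in> carrier K" "\<alpha> \<in> carrier (NMC n)" for c \<alpha>
    unfolding dm_hom_module_simps
  proof (rule ebar_hom_eqI[OF N homs[OF NM.smult_closed[OF ca]] dm_smult_hom[OF ebar_module N homs[OF ca(2)] ca(1)]])
    fix xs assume xs: "xs \<in> bar_gens n"
    show "cochain_hom n (c \<odot>\<^bsub>NMC n\<^esub> \<alpha>) (last xs) (clen d xs) (e (delta K xs)) =
      dm_fun X (ebar n) (\<lambda>x g m. c \<odot>\<^bsub>fib N x g\<^esub> cochain_hom n \<alpha> x g m)
        (last xs) (clen d xs) (e (delta K xs))"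
      using xs cochain_hom_gen[OF NM.smult_closed[OF ca] xs] encoded_gen[OF xs] bar_gensD(2)[OF xs]
      by (simp del: carrier_ebar add: cochain_hom_gen[OF ca(2)] bar_gens_iff mc_coeff_eq)
  qed
qed

lemma cochain_hom_bij: "bij_betw (cochain_hom n) (carrier (NMC n)) (dm_hom K X d (ebar n) N)"
  unfolding bij_betw_def
proof (intro conjI inj_onI equalityI subsetI)
  show "\<alpha> = \<beta>" if "\<alpha> \<in> carrier (NMC n)" "\<beta> \<in> carrier (NMC n)" "cochain_hom n \<alpha> = cochain_hom n \<beta>" for \<alpha> \<beta>
  proof (rule NMC_eqI[OF that(1,2)])
    show "\<alpha> xs = \<beta> xs" if "xs \<in> bar_gens n" for xs
      using cochain_hom_gen[OF \<open>\<alpha> \<in> _\<close> that] cochain_hom_gen[OF \<open>\<beta> \<in> _\<close> that]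
      by (simp add: \<open>cochain_hom n \<alpha> = _\<close>)
  qed
  show "\<phi> \<in> dm_hom K X d (ebar n) N" if "\<phi> \<in> cochain_hom n ` carrier (NMC n)" for \<phi>
    using that cochain_hom_hom by auto
  fix \<phi> assume \<phi>: "\<phi> \<in> dm_hom K X d (ebar n) N"
  \<comment> \<open>The preimage of \<phi>: its values on the generators, continued by zero to the
    degenerate chains as normalisation demands.\<close>
  let ?\<alpha> = "\<lambda>xs\<in>finite_chains X d n. if nondeg xs then \<phi> (last xs) (clen d xs) (e (delta K xs))
    else \<zero>\<^bsub>mc_coeff d M l xs\<^esub>"
  have gen: "\<phi> (last xs) (clen d xs) (e (delta K xs)) \<in> carrier (mc_coeff d M l xs)"
    if "xs \<in> bar_gens n" for xs
    unfolding mc_coeff_eq by (rule dm_hom_closed[OF \<phi> bar_gensD(2)[OF that] encoded_gen[OF that]])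
  have zero: "\<zero>\<^bsub>mc_coeff d M l xs\<^esub> \<in> carrier (mc_coeff d M l xs)" if "xs \<in> finite_chains X d n" for xs
    using finite_chainsD(6)[OF that] by (simp add: module_def abelian_group_def abelian_monoid.zero_closed)
  have \<alpha>: "?\<alpha> \<in> carrier (NMC n)"
    unfolding carrier_normalised_MC using gen zero by (auto simp: bar_gens_iff)
  have "\<phi> = cochain_hom n ?\<alpha>"
    by (rule ebar_hom_eqI[OF N \<phi> cochain_hom_hom[OF \<alpha>]])
      (simp add: cochain_hom_gen[OF \<alpha>], simp add: bar_gens_iff)
  then show "\<phi> \<in> cochain_hom n ` carrier (NMC n)"
    by (rule image_eqI[OF _ \<alpha>])
qed

lemma mcd_cochain_hom:
  assumes \<alpha>: "\<alpha> \<in> carrier (NMC n)" and xs: "xs \<in> bar_gens (Suc n)"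
  shows "mcd n \<alpha> xs = cochain_hom n \<alpha> (last xs) (clen d xs) (ebar_diff n (last xs) (clen d xs) (e (delta K xs)))"
proof -
  have dx: "delta K xs \<in> free_carrier K (bar_chains X d (Suc n) (last xs) (clen d xs))"
    by (rule free_carrier_delta[OF bar_gensD(1)[OF xs]])
  show ?thesis
    using bar_gensD(2)[OF xs] dx
    by (simp add: mc_differential_gen[OF \<alpha> xs] cochain_hom_apply[OF _ bar_diff_closed])
qed

text \<open>Morphisms from a bar module are compared on generators, and there the magnitude
  differential has just been expressed through the bar differential.\<close>

lemma cochain_hom_chain:
  assumes \<alpha>: "\<alpha> \<in> carrier (NMC n)"
  shows "cochain_hom (Suc n) (mcd n \<alpha>) = dm_comp X (ebar (Suc n)) (cochain_hom n \<alpha>) (ebar_diff n)"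
proof (rule ebar_hom_eqI[OF N cochain_hom_hom[OF mc_differential_NMC[OF \<alpha>]]
      dm_comp_hom[OF ebar_module ebar_diff_hom cochain_hom_hom[OF \<alpha>]]])
  fix xs assume xs: "xs \<in> bar_gens (Suc n)"
  show "cochain_hom (Suc n) (mcd n \<alpha>) (last xs) (clen d xs) (e (delta K xs)) =
      dm_comp X (ebar (Suc n)) (cochain_hom n \<alpha>) (ebar_diff n) (last xs) (clen d xs) (e (delta K xs))"
    using cochain_hom_gen[OF mc_differential_NMC[OF \<alpha>] xs] mcd_cochain_hom[OF \<alpha> xs] encoded_gen[OF xs]
      bar_gensD(2)[OF xs] by (simp del: carrier_ebar)
qed

text \<open>At a generator the differential evaluates \<open>cochain_hom n\<close> at a fixed
  boundary, so linearity is inherited from \<open>cochain_hom_linear\<close>; on degenerate chains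
  both sides are zero.\<close>

lemma mc_differential_linear: "mcd n \<in> linear_maps K (NMC n) (NMC (Suc n))"
proof (rule linear_mapsI)
  interpret NM: module K "NMC n" by (rule module_normalised_MC)
  interpret NM': module K "NMC (Suc n)" by (rule module_normalised_MC)
  show "mcd n \<alpha> \<in> carrier (NMC (Suc n))" if "\<alpha> \<in> carrier (NMC n)" for \<alpha>
    by (rule mc_differential_NMC[OF that])
  let ?m = "\<lambda>xs. ebar_diff n (last xs) (clen d xs) (e (delta K xs))"
  have m: "?m xs \<in> carrier (fib (ebar n) (last xs) (clen d xs))" if "xs \<in> bar_gens (Suc n)" for xs
    by (rule dm_hom_closed[OF ebar_diff_hom bar_gensD(2)[OF that] encoded_gen[OF that]])
  show "mcd n (\<alpha> \<oplus>\<^bsub>NMC n\<^esub> \<beta>) = mcd n \<alpha> \<oplus>\<^bsub>NMC (Suc n)\<^esub> mcd n \<beta>"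
    if ab: "\<alpha> \<in> carrier (NMC n)" "\<beta> \<in> carrier (NMC n)" for \<alpha> \<beta>
  proof (rule NMC_eqI[OF mc_differential_NMC[OF NM.M.a_closed[OF ab]]
        NM'.M.a_closed[OF mc_differential_NMC[OF ab(1)] mc_differential_NMC[OF ab(2)]]])
    fix xs assume xs: "xs \<in> bar_gens (Suc n)"
    have "cochain_hom n (\<alpha> \<oplus>\<^bsub>NMC n\<^esub> \<beta>) (last xs) (clen d xs) (?m xs) =
        cochain_hom n \<alpha> (last xs) (clen d xs) (?m xs) \<oplus>\<^bsub>fib N (last xs) (clen d xs)\<^esub>
        cochain_hom n \<beta> (last xs) (clen d xs) (?m xs)"
      using linear_maps_add[OF cochain_hom_linear ab] m[OF xs] bar_gensD(2)[OF xs]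
      by (simp del: carrier_ebar normalised_MC_simps)
    then show "mcd n (\<alpha> \<oplus>\<^bsub>NMC n\<^esub> \<beta>) xs = (mcd n \<alpha> \<oplus>\<^bsub>NMC (Suc n)\<^esub> mcd n \<beta>) xs"
      using xs unfolding mcd_cochain_hom[OF NM.M.a_closed[OF ab] xs]
      by (simp add: mcd_cochain_hom[OF ab(1) xs] mcd_cochain_hom[OF ab(2) xs] bar_gens_iff mc_coeff_eq)
  qed
  show "mcd n (c \<odot>\<^bsub>NMC n\<^esub> \<alpha>) = c \<odot>\<^bsub>NMC (Suc n)\<^esub> mcd n \<alpha>"
    if ca: "c \<in> carrier K" "\<alpha> \<in> carrier (NMC n)" for c \<alpha>
  proof (rule NMC_eqI[OF mc_differential_NMC[OF NM.smult_closed[OF ca]]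
        NM'.smult_closed[OF ca(1) mc_differential_NMC[OF ca(2)]]])
    fix xs assume xs: "xs \<in> bar_gens (Suc n)"
    have "cochain_hom n (c \<odot>\<^bsub>NMC n\<^esub> \<alpha>) (last xs) (clen d xs) (?m xs) =
        c \<odot>\<^bsub>fib N (last xs) (clen d xs)\<^esub> cochain_hom n \<alpha> (last xs) (clen d xs) (?m xs)"
      using linear_maps_smult[OF cochain_hom_linear ca] m[OF xs] bar_gensD(2)[OF xs]
      by (simp del: carrier_ebar normalised_MC_simps)
    then show "mcd n (c \<odot>\<^bsub>NMC n\<^esub> \<alpha>) xs = (c \<odot>\<^bsub>NMC (Suc n)\<^esub> mcd n \<alpha>) xs"
      using xs unfolding mcd_cochain_hom[OF NM.smult_closed[OF ca] xs]
      by (simp add: mcd_cochain_hom[OF ca(2) xs] bar_gens_iff mc_coeff_eq)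
  qed
qed

theorem MH_iso_bar_cohomology:
  "module_iso K (MH X d n l M) (cohomology (hom_complex K X d ebar N) (hom_diff X ebar ebar_diff) n)"
  unfolding MH_def
proof (rule cohomology_module_iso_chain_iso[where f = cochain_hom])
  show "module K (NMC i)" for i by (rule module_normalised_MC)
  show "mcd i \<in> linear_maps K (NMC i) (NMC (Suc i))" for i by (rule mc_differential_linear)
  show "module K (hom_complex K X d ebar N i)" for i
    by (rule hom_complex_module[OF is_cring ebar_resolution N])
  show "hom_diff X ebar ebar_diff i \<in> linear_maps K (hom_complex K X d ebar N i) (hom_complex K X d ebar N (Suc i))" for i
    by (rule hom_diff_linear[OF ebar_resolution])
  show "cochain_hom i \<in> linear_maps K (NMC i) (hom_complex K X d ebar N i)" for i
    by (rule cochain_hom_linear)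
  show "bij_betw (cochain_hom i) (carrier (NMC i)) (carrier (hom_complex K X d ebar N i))" for i
    using cochain_hom_bij by simp
  show "cochain_hom (Suc i) (mcd i \<alpha>) = hom_diff X ebar ebar_diff i (cochain_hom i \<alpha>)"
    if "\<alpha> \<in> carrier (NMC i)" for i \<alpha>
    by (rule cochain_hom_chain[OF that])
qed

end

section \<open>Passage from the bar resolution to the chosen one\<close>

theorem corollary4p10:
  fixes K :: "('k, 'z) ring_scheme"
    and X :: "'x set"
    and d :: "'x \<Rightarrow> 'x \<Rightarrow> ennreal"
    and G :: "real set"
    and M :: "('x, 'k, 'm) distance_module"
    and n :: nat
    and l :: real
  assumes "cring K"
    and "quasimetric_space X d"
    and "subgroup G real_add_group"
    and "\<And>x y. \<lbrakk>x \<in> X; y \<in> X; d x y < \<infinity>\<rbrakk> \<Longrightarrow> enn2real (d x y) \<in> G"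
    and "graded_distance_module K X d G M"
    and "l \<in> G"
  shows "module_iso K (MH X d n l M) (Ext K X d G n (trivial_distance_module K) (shift M l))"
proof -
  obtain e :: "('x list \<Rightarrow> 'k) \<Rightarrow> ('x, 'k, 'k) resolution_elem" where e: "inj_on e (free_carrier K UNIV)"
    using ex_encoding .
  let ?v = "inv_into (free_carrier K UNIV) e"
  interpret graded_quasimetric K X d G
    using assms(1-4) by (intro graded_quasimetric.intro graded_quasimetric_axioms.intro)
  interpret magnitude_cochains K X d G M l
    using graded_imp_distance_module[OF assms(5)] by unfold_locales
  interpret encoded_cochains K X d G M l e ?v
    using e by unfold_locales simp
  \<comment> \<open>An injection of the elements of the trivial module into the element type of the
    resolutions, used to lift against augmentations; it is the one-letter list in the last
    summand.\<close>
  let ?j = "\<lambda>k. [Inr (Inr (Inr k))] :: ('x, 'k, 'k) resolution_elem"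
  have j: "inj ?j" by (rule injI) simp
  let ?R = "\<lambda>(P :: nat \<Rightarrow> ('x, 'k, ('x, 'k, 'k) resolution_elem) distance_module, D, \<epsilon>). projective_resolution K X d G triv P D \<epsilon>"
  define S where "S = (SOME S. ?R S)"
  obtain P D \<epsilon> where S: "S = (P, D, \<epsilon>)" by (cases S)
  \<comment> \<open>The existence of this one resolution makes the chosen one a resolution as
    well.\<close>
  have "?R (ebar, ebar_diff, ebar_aug)"
    using ebar_resolution by simp
  then have "?R S"
    unfolding S_def by (rule someI)
  then have P: "projective_resolution K X d G triv P D \<epsilon>"
    by (simp add: S)
  have "Ext K X d G n triv N = cohomology (hom_complex K X d P N) (hom_diff X P D) n"
    using S unfolding Ext_def S_def by simp
  \<comment> \<open>The two isomorphisms meet in the cohomology of the Hom complex of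
    \<open>ebar\<close>.\<close>
  then show ?thesis
    using module_iso_trans[OF MH_iso_bar_cohomology
      resolution_independent[OF is_cring graded_triv j P ebar_resolution N]] by simp
qed

end
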